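(* Let $X$ be a compactum with $\dim_{\mathbb Q} X=1$ and $\dim X=n$. Then there exist a compactum $Z$ and a free continuous action of an abelian Cantor group $\Gamma$ on $Z$ such that the orbit space $Z/\Gamma$ is homeomorphic to $X$ and (i) $\dim Z\le n-1$ if $2\le n\le 6$, and (ii) $\dim Z\le \lfloor n/2\rfloor+2$ if $n\ge 7$.
   Context: A compactum is a compact metric space; $\dim$ is covering dimension. For an abelian group $G$, $\dim_G X$ is the smallest integer $n$ such that Čech cohomology $H^{n+1}(X,A;G)=0$ for every closed $A\subseteq X$. A Cantor group is a topological group homeomorphic to the Cantor set. *)

theory Defs
  imports "HOL-Analysis.Analysis" "HOL-Algebra.Group"
begin

definition finite_open_cover :: "'a topology \<Rightarrow> 'a set set \<Rightarrow> bool" where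
  "finite_open_cover X \<U> \<equiv>
     finite \<U> \<and> (\<forall>U\<in>\<U>. openin X U) \<and> \<Union>\<U> = topspace X"

definition covering_dim_le :: "'a topology \<Rightarrow> int \<Rightarrow> bool" where
  "covering_dim_le X n \<equiv>
     \<forall>\<U>. finite_open_cover X \<U> \<longrightarrow>
       (\<exists>\<V>. finite_open_cover X \<V> \<and> (\<forall>V\<in>\<V>. \<exists>U\<in>\<U>. V \<subseteq> U) \<and>
            (\<forall>x\<in>topspace X. int (card {V\<in>\<V>. x \<in> V}) \<le> n + 1))"

definition covering_dim :: "'a topology \<Rightarrow> int \<Rightarrow> bool" where
  "covering_dim X n \<equiv> covering_dim_le X n \<and> \<not> covering_dim_le X (n - 1)"

text \<open>Ordered simplices of the nerve of a cover: nonempty lists of members with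
  nonempty common intersection.\<close>
definition nerve_tuple :: "'a topology \<Rightarrow> 'a set set \<Rightarrow> 'a set list \<Rightarrow> bool" where
  "nerve_tuple X \<U> s \<equiv> s \<noteq> [] \<and> set s \<subseteq> \<U> \<and> topspace X \<inter> \<Inter>(set s) \<noteq> {}"

definition coboundary :: "('a set list \<Rightarrow> rat) \<Rightarrow> 'a set list \<Rightarrow> rat" where
  "coboundary c s = (\<Sum>i<length s. (-1) ^ i * c (take i s @ drop (Suc i) s))"

definition rel_cochain :: "'a topology \<Rightarrow> 'a set \<Rightarrow> 'a set set \<Rightarrow> nat \<Rightarrow> ('a set list \<Rightarrow> rat) \<Rightarrow> bool" where
  "rel_cochain X A \<U> k c \<equiv>
     \<forall>s. nerve_tuple X \<U> s \<and> length s = Suc k \<and> A \<inter> \<Inter>(set s) \<noteq> {} \<longrightarrow> c s = 0"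

definition rel_cocycle :: "'a topology \<Rightarrow> 'a set \<Rightarrow> 'a set set \<Rightarrow> nat \<Rightarrow> ('a set list \<Rightarrow> rat) \<Rightarrow> bool" where
  "rel_cocycle X A \<U> k c \<equiv> rel_cochain X A \<U> k c \<and>
     (\<forall>s. nerve_tuple X \<U> s \<and> length s = Suc (Suc k) \<longrightarrow> coboundary c s = 0)"

definition rel_coboundary :: "'a topology \<Rightarrow> 'a set \<Rightarrow> 'a set set \<Rightarrow> nat \<Rightarrow> ('a set list \<Rightarrow> rat) \<Rightarrow> bool" where
  "rel_coboundary X A \<U> k c \<equiv>
     (if k = 0 then (\<forall>s. nerve_tuple X \<U> s \<and> length s = 1 \<longrightarrow> c s = 0)
      else (\<exists>b. rel_cochain X A \<U> (k - 1) b \<and>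
              (\<forall>s. nerve_tuple X \<U> s \<and> length s = Suc k \<longrightarrow> c s = coboundary b s)))"

text \<open>H^k(X,A;Q) = 0 for the Cech cohomology (direct limit over finite open covers of the
  simplicial cohomology of the nerve pairs): every class at some cover becomes zero after
  pulling back along a refinement projection.\<close>
definition cech_vanishes :: "'a topology \<Rightarrow> 'a set \<Rightarrow> nat \<Rightarrow> bool" where
  "cech_vanishes X A k \<equiv>
     \<forall>\<U> c. finite_open_cover X \<U> \<and> rel_cocycle X A \<U> k c \<longrightarrow>
       (\<exists>\<V> p. finite_open_cover X \<V> \<and> (\<forall>V\<in>\<V>. p V \<in> \<U> \<and> V \<subseteq> p V) \<and>
              rel_coboundary X A \<V> k (\<lambda>s. c (map p s)))"

definition rat_cohom_dim_le :: "'a topology \<Rightarrow> nat \<Rightarrow> bool" where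
  "rat_cohom_dim_le X n \<equiv> \<forall>A. closedin X A \<longrightarrow> cech_vanishes X A (Suc n)"

text \<open>dim_Q X = 1 (smallest n with H^{n+1}(X,A;Q)=0 for all closed A is 1; the case n=-1
  only happens for empty X, which is excluded by not (dim_Q X \<le> 0)).\<close>
definition rat_cohom_dim_one :: "'a topology \<Rightarrow> bool" where
  "rat_cohom_dim_one X \<equiv> rat_cohom_dim_le X 1 \<and> \<not> rat_cohom_dim_le X 0"

definition compactum :: "'a topology \<Rightarrow> bool" where
  "compactum X \<equiv> compact_space X \<and> metrizable_space X"

definition cantor_space :: "(nat \<Rightarrow> bool) topology" where
  "cantor_space = product_topology (\<lambda>_. discrete_topology (UNIV :: bool set)) UNIV"

definition abelian_cantor_group :: "('g, 'b) monoid_scheme \<Rightarrow> 'g topology \<Rightarrow> bool" where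
  "abelian_cantor_group G T \<equiv> comm_group G \<and> topspace T = carrier G \<and>
     continuous_map (prod_topology T T) T (\<lambda>(x, y). x \<otimes>\<^bsub>G\<^esub> y) \<and>
     continuous_map T T (\<lambda>x. inv\<^bsub>G\<^esub> x) \<and>
     T homeomorphic_space cantor_space"

definition free_continuous_action ::
    "('g, 'b) monoid_scheme \<Rightarrow> 'g topology \<Rightarrow> 'z topology \<Rightarrow> ('g \<Rightarrow> 'z \<Rightarrow> 'z) \<Rightarrow> bool" where
  "free_continuous_action G T Z act \<equiv>
     (\<forall>g\<in>carrier G. \<forall>z\<in>topspace Z. act g z \<in> topspace Z) \<and>
     (\<forall>z\<in>topspace Z. act \<one>\<^bsub>G\<^esub> z = z) \<and>
     (\<forall>g\<in>carrier G. \<forall>h\<in>carrier G. \<forall>z\<in>topspace Z. act (g \<otimes>\<^bsub>G\<^esub> h) z = act g (act h z)) \<and>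
     continuous_map (prod_topology T Z) Z (\<lambda>(g, z). act g z) \<and>
     (\<forall>g\<in>carrier G. \<forall>z\<in>topspace Z. act g z = z \<longrightarrow> g = \<one>\<^bsub>G\<^esub>)"

definition orbits :: "('g, 'b) monoid_scheme \<Rightarrow> 'z topology \<Rightarrow> ('g \<Rightarrow> 'z \<Rightarrow> 'z) \<Rightarrow> 'z set set" where
  "orbits G Z act = {{act g z | g. g \<in> carrier G} | z. z \<in> topspace Z}"

definition orbit_space ::
    "('g, 'b) monoid_scheme \<Rightarrow> 'z topology \<Rightarrow> ('g \<Rightarrow> 'z \<Rightarrow> 'z) \<Rightarrow> 'z set topology" where
  "orbit_space G Z act = topology (\<lambda>\<O>. \<O> \<subseteq> orbits G Z act \<and> openin Z (\<Union>\<O>))"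

end

(*
  Fix countably many maps F j from X to the circle that are dense among all such maps, and let Z
  be the space of points x of X together with an M j-th root of F j x for every j, where every
  pair of a map and an exponent occurs. The product of the groups of M j-th roots of unity acts
  freely on Z with orbit space X.

  Since H^2(X, A; Q) = 0, a circle-valued map on a closed subset A of X has a power that extends
  over X up to a null-homotopic factor; pulled back to Z, where this extension has roots, the map
  itself extends.

  To see that dim Z is at most r + 1, one moves a given map from Z to R^(r+2) off the origin. It
  may be assumed to factor through a finite stage of the tower, which covers X with separated
  fibres. In general position the zero set P of the first r coordinates of the map on the stage
  either maps injectively to X (if 2r > n), or is a union of sheets that do so, where the last two
  coordinates have no common zero on the overlaps of the sheets (if n = r + 2). Over P the last
  two coordinates, where not both zero, give circle-valued maps on closed subsets of X, which
  extend over Z; so these two coordinates can be changed to have no common zero over P.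
*)

theory Submission
  imports Defs
begin

subsection \<open>General position in finite-dimensional compacta\<close>

text \<open>The obstacle is that circle-valued maps are only known to extend if they are pulled back
  from closed subsets of X, not if they live on a stage of the tower. So the zero set
  \<open>P\<close> has to be cut into pieces on which the projection to X is injective; there the
  last two coordinates become functions on closed subsets of X. The numbers come from counting
  functions against the dimension n of the base. Two disjoint sheets carry \<open>2 * r\<close>
  functions over the same base points, generically without a common zero if
  \<open>2 * r > n\<close>. If \<open>n = r + 2\<close>, all \<open>n\<close> coordinates and one
  cutting function make \<open>n + 1\<close> functions on a single sheet. The choices
  \<open>r = n div 2 + 1\<close> and \<open>r = n - 2\<close> give the bounds
  \<open>n div 2 + 2\<close> and \<open>n - 1\<close>; the second is at most the first exactly for
  \<open>n \<le> 6\<close>. Countably many maps are enough because circle-valued maps at distance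
  below \<open>1\<close> have a quotient with a continuous logarithm, which can be divided by any
  exponent.\<close>

lemma finite_common_radius:
  assumes "finite I"
    and "\<And>i. i \<in> I \<Longrightarrow> \<exists>d>0. \<forall>d'. 0 < d' \<and> d' \<le> d \<longrightarrow> Q i d'"
  shows "\<exists>d>(0::real). \<forall>i\<in>I. \<forall>d'. 0 < d' \<and> d' \<le> d \<longrightarrow> Q i d'"
  using assms
proof (induction I rule: finite_induct)
  case empty
  then show ?case by (auto intro: exI[of _ 1])
next
  case (insert i I)
  obtain d1 where "d1 > 0" "\<forall>j\<in>I. \<forall>d'. 0 < d' \<and> d' \<le> d1 \<longrightarrow> Q j d'"
    using insert by auto
  moreover obtain d2 where "d2 > 0" "\<forall>d'. 0 < d' \<and> d' \<le> d2 \<longrightarrow> Q i d'"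
    using insert.prems[of i] by auto
  ultimately show ?case
    by (intro exI[of _ "min d1 d2"]) auto
qed

lemma uniformly_continuous_finite_family:
  fixes h :: "'i \<Rightarrow> 'a::metric_space \<Rightarrow> 'b::metric_space"
  assumes "finite I" "compact K" "\<And>i. i \<in> I \<Longrightarrow> continuous_on K (h i)" "e > 0"
  shows "\<exists>d>0. \<forall>i\<in>I. \<forall>x\<in>K. \<forall>y\<in>K. dist x y < d \<longrightarrow> dist (h i x) (h i y) < e"
proof -
  have "\<exists>d>0. \<forall>i\<in>I. \<forall>d'. 0 < d' \<and> d' \<le> d \<longrightarrow>
      (\<forall>x\<in>K. \<forall>y\<in>K. dist x y < d' \<longrightarrow> dist (h i x) (h i y) < e)"
  proof (rule finite_common_radius)
    fix i assume "i \<in> I"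
    then have "uniformly_continuous_on K (h i)"
      using assms compact_uniformly_continuous by blast
    then obtain d where "d > 0" "\<forall>x\<in>K. \<forall>y\<in>K. dist y x < d \<longrightarrow> dist (h i y) (h i x) < e"
      unfolding uniformly_continuous_on_def using \<open>e > 0\<close> by blast
    then show "\<exists>d>0. \<forall>d'. 0 < d' \<and> d' \<le> d \<longrightarrow>
      (\<forall>x\<in>K. \<forall>y\<in>K. dist x y < d' \<longrightarrow> dist (h i x) (h i y) < e)"
      by (intro exI[of _ d]) auto
  qed fact
  then show ?thesis by (meson order_refl)
qed

lemma compact_pos_lower_bound:
  fixes f :: "'a::topological_space \<Rightarrow> real"
  assumes "compact K" "continuous_on K f" "\<And>x. x \<in> K \<Longrightarrow> f x > 0"
  obtains c where "c > 0" "\<And>x. x \<in> K \<Longrightarrow> f x \<ge> c"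
proof (cases "K = {}")
  case True
  then show ?thesis using that[of 1] by auto
next
  case False
  then show ?thesis using continuous_attains_inf[OF assms(1) False assms(2)] assms(3) that
    by blast
qed

text \<open>The case \<open>S \<subseteq> V\<close> is separate because \<open>infdist\<close> to
  the empty set is \<open>0\<close>, which would make the bump vanish everywhere.\<close>

definition bump :: "'a::metric_space set \<Rightarrow> 'a set \<Rightarrow> 'a \<Rightarrow> real" where
  "bump S V x = (if S \<subseteq> V then 1 else infdist x (S - V))"

lemma continuous_on_bump [continuous_intros]: "continuous_on A (bump S V)"
  unfolding bump_def
  by (cases "S \<subseteq> V") (simp_all only: if_True if_False continuous_on_const continuous_on_infdist continuous_on_id)

lemma bump_nonneg: "bump S V x \<ge> 0"
  unfolding bump_def using infdist_nonneg by auto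

lemma bump_pos_iff:
  assumes "compact S" "openin (top_of_set S) V" "x \<in> S"
  shows "bump S V x > 0 \<longleftrightarrow> x \<in> V"
proof (cases "S \<subseteq> V")
  case True
  then show ?thesis using assms by (auto simp: bump_def)
next
  case False
  have "closedin (top_of_set S) (S - V)"
    using assms(2) by (metis closedin_diff closedin_subtopology_refl topspace_euclidean_subtopology subset_UNIV closedin_topspace)
  then have "closed (S - V)"
    using assms(1) closedin_compact compact_imp_closed by blast
  then have "x \<in> S - V \<longleftrightarrow> infdist x (S - V) = 0"
    using in_closed_iff_infdist_zero[of "S - V" x] False by blast
  then show ?thesis
    using assms(3) False infdist_nonneg[of x "S - V"]
    by (simp add: bump_def) argo
qed

text \<open>Covering dimension in terms of mesh: perturbing functions needs members on which they
  vary little, not the refinement of a given cover.\<close>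

definition fine_covers :: "'a::metric_space set \<Rightarrow> nat \<Rightarrow> bool" where
  "fine_covers S n \<longleftrightarrow> (\<forall>e>0. \<exists>\<V>. finite \<V> \<and>
     (\<forall>V\<in>\<V>. openin (top_of_set S) V \<and> (\<forall>x\<in>V. \<forall>y\<in>V. dist x y < e)) \<and>
     \<Union>\<V> = S \<and> (\<forall>x\<in>S. card {V\<in>\<V>. x \<in> V} \<le> n + 1))"

lemma sum_at_most_one_nonzero:
  fixes f :: "'a \<Rightarrow> real"
  assumes "finite F" "t \<in> F" "\<And>s. s \<in> F \<Longrightarrow> s \<noteq> t \<Longrightarrow> f s = 0"
  shows "sum f F = f t"
proof -
  have "sum f F = sum f {t}"
    using assms by (intro sum.mono_neutral_right) auto
  then show ?thesis by simp
qed

text \<open>Ostrand's decomposition: for a cover of order at most \<open>n + 1\<close> with bump functions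
  \<open>\<phi>\<close>, the sets on which the \<open>\<phi> V\<close> with \<open>V \<in> T\<close> are positive and larger than all
  others are disjoint for distinct \<open>T\<close> of the same size. The family of sets with
  \<open>card T = c + 1\<close> serves to make the \<open>c\<close>-th function nonzero.\<close>

lemma perturb_to_no_common_zero:
  fixes S :: "'a::metric_space set" and h :: "nat \<Rightarrow> 'a \<Rightarrow> real"
  assumes S: "compact S" "fine_covers S n" and E: "closed E" "E \<subseteq> S"
    and h: "\<And>i. i \<le> n \<Longrightarrow> continuous_on E (h i)" and "\<epsilon> > 0"
  obtains h' where "\<And>i. i \<le> n \<Longrightarrow> continuous_on E (h' i)"
    "\<And>i x. i \<le> n \<Longrightarrow> x \<in> E \<Longrightarrow> \<bar>h' i x - h i x\<bar> \<le> \<epsilon>"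
    "\<And>x. x \<in> E \<Longrightarrow> \<exists>i\<le>n. h' i x \<noteq> 0"
proof -
  have cE: "compact E" using E S compact_Int_closed by (metis Int_absorb1)
  obtain \<eta> where \<eta>: "\<eta> > 0"
    "\<And>i x y. i \<le> n \<Longrightarrow> x \<in> E \<Longrightarrow> y \<in> E \<Longrightarrow> dist x y < \<eta> \<Longrightarrow> \<bar>h i x - h i y\<bar> < \<epsilon> / 2"
  proof -
    have "\<exists>d>0. \<forall>i\<in>{..n}. \<forall>x\<in>E. \<forall>y\<in>E. dist x y < d \<longrightarrow> dist (h i x) (h i y) < \<epsilon>/2"
      using cE h \<open>\<epsilon> > 0\<close> by (intro uniformly_continuous_finite_family) auto
    then obtain d where "d > 0" and d: "\<forall>i\<in>{..n}. \<forall>x\<in>E. \<forall>y\<in>E. dist x y < d \<longrightarrow> dist (h i x) (h i y) < \<epsilon>/2"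
      by blast
    show ?thesis
      by (rule that[OF \<open>d > 0\<close>]) (use d in \<open>simp add: dist_real_def\<close>)
  qed
  obtain \<V> where V0: "finite \<V> \<and>
     (\<forall>V\<in>\<V>. openin (top_of_set S) V \<and> (\<forall>x\<in>V. \<forall>y\<in>V. dist x y < \<eta>)) \<and>
     \<Union>\<V> = S \<and> (\<forall>x\<in>S. card {V\<in>\<V>. x \<in> V} \<le> n + 1)"
    using S(2)[unfolded fine_covers_def, THEN spec, THEN mp, OF \<eta>(1)] ..
  then have V: "finite \<V>" "\<And>V. V \<in> \<V> \<Longrightarrow> openin (top_of_set S) V"
      "\<And>V x y. V \<in> \<V> \<Longrightarrow> x \<in> V \<Longrightarrow> y \<in> V \<Longrightarrow> dist x y < \<eta>" "\<Union>\<V> = S"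
      "\<And>x. x \<in> S \<Longrightarrow> card {V\<in>\<V>. x \<in> V} \<le> n + 1"
    by simp_all
  define \<phi> where "\<phi> = bump S"
  have \<phi>0: "\<phi> V x \<ge> 0" for V x by (simp add: \<phi>_def bump_nonneg)
  have \<phi>pos: "\<phi> V x > 0 \<longleftrightarrow> x \<in> V" if "V \<in> \<V>" "x \<in> S" for V x
    using bump_pos_iff S(1) V(2) that by (auto simp: \<phi>_def)
  \<comment> \<open>The double product encodes the comparison with the bumps outside
    \<open>T\<close>. It is empty for \<open>T = \<V>\<close>, and the first product then still
    demands positivity.\<close>
  define g where "g T x = (\<Prod>V\<in>T. \<phi> V x) * (\<Prod>V\<in>T. \<Prod>W\<in>\<V>-T. max 0 (\<phi> V x - \<phi> W x))" for T x
  have gcont: "continuous_on E (g T)" for T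
    unfolding g_def \<phi>_def by (intro continuous_intros)
  have g0: "g T x \<ge> 0" for T x
    unfolding g_def by (intro mult_nonneg_nonneg prod_nonneg) (auto simp: \<phi>0)
  define \<T> where "\<T> c = {T. T \<subseteq> \<V> \<and> card T = Suc c}" for c
  have fT: "finite (\<T> c)" for c using V(1) by (auto simp: \<T>_def)
  have finT: "finite T" if "T \<subseteq> \<V>" for T using that V(1) finite_subset by blast
  have gpos: "g T x > 0 \<longleftrightarrow> (\<forall>V\<in>T. \<phi> V x > 0 \<and> (\<forall>W\<in>\<V>-T. \<phi> V x > \<phi> W x))"
    if "T \<subseteq> \<V>" for T x
  proof -
    have "g T x > 0 \<longleftrightarrow> g T x \<noteq> 0" using g0[of T x] by linarith
    also have "\<dots> \<longleftrightarrow> (\<forall>V\<in>T. \<phi> V x \<noteq> 0 \<and> (\<forall>W\<in>\<V>-T. max 0 (\<phi> V x - \<phi> W x) \<noteq> 0))"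
      unfolding g_def using finT[OF that] V(1) by auto
    also have "\<dots> \<longleftrightarrow> (\<forall>V\<in>T. \<phi> V x > 0 \<and> (\<forall>W\<in>\<V>-T. \<phi> V x > \<phi> W x))"
      using \<phi>0 by (smt (verit, best))
    finally show ?thesis .
  qed
  have disj: "g T' x = 0" if "T \<in> \<T> c" "T' \<in> \<T> c" "T' \<noteq> T" "g T x > 0" for T T' c x
  proof (rule ccontr)
    assume "g T' x \<noteq> 0"
    then have "g T' x > 0" using g0[of T' x] by linarith
    have T: "T \<subseteq> \<V>" "T' \<subseteq> \<V>" "card T = card T'" using that by (auto simp: \<T>_def)
    then have "\<not> T \<subseteq> T'" "\<not> T' \<subseteq> T"
      using that(3) card_subset_eq finT by metis+
    then obtain V W where "V \<in> T" "V \<notin> T'" "W \<in> T'" "W \<notin> T" by blast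
    then show False
      using gpos[OF T(1)] gpos[OF T(2)] that(4) \<open>g T' x > 0\<close> T
      by (smt (verit, best) DiffI subsetD)
  qed
  have ex: "\<exists>c\<le>n. \<exists>T\<in>\<T> c. g T x > 0" if "x \<in> E" for x
  proof -
    have xS: "x \<in> S" using that E by blast
    \<comment> \<open>All members that contain \<open>x\<close>: the other bumps vanish at
      \<open>x\<close>, and the order bound \<open>card T \<le> n + 1\<close> yields an index
      \<open>c \<le> n\<close>.\<close>
    define T where "T = {V\<in>\<V>. x \<in> V}"
    have "T \<subseteq> \<V>" "T \<noteq> {}" using xS V(4) by (auto simp: T_def)
    then have "card T > 0" using finT by (simp add: card_gt_0_iff)
    then obtain c where c: "card T = Suc c" by (metis gr0_implies_Suc)
    have "card T \<le> n + 1" using V(5)[OF xS] by (simp add: T_def)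
    then have "c \<le> n" using c by linarith
    moreover have "T \<in> \<T> c" using c \<open>T \<subseteq> \<V>\<close> by (simp add: \<T>_def)
    moreover have "g T x > 0"
      unfolding gpos[OF \<open>T \<subseteq> \<V>\<close>]
    proof (intro ballI conjI)
      fix V assume "V \<in> T"
      then show "\<phi> V x > 0" using \<phi>pos xS by (auto simp: T_def)
      fix W assume "W \<in> \<V> - T"
      then have "\<not> \<phi> W x > 0" using \<phi>pos xS by (auto simp: T_def)
      with \<open>\<phi> V x > 0\<close> show "\<phi> V x > \<phi> W x" by linarith
    qed
    ultimately show ?thesis by blast
  qed
  define P where "P = (SIGMA c:{..n}. \<T> c)"
  have fP: "finite P" by (auto simp: P_def fT)
  have gsum: "continuous_on E (\<lambda>x. \<Sum>p\<in>P. g (snd p) x)"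
    by (intro continuous_on_sum gcont)
  have gsum_pos: "(\<Sum>p\<in>P. g (snd p) x) > 0" if x: "x \<in> E" for x
  proof -
    obtain c T where "c \<le> n" "T \<in> \<T> c" "g T x > 0" using ex[OF x] by blast
    then show ?thesis
      by (intro sum_pos2[where i="(c,T)"]) (auto simp: P_def fT g0)
  qed
  obtain \<mu> where \<mu>: "\<mu> > 0" "\<And>x. x \<in> E \<Longrightarrow> (\<Sum>p\<in>P. g (snd p) x) \<ge> \<mu>"
    using compact_pos_lower_bound[OF cE gsum gsum_pos] by blast
  \<comment> \<open>Pigeonhole over \<open>P\<close>: if every term were below
    \<open>\<delta>\<close>, the sum would be below \<open>\<mu>\<close>. The \<open>+ 1\<close>
    makes this strict and avoids a division by zero.\<close>
  define \<delta> where "\<delta> = \<mu> / (card P + 1)"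
  have "\<delta> > 0" using \<mu> by (simp add: \<delta>_def)
  have ex\<delta>: "\<exists>c\<le>n. \<exists>T\<in>\<T> c. g T x \<ge> \<delta>" if x: "x \<in> E" for x
  proof (rule ccontr)
    assume "\<not> ?thesis"
    then have "(\<Sum>p\<in>P. g (snd p) x) \<le> (\<Sum>p\<in>P. \<delta>)"
      by (intro sum_mono) (force simp: P_def)
    also have "\<dots> = card P * \<delta>" by simp
    also have "\<dots> < \<mu>" using \<mu>(1) by (simp add: \<delta>_def field_simps)
    finally show False using \<mu>(2)[OF x] by linarith
  qed
  have "\<forall>c T. \<exists>v. c \<le> n \<and> T \<in> \<T> c \<longrightarrow> v \<noteq> 0 \<and> (\<forall>x\<in>E. g T x > 0 \<longrightarrow> \<bar>v - h c x\<bar> \<le> \<epsilon>)"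
  proof (intro allI)
    fix c T
    show "\<exists>v. c \<le> n \<and> T \<in> \<T> c \<longrightarrow> v \<noteq> 0 \<and> (\<forall>x\<in>E. g T x > 0 \<longrightarrow> \<bar>v - h c x\<bar> \<le> \<epsilon>)"
    proof (cases "c \<le> n \<and> T \<in> \<T> c \<and> (\<exists>y\<in>E. g T y > 0)")
      case True
      then obtain y where y: "y \<in> E" "g T y > 0" by blast
      have T: "T \<subseteq> \<V>" "T \<noteq> {}" using True by (auto simp: \<T>_def)
      then obtain V where V': "V \<in> T" "V \<in> \<V>" by blast
      \<comment> \<open>The value of \<open>h c\<close> at a sample point, moved to
        \<open>\<epsilon> / 2\<close> if it is \<open>0\<close>. The other half of
        \<open>\<epsilon>\<close> absorbs the oscillation of \<open>h c\<close> on the member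
        \<open>V\<close>.\<close>
      define v where "v = (if h c y = 0 then \<epsilon> / 2 else h c y)"
      have "\<bar>v - h c x\<bar> \<le> \<epsilon>" if x: "x \<in> E" "g T x > 0" for x
      proof -
        have "\<phi> V x > 0" "\<phi> V y > 0" "x \<in> S" "y \<in> S"
          using gpos[OF T(1)] x y V'(1) E(2) by blast+
        then have "x \<in> V" "y \<in> V" using \<phi>pos[OF V'(2)] by blast+
        then have "dist x y < \<eta>" using V(3)[OF V'(2)] by blast
        then have "\<bar>h c x - h c y\<bar> < \<epsilon>/2" using \<eta>(2) True x y by blast
        moreover have "v = \<epsilon>/2 \<and> h c y = 0 \<or> v = h c y" by (simp add: v_def)
        ultimately show ?thesis using \<open>\<epsilon> > 0\<close> by argo
      qed
      moreover have "v \<noteq> 0" using \<open>\<epsilon> > 0\<close> by (simp add: v_def)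
      ultimately show ?thesis by blast
    next
      case False
      then show ?thesis by (intro exI[of _ 1]) auto
    qed
  qed
  then obtain v where v: "\<And>c T. c \<le> n \<Longrightarrow> T \<in> \<T> c \<Longrightarrow> v c T \<noteq> 0"
    "\<And>c T x. c \<le> n \<Longrightarrow> T \<in> \<T> c \<Longrightarrow> x \<in> E \<Longrightarrow> g T x > 0 \<Longrightarrow> \<bar>v c T - h c x\<bar> \<le> \<epsilon>"
    by metis
  define \<kappa> where "\<kappa> T x = min 1 (g T x / \<delta>)" for T x
  \<comment> \<open>For fixed \<open>c\<close> at most one summand is nonzero at a point. Where
    \<open>g T x \<ge> \<delta>\<close> the weight is \<open>1\<close>, so \<open>h' c x\<close> is
    exactly the nonzero constant \<open>v c T\<close>.\<close>
  define h' where "h' c x = h c x + (\<Sum>T\<in>\<T> c. \<kappa> T x * (v c T - h c x))" for c x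
  have h'_eq: "h' c x = h c x + \<kappa> T x * (v c T - h c x)"
    if "T \<in> \<T> c" "g T x > 0" for c T x
  proof -
    have "(\<Sum>T\<in>\<T> c. \<kappa> T x * (v c T - h c x)) = \<kappa> T x * (v c T - h c x)"
      using disj[OF that(1) _ _ that(2)] by (intro sum_at_most_one_nonzero fT that) (auto simp: \<kappa>_def)
    then show ?thesis by (simp add: h'_def)
  qed
  show ?thesis
  proof (rule that)
    fix i assume "i \<le> n"
    show "continuous_on E (h' i)"
      unfolding h'_def \<kappa>_def using \<open>\<delta> > 0\<close>
      by (intro continuous_intros h gcont \<open>i \<le> n\<close>) auto
    fix x assume "x \<in> E"
    show "\<bar>h' i x - h i x\<bar> \<le> \<epsilon>"
    proof (cases "\<exists>T\<in>\<T> i. g T x > 0")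
      case True
      then obtain T where T: "T \<in> \<T> i" "g T x > 0" by blast
      have "0 \<le> \<kappa> T x" "\<kappa> T x \<le> 1" using T(2) \<open>\<delta> > 0\<close> by (auto simp: \<kappa>_def)
      then have "\<bar>\<kappa> T x * (v i T - h i x)\<bar> \<le> 1 * \<epsilon>"
        unfolding abs_mult using v(2)[OF \<open>i \<le> n\<close> T(1) \<open>x \<in> E\<close> T(2)]
        by (intro mult_mono) auto
      then show ?thesis using h'_eq[OF T] by simp
    next
      case False
      then have "g T x = 0" if "T \<in> \<T> i" for T using g0[of T x] that by force
      then have "h' i x = h i x" by (simp add: h'_def \<kappa>_def)
      then show ?thesis using \<open>\<epsilon> > 0\<close> by simp
    qed
  next
    fix x assume x: "x \<in> E"
    obtain c T where c: "c \<le> n" "T \<in> \<T> c" "g T x \<ge> \<delta>" using ex\<delta>[OF x] by blast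
    then have "\<kappa> T x = 1" "g T x > 0" using \<open>\<delta> > 0\<close> by (auto simp: \<kappa>_def)
    then have "h' c x = v c T" using h'_eq c by simp
    then show "\<exists>i\<le>n. h' i x \<noteq> 0" using c v(1) by metis
  qed
qed

subsection \<open>General position over a base with separated fibres\<close>

definition cont_fam :: "nat \<Rightarrow> 'a::topological_space set \<Rightarrow> (nat \<Rightarrow> 'a \<Rightarrow> real) \<Rightarrow> bool" where
  "cont_fam m Y a \<longleftrightarrow> (\<forall>i<m. continuous_on Y (a i))"

definition near :: "nat \<Rightarrow> 'a set \<Rightarrow> real \<Rightarrow> (nat \<Rightarrow> 'a \<Rightarrow> real) \<Rightarrow> (nat \<Rightarrow> 'a \<Rightarrow> real) \<Rightarrow> bool" where
  "near m Y e a b \<longleftrightarrow> (\<forall>i<m. \<forall>z\<in>Y. \<bar>b i z - a i z\<bar> \<le> e)"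

lemma near_trans: "near m Y d a b \<Longrightarrow> near m Y e b c \<Longrightarrow> near m Y (d + e) a c"
  unfolding near_def
proof (intro allI impI ballI)
  fix i z
  assume *: "\<forall>i<m. \<forall>z\<in>Y. \<bar>b i z - a i z\<bar> \<le> d" "\<forall>i<m. \<forall>z\<in>Y. \<bar>c i z - b i z\<bar> \<le> e" "i < m" "z \<in> Y"
  then have "\<bar>b i z - a i z\<bar> \<le> d" "\<bar>c i z - b i z\<bar> \<le> e" by blast+
  then show "\<bar>c i z - a i z\<bar> \<le> d + e" by linarith
qed

lemma near_mono: "near m Y d a b \<Longrightarrow> d \<le> e \<Longrightarrow> near m Y e a b"
  unfolding near_def by (meson order_trans)

text \<open>A finite Baire argument: each new condition is met by a perturbation so small that
  openness preserves those already met.\<close>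

lemma generic_finite_conditions:
  assumes "finite J"
    and dense: "\<And>c a e. c \<in> J \<Longrightarrow> cont_fam m Y a \<Longrightarrow> e > 0 \<Longrightarrow>
                  \<exists>a'. cont_fam m Y a' \<and> near m Y e a a' \<and> P c a'"
    and "open": "\<And>c a. c \<in> J \<Longrightarrow> cont_fam m Y a \<Longrightarrow> P c a \<Longrightarrow>
                  \<exists>d>0. \<forall>a'. cont_fam m Y a' \<and> near m Y d a a' \<longrightarrow> P c a'"
    and a: "cont_fam m Y a" "e > 0"
  shows "\<exists>a'. cont_fam m Y a' \<and> near m Y e a a' \<and> (\<forall>c\<in>J. P c a')"
  using \<open>finite J\<close> dense "open" \<open>e > 0\<close>
proof (induction J arbitrary: e rule: finite_induct)
  case empty
  then show ?case using a(1) by (intro exI[of _ a]) (auto simp: near_def)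
next
  case (insert c J)
  have "\<exists>a'. cont_fam m Y a' \<and> near m Y (e/2) a a' \<and> (\<forall>c\<in>J. P c a')"
    by (rule insert.IH) (use insert.prems in auto)
  then obtain a1 where a1: "cont_fam m Y a1" "near m Y (e/2) a a1" "\<forall>c\<in>J. P c a1" by blast
  have "\<exists>d>0. \<forall>c\<in>J. \<forall>d'. 0 < d' \<and> d' \<le> d \<longrightarrow>
      (\<forall>a'. cont_fam m Y a' \<and> near m Y d' a1 a' \<longrightarrow> P c a')"
  proof (rule finite_common_radius)
    fix c assume "c \<in> J"
    then obtain d where d: "d > 0" "\<forall>a'. cont_fam m Y a' \<and> near m Y d a1 a' \<longrightarrow> P c a'"
      using insert.prems(2)[of c a1] a1 by auto
    show "\<exists>d>0. \<forall>d'. 0 < d' \<and> d' \<le> d \<longrightarrow>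
        (\<forall>a'. cont_fam m Y a' \<and> near m Y d' a1 a' \<longrightarrow> P c a')"
      using d near_mono by blast
  qed fact
  then obtain d where d: "d > 0"
    "\<And>c d' a'. c \<in> J \<Longrightarrow> 0 < d' \<Longrightarrow> d' \<le> d \<Longrightarrow> cont_fam m Y a' \<Longrightarrow> near m Y d' a1 a' \<Longrightarrow> P c a'"
    by blast
  define e' where "e' = min d (e/2)"
  have e': "e' > 0" "e' \<le> d" "e' \<le> e/2" using d(1) \<open>e > 0\<close> by (auto simp: e'_def)
  obtain a2 where a2: "cont_fam m Y a2" "near m Y e' a1 a2" "P c a2"
    using insert.prems(1)[of c a1 e'] a1 e' by auto
  have "near m Y e a a2"
    using near_trans[OF a1(2) a2(2)] e' by (elim near_mono) auto
  then show ?case using a2 d(2) e' by blast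
qed

text \<open>The \<open>sheets\<close> in \<open>\<A>\<close> are pieces of \<open>Y\<close> mapped injectively by \<open>\<pi>\<close>. A family is nonzero over the
  sheets if over no base point all functions with index in \<open>I\<close> vanish on all the sheets at once.\<close>

definition nonzero_over ::
    "('y \<Rightarrow> 'x) \<Rightarrow> 'y set set \<Rightarrow> nat set \<Rightarrow> (nat \<Rightarrow> 'y \<Rightarrow> real) \<Rightarrow> bool" where
  "nonzero_over \<pi> \<A> I a \<longleftrightarrow>
     (\<forall>x. (\<forall>A\<in>\<A>. x \<in> \<pi> ` A) \<longrightarrow> (\<exists>A\<in>\<A>. \<exists>z\<in>A. \<pi> z = x \<and> (\<exists>i\<in>I. a i z \<noteq> 0)))"

text \<open>Modelled on a finite covering: points of one fibre keep a uniform distance, so every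
  small piece of \<open>Y\<close> is a sheet. The finite stages of the tower are the
  instances.\<close>

locale separated_fibres =
  fixes S :: "'x::metric_space set" and n :: nat
    and Y :: "'y::{metric_space,second_countable_topology} set" and \<pi> :: "'y \<Rightarrow> 'x" and \<delta> :: real
  assumes compact_S: "compact S" and fine: "fine_covers S n"
    and compact_Y: "compact Y" and cont_\<pi>: "continuous_on Y \<pi>" and \<pi>_in: "\<pi> ` Y \<subseteq> S"
    and \<delta>_pos: "\<delta> > 0"
    and separated: "\<And>z z'. z \<in> Y \<Longrightarrow> z' \<in> Y \<Longrightarrow> \<pi> z = \<pi> z' \<Longrightarrow> z \<noteq> z' \<Longrightarrow> dist z z' \<ge> \<delta>"
begin

lemma inj_on_small: 
  assumes "A \<subseteq> Y" "\<And>x. x \<in> A \<Longrightarrow> dist c x < \<delta>/2"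
  shows "inj_on \<pi> A"
proof (rule inj_onI, rule ccontr)
  fix x y assume "x \<in> A" "y \<in> A" "\<pi> x = \<pi> y" "x \<noteq> y"
  then have "dist x y \<ge> \<delta>" using separated assms by blast
  moreover have "dist x y < \<delta>" 
    using assms(2)[OF \<open>x \<in> A\<close>] assms(2)[OF \<open>y \<in> A\<close>] dist_triangle3[of x y c] by linarith
  ultimately show False by linarith
qed

lemma continuous_on_section:
  assumes "compact A" "A \<subseteq> Y" "inj_on \<pi> A"
  shows "continuous_on (\<pi> ` A) (inv_into A \<pi>)"
  using assms by (intro continuous_on_inv continuous_on_subset[OF cont_\<pi>]) auto

text \<open>Read along the sheets, the functions \<open>a i\<close> with \<open>i \<in> I\<close>
  become \<open>card \<A> * card I > n\<close> functions on the common image \<open>E\<close> of the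
  sheets, which can be perturbed to have no common zero. As the sheets are disjoint, the corrections
  on different sheets do not interfere, and Tietze extends them to \<open>Y\<close> with the same
  bound.\<close>

lemma nonzero_over_dense:
  assumes \<A>: "finite \<A>" "\<And>A. A \<in> \<A> \<Longrightarrow> compact A \<and> A \<subseteq> Y \<and> inj_on \<pi> A" "pairwise disjnt \<A>"
    and I: "finite I" "I \<subseteq> {..<m}" and card: "card \<A> * card I > n"
    and a: "cont_fam m Y a" and "e > 0"
  shows "\<exists>a'. cont_fam m Y a' \<and> near m Y e a a' \<and> nonzero_over \<pi> \<A> I a'"
proof -
  define \<sigma> where "\<sigma> A = inv_into A \<pi>" for A
  have \<sigma>: "\<sigma> A x \<in> A" "\<pi> (\<sigma> A x) = x" if "x \<in> \<pi> ` A" for A x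
    using that by (auto simp: \<sigma>_def inv_into_into f_inv_into_f)
  have \<sigma>\<pi>: "\<sigma> A (\<pi> z) = z" if "A \<in> \<A>" "z \<in> A" for A z
    using that \<A>(2) by (simp add: \<sigma>_def)
  have \<sigma>c: "continuous_on (\<pi> ` A) (\<sigma> A)" if "A \<in> \<A>" for A
    unfolding \<sigma>_def using \<A>(2)[OF that] continuous_on_section by blast
  define E where "E = (\<Inter>A\<in>\<A>. \<pi> ` A)"
  have "\<A> \<noteq> {}" using card by auto
  have cpi: "compact (\<pi> ` A)" if "A \<in> \<A>" for A
    using \<A>(2)[OF that] by (intro compact_continuous_image continuous_on_subset[OF cont_\<pi>]) auto
  have clE: "closed E" unfolding E_def using cpi compact_imp_closed by blast
  have EA: "E \<subseteq> \<pi> ` A" if "A \<in> \<A>" for A using that by (auto simp: E_def)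
  have ES: "E \<subseteq> S" using \<open>\<A> \<noteq> {}\<close> EA \<A>(2) \<pi>_in by blast
  have "finite (\<A> \<times> I)" using \<A>(1) I(1) by blast
  \<comment> \<open>\<open>f\<close> numbers the pairs of a sheet and an index; its first
    \<open>n + 1\<close> values supply the functions to be perturbed.\<close>
  then obtain f where f: "bij_betw f {0..<card (\<A> \<times> I)} (\<A> \<times> I)"
    using ex_bij_betw_nat_finite by blast
  have n: "{..n} \<subseteq> {0..<card (\<A> \<times> I)}" using card by (auto simp: card_cartesian_product)
  have inj: "inj_on f {..n}" using f n inj_on_subset by (metis bij_betw_def)
  define sh where "sh j = fst (f j)" for j
  define ix where "ix j = snd (f j)" for j
  have "f j \<in> \<A> \<times> I" if "j \<le> n" for j
    using f n that by (meson atMost_iff bij_betw_apply subsetD)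
  then have shA: "sh j \<in> \<A>" and ixI: "ix j \<in> I" if "j \<le> n" for j
    using that by (auto simp: sh_def ix_def mem_Times_iff)
  define h where "h j x = a (ix j) (\<sigma> (sh j) x)" for j x
  have hc: "continuous_on E (h j)" if "j \<le> n" for j
  proof -
    have A: "sh j \<in> \<A>" and "ix j < m" using shA ixI I that by auto
    then have "continuous_on Y (a (ix j))" using a by (simp add: cont_fam_def)
    moreover have "\<sigma> (sh j) ` E \<subseteq> Y" using EA[OF A] \<sigma>(1) \<A>(2)[OF A] by blast
    ultimately show ?thesis
      unfolding h_def using continuous_on_compose2 continuous_on_subset[OF \<sigma>c[OF A] EA[OF A]]
      by blast
  qed
  obtain h' where h': "\<And>i. i \<le> n \<Longrightarrow> continuous_on E (h' i)"
    "\<And>i x. i \<le> n \<Longrightarrow> x \<in> E \<Longrightarrow> \<bar>h' i x - h i x\<bar> \<le> e"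
    "\<And>x. x \<in> E \<Longrightarrow> \<exists>i\<le>n. h' i x \<noteq> 0"
    using perturb_to_no_common_zero[where h=h, OF compact_S fine clE ES hc \<open>e > 0\<close>] by blast
  define B where "B j = {z \<in> sh j. \<pi> z \<in> E}" for j
  have B: "B j \<subseteq> Y" "closed (B j)" if "j \<le> n" for j
  proof -
    have A: "compact (sh j)" "sh j \<subseteq> Y" using \<A>(2) shA[OF that] by auto
    then show "B j \<subseteq> Y" by (auto simp: B_def)
    have "closedin (top_of_set (sh j)) (sh j \<inter> \<pi> -` E)"
      using A clE by (intro continuous_closedin_preimage continuous_on_subset[OF cont_\<pi>])
    moreover have "sh j \<inter> \<pi> -` E = B j" by (auto simp: B_def)
    ultimately show "closed (B j)"
      using A closedin_closed_trans compact_imp_closed by metis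
  qed
  have "\<exists>g. continuous_on Y g \<and> (\<forall>z\<in>Y. \<bar>g z\<bar> \<le> e) \<and>
      (\<forall>j\<le>n. ix j = i \<longrightarrow> (\<forall>z\<in>B j. g z = h' j (\<pi> z) - a i z))" if "i < m" for i
  proof -
    define J where "J = {j\<in>{..n}. ix j = i}"
    \<comment> \<open>Well defined: for fixed \<open>i\<close>, disjointness of the sheets and
      injectivity of \<open>f\<close> leave only one \<open>j\<close> with
      \<open>z \<in> B j\<close>.\<close>
    define jj where "jj z = (SOME j. j \<in> J \<and> z \<in> B j)" for z
    have jj: "jj z = j" if "j \<in> J" "z \<in> B j" for j z
    proof -
      have j': "jj z \<in> J \<and> z \<in> B (jj z)"
        unfolding jj_def by (rule someI[of _ j]) (use that in blast)
      then have "z \<in> sh (jj z)" "z \<in> sh j" "sh (jj z) \<in> \<A>" "sh j \<in> \<A>"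
        using that shA by (auto simp: B_def J_def)
      then have "sh (jj z) = sh j" using \<A>(3) by (metis disjnt_iff pairwiseD)
      then have "f (jj z) = f j" using j' that by (auto simp: J_def ix_def sh_def prod_eq_iff)
      then show ?thesis using inj j' that by (auto simp: J_def inj_on_def)
    qed
    define D where "D z = h' (jj z) (\<pi> z) - a i z" for z
    have Dc: "continuous_on (B j) D" if j: "j \<in> J" for j
    proof -
      have "j \<le> n" using j by (auto simp: J_def)
      have "continuous_on (B j) (\<lambda>z. h' j (\<pi> z) - a i z)"
      proof (intro continuous_on_diff)
        show "continuous_on (B j) (\<lambda>z. h' j (\<pi> z))"
          by (rule continuous_on_compose2[OF h'(1)[OF \<open>j \<le> n\<close>] continuous_on_subset[OF cont_\<pi> B(1)[OF \<open>j \<le> n\<close>]]])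
             (auto simp: B_def)
        show "continuous_on (B j) (a i)"
          using a \<open>i < m\<close> B(1)[OF \<open>j \<le> n\<close>] continuous_on_subset unfolding cont_fam_def by blast
      qed
      then show ?thesis
        by (rule continuous_on_eq) (simp add: D_def jj[OF j])
    qed
    have fJ: "finite J" by (simp add: J_def)
    have "continuous_on (\<Union>j\<in>J. B j) D"
      using fJ by (rule continuous_on_closed_Union) (use B Dc in \<open>auto simp: J_def\<close>)
    moreover have "closed (\<Union>j\<in>J. B j)"
      using fJ B by (intro closed_UN) (auto simp: J_def)
    then have "closedin (top_of_set Y) (\<Union>j\<in>J. B j)"
      using B by (intro closed_subset) (auto simp: J_def)
    moreover have "norm (D z) \<le> e" if z: "z \<in> (\<Union>j\<in>J. B j)" for z
    proof -
      obtain j where j: "j \<in> J" "z \<in> B j" using z by blast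
      then have "j \<le> n" "ix j = i" "\<pi> z \<in> E" "z \<in> sh j" by (auto simp: J_def B_def)
      then have "h j (\<pi> z) = a i z" using shA by (simp add: h_def \<sigma>\<pi>)
      then show ?thesis using h'(2)[OF \<open>j \<le> n\<close> \<open>\<pi> z \<in> E\<close>] jj[OF j] by (simp add: D_def)
    qed
    ultimately obtain g where g: "continuous_on Y g" "\<And>z. z \<in> (\<Union>j\<in>J. B j) \<Longrightarrow> g z = D z"
      "\<And>z. z \<in> Y \<Longrightarrow> norm (g z) \<le> e"
      using Tietze[of "\<Union>j\<in>J. B j" D Y e] \<open>e > 0\<close> by auto
    show ?thesis
    proof (intro exI[of _ g] conjI allI impI ballI)
      fix j z assume "j \<le> n" "ix j = i" "z \<in> B j"
      then have "j \<in> J" by (simp add: J_def)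
      then show "g z = h' j (\<pi> z) - a i z"
        using g(2)[of z] \<open>z \<in> B j\<close> jj[of j z] by (auto simp: D_def)
    qed (use g in auto)
  qed
  then obtain g where g: "\<And>i. i < m \<Longrightarrow> continuous_on Y (g i)"
    "\<And>i z. i < m \<Longrightarrow> z \<in> Y \<Longrightarrow> \<bar>g i z\<bar> \<le> e"
    "\<And>i j z. i < m \<Longrightarrow> j \<le> n \<Longrightarrow> ix j = i \<Longrightarrow> z \<in> B j \<Longrightarrow> g i z = h' j (\<pi> z) - a i z"
    by metis
  define a' where "a' i z = a i z + g i z" for i z
  have "cont_fam m Y a'"
    using a g(1) unfolding cont_fam_def a'_def by (auto intro: continuous_on_add)
  moreover have "near m Y e a a'" using g(2) by (simp add: near_def a'_def)
  moreover have "nonzero_over \<pi> \<A> I a'"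
    unfolding nonzero_over_def
  proof (intro allI impI)
    fix x assume "\<forall>A\<in>\<A>. x \<in> \<pi> ` A"
    then have x: "x \<in> E" by (simp add: E_def)
    then obtain j where j: "j \<le> n" "h' j x \<noteq> 0" using h'(3) by blast
    define z where "z = \<sigma> (sh j) x"
    have "x \<in> \<pi> ` sh j" using x EA shA[OF j(1)] by blast
    then have z: "z \<in> sh j" "\<pi> z = x" using \<sigma> by (auto simp: z_def)
    then have "z \<in> B j" using x by (simp add: B_def)
    moreover have "ix j < m" using ixI j(1) I(2) by auto
    ultimately have "a' (ix j) z = h' j x" using g(3) j z by (simp add: a'_def)
    then show "\<exists>A\<in>\<A>. \<exists>z\<in>A. \<pi> z = x \<and> (\<exists>i\<in>I. a' i z \<noteq> 0)"
      using j z shA ixI by metis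
  qed
  ultimately show ?thesis by blast
qed

text \<open>The sum of all \<open>\<bar>a i\<bar>\<close> along all sheets is positive on the
  compact common image, hence at least some \<open>\<mu>\<close>. If a perturbation by
  \<open>\<mu> / (card K + 1)\<close> made all terms vanish, the sum would have been below
  \<open>\<mu>\<close>.\<close>

lemma nonzero_over_open:
  assumes \<A>: "finite \<A>" "\<A> \<noteq> {}" "\<And>A. A \<in> \<A> \<Longrightarrow> compact A \<and> A \<subseteq> Y \<and> inj_on \<pi> A"
    and I: "finite I" "I \<subseteq> {..<m}"
    and a: "cont_fam m Y a" "nonzero_over \<pi> \<A> I a"
  shows "\<exists>d>0. \<forall>a'. cont_fam m Y a' \<and> near m Y d a a' \<longrightarrow> nonzero_over \<pi> \<A> I a'"
proof -
  define \<sigma> where "\<sigma> A = inv_into A \<pi>" for A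
  have \<sigma>: "\<sigma> A x \<in> A" "\<pi> (\<sigma> A x) = x" if "x \<in> \<pi> ` A" for A x
    using that by (auto simp: \<sigma>_def inv_into_into f_inv_into_f)
  have \<sigma>\<pi>: "\<sigma> A (\<pi> z) = z" if "A \<in> \<A>" "z \<in> A" for A z
    using that \<A>(3) by (simp add: \<sigma>_def)
  have \<sigma>c: "continuous_on (\<pi> ` A) (\<sigma> A)" if "A \<in> \<A>" for A
    unfolding \<sigma>_def using \<A>(3)[OF that] continuous_on_section by blast
  define E where "E = (\<Inter>A\<in>\<A>. \<pi> ` A)"
  have cpi: "compact (\<pi> ` A)" if "A \<in> \<A>" for A
    using \<A>(3)[OF that] by (intro compact_continuous_image continuous_on_subset[OF cont_\<pi>]) auto
  have EA: "E \<subseteq> \<pi> ` A" if "A \<in> \<A>" for A using that by (auto simp: E_def)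
  have "closed E" unfolding E_def using cpi compact_imp_closed by blast
  then have cE: "compact E" using EA cpi \<A>(2) by (metis all_not_in_conv compact_Int_closed inf.absorb2)
  define K where "K = \<A> \<times> I"
  have fK: "finite K" using \<A> I by (simp add: K_def)
  define \<Phi> where "\<Phi> x = (\<Sum>p\<in>K. \<bar>a (snd p) (\<sigma> (fst p) x)\<bar>)" for x
  have "continuous_on E (\<lambda>x. a (snd p) (\<sigma> (fst p) x))" if "p \<in> K" for p
  proof -
    have A: "fst p \<in> \<A>" and "snd p < m" using that I by (auto simp: K_def)
    then have "continuous_on Y (a (snd p))" using a by (simp add: cont_fam_def)
    moreover have "\<sigma> (fst p) ` E \<subseteq> Y" using EA[OF A] \<sigma>(1) \<A>(3)[OF A] by blast
    ultimately show ?thesis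
      using continuous_on_compose2 continuous_on_subset[OF \<sigma>c[OF A] EA[OF A]] by blast
  qed
  then have \<Phi>c: "continuous_on E \<Phi>"
    unfolding \<Phi>_def by (intro continuous_on_sum continuous_on_rabs) auto
  have \<Phi>pos: "\<Phi> x > 0" if x: "x \<in> E" for x
  proof -
    obtain A z i where p: "A \<in> \<A>" "z \<in> A" "\<pi> z = x" "i \<in> I" "a i z \<noteq> 0"
      using a(2) x unfolding nonzero_over_def E_def by blast
    then have "\<sigma> A x = z" using \<sigma>\<pi> by blast
    then show ?thesis unfolding \<Phi>_def
      using p by (intro sum_pos2[OF fK, of "(A,i)"]) (auto simp: K_def)
  qed
  obtain \<mu> where \<mu>: "\<mu> > 0" "\<And>x. x \<in> E \<Longrightarrow> \<Phi> x \<ge> \<mu>"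
    using compact_pos_lower_bound[OF cE \<Phi>c \<Phi>pos] by blast
  define d where "d = \<mu> / (card K + 1)"
  have "d > 0" using \<mu> by (simp add: d_def)
  moreover have "nonzero_over \<pi> \<A> I a'" if a': "near m Y d a a'" for a'
    unfolding nonzero_over_def
  proof (intro allI impI, rule ccontr)
    fix x assume "\<forall>A\<in>\<A>. x \<in> \<pi> ` A"
      and neg: "\<not> (\<exists>A\<in>\<A>. \<exists>z\<in>A. \<pi> z = x \<and> (\<exists>i\<in>I. a' i z \<noteq> 0))"
    then have x: "x \<in> E" by (simp add: E_def)
    have "\<bar>a (snd p) (\<sigma> (fst p) x)\<bar> \<le> d" if p: "p \<in> K" for p
    proof -
      have A: "fst p \<in> \<A>" "snd p \<in> I" "snd p < m" using p I by (auto simp: K_def)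
      then have "x \<in> \<pi> ` fst p" using EA x by blast
      then have "\<sigma> (fst p) x \<in> fst p" "\<pi> (\<sigma> (fst p) x) = x" using \<sigma> by auto
      then have "a' (snd p) (\<sigma> (fst p) x) = 0" "\<sigma> (fst p) x \<in> Y"
        using neg A \<A>(3) by blast+
      then show ?thesis using a' A unfolding near_def by fastforce
    qed
    then have "\<Phi> x \<le> (\<Sum>p\<in>K. d)" unfolding \<Phi>_def by (intro sum_mono)
    also have "\<dots> = card K * d" by simp
    also have "\<dots> < \<mu>" using \<mu>(1) by (simp add: d_def field_simps)
    finally show False using \<mu>(2)[OF x] by linarith
  qed
  ultimately show ?thesis by blast
qed

lemma generic_nonzero_over:
  assumes "finite J"
    and \<A>: "\<And>c. c \<in> J \<Longrightarrow> finite (\<A> c)"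
      "\<And>c A. c \<in> J \<Longrightarrow> A \<in> \<A> c \<Longrightarrow> compact A \<and> A \<subseteq> Y \<and> inj_on \<pi> A"
      "\<And>c. c \<in> J \<Longrightarrow> pairwise disjnt (\<A> c)"
    and I: "\<And>c. c \<in> J \<Longrightarrow> I c \<subseteq> {..<m}" "\<And>c. c \<in> J \<Longrightarrow> card (\<A> c) * card (I c) > n"
    and a: "cont_fam m Y a" "e > 0"
  obtains a' where "cont_fam m Y a'" "near m Y e a a'" "\<And>c. c \<in> J \<Longrightarrow> nonzero_over \<pi> (\<A> c) (I c) a'"
proof -
  have fI: "finite (I c)" if "c \<in> J" for c using I(1)[OF that] finite_subset by blast
  have ne: "\<A> c \<noteq> {}" if "c \<in> J" for c using I(2)[OF that] by auto
  have "\<exists>a'. cont_fam m Y a' \<and> near m Y e a a' \<and> (\<forall>c\<in>J. nonzero_over \<pi> (\<A> c) (I c) a')"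
  proof (rule generic_finite_conditions[OF \<open>finite J\<close> _ _ a])
    fix c a and e :: real assume "c \<in> J" "cont_fam m Y a" "e > 0"
    then show "\<exists>a'. cont_fam m Y a' \<and> near m Y e a a' \<and> nonzero_over \<pi> (\<A> c) (I c) a'"
      by (intro nonzero_over_dense \<A> fI I) auto
  next
    fix c a assume "c \<in> J" "cont_fam m Y a" "nonzero_over \<pi> (\<A> c) (I c) a"
    then show "\<exists>d>0. \<forall>a'. cont_fam m Y a' \<and> near m Y d a a' \<longrightarrow> nonzero_over \<pi> (\<A> c) (I c) a'"
      by (intro nonzero_over_open \<A> fI I ne) auto
  qed
  then show ?thesis using that by blast
qed

section \<open>Zero sets that split into sheets over the base\<close>

lemma finite_small_net:
  assumes "\<eta> > 0"
  obtains C where "finite C" "C \<subseteq> Y" "Y \<subseteq> (\<Union>c\<in>C. ball c \<eta>)"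
proof -
  have "Y \<subseteq> (\<Union>c\<in>Y. ball c \<eta>)" using assms by auto
  then obtain C where "C \<subseteq> Y" "finite C" "Y \<subseteq> (\<Union>c\<in>C. ball c \<eta>)"
    by (rule compactE_image[OF compact_Y, of Y "\<lambda>c. ball c \<eta>", rotated]) auto
  then show ?thesis by (intro that)
qed

text \<open>Two zeros in one fibre would lie on disjoint small pieces. Over the common image of two
  such pieces there are \<open>2 * r > n\<close> functions, and in general position they have no
  common zero.\<close>

lemma zero_set_one_sheet:
  assumes "2 * r > n" "m = r + 2" and a: "cont_fam m Y a" "e > 0"
  obtains a' where "cont_fam m Y a'" "near m Y e a a'"
    "inj_on \<pi> {z\<in>Y. \<forall>i<r. a' i z = 0}"
proof -
  obtain C where C: "finite C" "C \<subseteq> Y" "Y \<subseteq> (\<Union>c\<in>C. ball c (\<delta>/8))"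
    using finite_small_net[of "\<delta>/8"] \<delta>_pos by auto
  define A where "A c = cball c (\<delta>/8) \<inter> Y" for c
  have A: "compact (A c) \<and> A c \<subseteq> Y \<and> inj_on \<pi> (A c)" for c
  proof (intro conjI)
    show "compact (A c)" unfolding A_def using compact_Y by (metis closed_cball compact_Int_closed inf_commute)
    show "inj_on \<pi> (A c)" 
      using \<delta>_pos by (intro inj_on_small[where c=c]) (auto simp: A_def)
  qed (auto simp: A_def)
  have Ac: "c \<in> A c" if "c \<in> C" for c using that C \<delta>_pos by (auto simp: A_def)
  \<comment> \<open>Disjoint pairs suffice: if the pieces around \<open>z\<close> and
    \<open>z'\<close> met, these points would be less than \<open>\<delta>\<close> apart.\<close>
  define J where "J = {(c,c'). c \<in> C \<and> c' \<in> C \<and> A c \<inter> A c' = {}}"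
  have "J \<subseteq> C \<times> C" by (auto simp: J_def)
  then have fJ: "finite J" using C(1) finite_subset by blast
  obtain a' where a': "cont_fam m Y a'" "near m Y e a a'"
    "\<And>p. p \<in> J \<Longrightarrow> nonzero_over \<pi> {A (fst p), A (snd p)} {..<r} a'"
  proof (rule generic_nonzero_over[OF fJ, of "\<lambda>p. {A (fst p), A (snd p)}" "\<lambda>_. {..<r}" m a e])
    fix p assume "p \<in> J"
    then have "A (fst p) \<inter> A (snd p) = {}" "fst p \<in> C" by (auto simp: J_def)
    moreover from this have "A (fst p) \<noteq> A (snd p)" using Ac by blast
    ultimately show "pairwise disjnt {A (fst p), A (snd p)}"
      "n < card {A (fst p), A (snd p)} * card {..<r}"
      using \<open>2 * r > n\<close> by (auto simp: pairwise_def disjnt_def)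
  qed (use A \<open>m = r + 2\<close> a in auto)
  have "inj_on \<pi> {z\<in>Y. \<forall>i<r. a' i z = 0}"
  proof (rule inj_onI, rule ccontr)
    fix z z' assume z: "z \<in> {z\<in>Y. \<forall>i<r. a' i z = 0}" "z' \<in> {z\<in>Y. \<forall>i<r. a' i z = 0}"
      and eq: "\<pi> z = \<pi> z'" and "z \<noteq> z'"
    then have d: "dist z z' \<ge> \<delta>" using separated by blast
    obtain c where c: "c \<in> C" "dist c z < \<delta>/8" using C z by auto
    obtain c' where c': "c' \<in> C" "dist c' z' < \<delta>/8" using C z by auto
    have "A c \<inter> A c' = {}"
    proof (rule ccontr)
      assume "A c \<inter> A c' \<noteq> {}"
      then obtain y where "dist c y \<le> \<delta>/8" "dist c' y \<le> \<delta>/8" by (auto simp: A_def)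
      then have "dist z z' < \<delta>" 
        using c c' dist_triangle[of z z' c] dist_triangle[of c z' c'] dist_triangle2[of c c' y]
          \<delta>_pos dist_commute[of z c] by linarith
      then show False using d by simp
    qed
    then have "(c,c') \<in> J" using c c' by (auto simp: J_def)
    then have nz: "nonzero_over \<pi> {A c, A c'} {..<r} a'" using a'(3) by fastforce
    have zA: "z \<in> A c" "z' \<in> A c'" using c c' z by (auto simp: A_def)
    have "\<pi> z \<in> \<pi> ` A c" using zA(1) by (rule imageI)
    moreover have "\<pi> z \<in> \<pi> ` A c'" unfolding eq using zA(2) by (rule imageI)
    ultimately obtain B w i where w: "B \<in> {A c, A c'}" "w \<in> B" "\<pi> w = \<pi> z" "i < r" "a' i w \<noteq> 0"
      using nz unfolding nonzero_over_def by (metis insert_iff lessThan_iff singletonD)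
    then have "w = z \<or> w = z'" using A zA eq by (metis inj_onD insert_iff singletonD)
    then show False using w z by auto
  qed
  then show ?thesis using that a' by blast
qed

text \<open>The sheets are cut out by further functions \<open>u\<close>, put in general position together with the
  given ones: two sheets only meet where some \<open>u\<close> vanishes.\<close>

lemma zero_set_many_sheets:
  assumes "n = r + 2" and a: "cont_fam n Y a" "e > 0"
  obtains a' F and L :: nat where "cont_fam n Y a'" "near n Y e a a'"
    "\<And>l. l < L \<Longrightarrow> closed (F l) \<and> F l \<subseteq> Y \<and> inj_on \<pi> (F l)"
    "(\<Union>l<L. F l) = {z\<in>Y. \<forall>i<r. a' i z = 0}"
    "\<And>l k z. l < L \<Longrightarrow> k < L \<Longrightarrow> l \<noteq> k \<Longrightarrow> z \<in> F l \<Longrightarrow> z \<in> F k \<Longrightarrow> a' r z \<noteq> 0 \<or> a' (Suc r) z \<noteq> 0"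
proof -
  obtain C where C: "finite C" "C \<subseteq> Y" "Y \<subseteq> (\<Union>c\<in>C. ball c (\<delta>/16))"
    using finite_small_net[of "\<delta>/16"] \<delta>_pos by auto
  obtain c where c: "bij_betw c {0..<card C} C" using ex_bij_betw_nat_finite C(1) by blast
  define L where "L = card C"
  have cC: "c ` {..<L} = C" using c by (simp add: bij_betw_def L_def atLeast0LessThan)
  define A where "A p = cball (c p) (\<delta>/16) \<inter> Y" for p
  have A: "compact (A p) \<and> A p \<subseteq> Y \<and> inj_on \<pi> (A p)" for p
  proof (intro conjI)
    show "compact (A p)" unfolding A_def using compact_Y by (metis closed_cball compact_Int_closed inf_commute)
    show "inj_on \<pi> (A p)" 
      using \<delta>_pos by (intro inj_on_small[where c="c p"]) (auto simp: A_def)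
  qed (auto simp: A_def)
  \<comment> \<open>The function with index \<open>n + l\<close> is positive near the centre
    \<open>c l\<close>. With an error of at most \<open>\<delta>/32\<close> it remains positive
    within \<open>\<delta>/16\<close> of the centre, and wherever it is nonnegative the distance to
    the centre is below \<open>\<delta>/2\<close>, so that \<open>\<pi>\<close> is injective
    there.\<close>
  define u where "u i z = (if i < n then a i z else \<delta>/8 - dist z (c (i - n)))" for i z
  have uc: "cont_fam (n + L) Y u"
    unfolding cont_fam_def
  proof (intro allI impI)
    fix i
    show "continuous_on Y (u i)"
      using a(1) by (cases "i < n") (auto simp: u_def cont_fam_def intro!: continuous_intros)
  qed
  define e' where "e' = min e (\<delta>/32)"
  have e': "e' > 0" "e' \<le> e" "e' \<le> \<delta>/32" using a \<delta>_pos by (auto simp: e'_def)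
  obtain v where v: "cont_fam (n + L) Y v" "near (n + L) Y e' u v"
    "\<And>p. p \<in> {..<L} \<times> {..<L} \<Longrightarrow> nonzero_over \<pi> {A (fst p)} (insert (n + snd p) {..<n}) v"
  \<comment> \<open>On the single sheet \<open>A p\<close>, the \<open>n\<close> given functions and
    one cutting function are \<open>n + 1\<close> in number, which exceeds the dimension
    bound.\<close>
  proof (rule generic_nonzero_over[of "{..<L} \<times> {..<L}" "\<lambda>p. {A (fst p)}" "\<lambda>p. insert (n + snd p) {..<n}" "n+L" u e'])
    fix p assume "p \<in> {..<L} \<times> {..<L}"
    then show "n < card {A (fst p)} * card (insert (n + snd p) {..<n})" by auto
  qed (use A e' uc in auto)
  have nz: "v (n + l) z \<noteq> 0 \<or> (\<exists>i<n. v i z \<noteq> 0)" if "l < L" and "z \<in> Y" for l z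
  proof -
    obtain y where y: "y \<in> c ` {..<L}" "dist y z < \<delta>/16"
      using C(3) \<open>z \<in> Y\<close> unfolding cC by auto
    then obtain p where p: "p < L" "z \<in> A p" using \<open>z \<in> Y\<close> by (auto simp: A_def)
    then have "nonzero_over \<pi> {A p} (insert (n + l) {..<n}) v" using v(3)[of "(p,l)"] that by auto
    then obtain w i where w: "w \<in> A p" "\<pi> w = \<pi> z" "i \<in> insert (n + l) {..<n}" "v i w \<noteq> 0"
      using p(2) unfolding nonzero_over_def by blast
    then have "w = z" using A p(2) by (metis inj_onD)
    then show ?thesis using w by auto
  qed
  have vu: "\<bar>v (n + l) z - (\<delta>/8 - dist z (c l))\<bar> \<le> \<delta>/32" if "l < L" "z \<in> Y" for l z
  proof -
    have "\<bar>v (n + l) z - u (n + l) z\<bar> \<le> e'" using v(2) that by (simp add: near_def)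
    then show ?thesis using e' by (simp add: u_def)
  qed
  define P where "P = {z\<in>Y. \<forall>i<r. v i z = 0}"
  \<comment> \<open>A closed form of "the first index with a positive value". For
    \<open>k < l\<close>, lying in both \<open>F l\<close> and \<open>F k\<close> forces
    \<open>v (n + k) z = 0\<close>; then \<open>nz\<close> supplies a nonzero \<open>v i z\<close>
    with \<open>i < n\<close>, and \<open>i\<close> must be \<open>r\<close> or \<open>Suc r\<close>
    because the first \<open>r\<close> functions vanish on \<open>P\<close>.\<close>
  define F where "F l = {z\<in>P. v (n + l) z \<ge> 0 \<and> (\<forall>j<l. v (n + j) z \<le> 0)}" for l
  have vc: "continuous_on Y (v i)" if "i < n + L" for i using v(1) that by (simp add: cont_fam_def)
  have clY: "closed Y" using compact_Y compact_imp_closed by blast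
  have clF: "closed (F l)" if "l < L" for l
  proof -
    have eq: "F l = (Y \<inter> (\<Inter>i\<in>{..<r}. {z\<in>Y. v i z = 0})) \<inter> {z\<in>Y. 0 \<le> v (n + l) z} \<inter> (Y \<inter> (\<Inter>j\<in>{..<l}. {z\<in>Y. v (n + j) z \<le> 0}))"
      by (auto simp: F_def P_def)
    have c1: "closed (Y \<inter> (\<Inter>i\<in>{..<r}. {z\<in>Y. v i z = 0}))"
      using \<open>n = r + 2\<close>
      by (intro closed_Int clY closed_INT ballI continuous_closed_preimage_constant vc) auto
    have c2: "closed {z\<in>Y. 0 \<le> v (n + l) z}"
      using that by (intro continuous_on_closed_Collect_le continuous_on_const vc clY) auto
    have c3: "closed (Y \<inter> (\<Inter>j\<in>{..<l}. {z\<in>Y. v (n + j) z \<le> 0}))"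
      using that by (intro closed_Int clY closed_INT ballI continuous_on_closed_Collect_le continuous_on_const vc) auto
    show ?thesis unfolding eq by (rule closed_Int[OF closed_Int[OF c1 c2] c3])
  qed
  show ?thesis
  proof (rule that[of v L F])
    show "cont_fam n Y v" using v(1) by (auto simp: cont_fam_def)
    show "near n Y e a v"
      unfolding near_def
    proof (intro allI impI ballI)
      fix i z assume "i < n" "z \<in> Y"
      then have "\<bar>v i z - u i z\<bar> \<le> e'" using v(2) by (simp add: near_def)
      then show "\<bar>v i z - a i z\<bar> \<le> e" using e' \<open>i < n\<close> by (simp add: u_def)
    qed
    show "closed (F l) \<and> F l \<subseteq> Y \<and> inj_on \<pi> (F l)" if "l < L" for l
    proof (intro conjI clF that)
      show FY: "F l \<subseteq> Y" by (auto simp: F_def P_def)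
      show "inj_on \<pi> (F l)"
      proof (rule inj_on_small[where c="c l", OF FY])
        fix z assume z: "z \<in> F l"
        then have "v (n + l) z \<ge> 0" "z \<in> Y" by (auto simp: F_def P_def)
        then show "dist (c l) z < \<delta>/2" using vu[OF that \<open>z \<in> Y\<close>] \<delta>_pos dist_commute[of z "c l"] by linarith
      qed
    qed
    show "(\<Union>l<L. F l) = {z\<in>Y. \<forall>i<r. v i z = 0}"
    proof
      show "(\<Union>l<L. F l) \<subseteq> {z\<in>Y. \<forall>i<r. v i z = 0}" by (auto simp: F_def P_def)
      show "{z\<in>Y. \<forall>i<r. v i z = 0} \<subseteq> (\<Union>l<L. F l)"
      proof
        fix z assume z: "z \<in> {z\<in>Y. \<forall>i<r. v i z = 0}"
        then obtain y where y: "y \<in> c ` {..<L}" "dist y z < \<delta>/16" using C(3) unfolding cC by auto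
        then obtain l where l: "l < L" "dist (c l) z < \<delta>/16" by blast
        have "z \<in> Y" using z by simp
        then have "v (n + l) z > 0"
          using vu[OF l(1) \<open>z \<in> Y\<close>] l(2) dist_commute[of z "c l"] \<delta>_pos by linarith
        define k where "k = (LEAST k. v (n + k) z > 0)"
        have k: "v (n + k) z > 0" unfolding k_def by (rule LeastI, fact)
        have "k \<le> l" unfolding k_def by (rule Least_le, fact)
        moreover have "v (n + j) z \<le> 0" if "j < k" for j
          using not_less_Least[of j "\<lambda>k. v (n + k) z > 0"] that unfolding k_def by simp
        ultimately have "z \<in> F k" using z k by (auto simp: F_def P_def)
        moreover have "k < L" using \<open>k \<le> l\<close> \<open>l < L\<close> by simp
        ultimately show "z \<in> (\<Union>l<L. F l)" by blast
      qed
    qed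
    have less: "v r z \<noteq> 0 \<or> v (Suc r) z \<noteq> 0" if "l < L" "k < l" "z \<in> F l" "z \<in> F k" for l k z
    proof -
      have "v (n + k) z \<ge> 0" "v (n + k) z \<le> 0" "z \<in> Y" using that by (auto simp: F_def P_def)
      then have "v (n + k) z = 0" "z \<in> Y" by auto
      moreover have "k < L" using that by linarith
      ultimately obtain i where i: "i < n" "v i z \<noteq> 0" using nz[of k z] by blast
      moreover have "\<not> i < r" using i that by (auto simp: F_def P_def)
      ultimately have "i = r \<or> i = Suc r" using \<open>n = r + 2\<close> by linarith
      then show ?thesis using i by auto
    qed
    show "v r z \<noteq> 0 \<or> v (Suc r) z \<noteq> 0"
      if "l < L" "k < L" "l \<noteq> k" "z \<in> F l" "z \<in> F k" for l k z
    proof (cases "k < l")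
      case True
      then show ?thesis using less that by blast
    next
      case False
      then have "l < k" using \<open>l \<noteq> k\<close> by simp
      then show ?thesis using less that by blast
    qed
  qed
qed

end

subsection \<open>Moving maps off the origin\<close>

text \<open>Over the sheet \<open>F l\<close> the direction of \<open>b\<close> is a circle-valued function on a closed subset of
  the base, so it extends after pulling back to \<open>Z\<close>; the extensions agree on the overlaps
  because \<open>b\<close> is already nonzero there.\<close>

lemma extend_nonzero_over_sheets:
  fixes \<rho> :: "'z::{metric_space,second_countable_topology} \<Rightarrow> 'y::metric_space"
    and \<pi> :: "'y \<Rightarrow> 'x::metric_space" and b :: "'y \<Rightarrow> complex" and L :: nat
  assumes Z: "compact Z" "continuous_on Z \<rho>" "\<rho> ` Z \<subseteq> Y"
    and Y: "compact Y" "continuous_on Y \<pi>" "\<pi> ` Y \<subseteq> S"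
    and ext: "\<And>A f. closed A \<Longrightarrow> A \<subseteq> S \<Longrightarrow> continuous_on A f \<Longrightarrow> (\<And>x. x \<in> A \<Longrightarrow> norm (f x) = 1) \<Longrightarrow>
       \<exists>g. continuous_on Z g \<and> (\<forall>z\<in>Z. norm (g z) = 1) \<and>
           (\<forall>z\<in>Z. \<pi> (\<rho> z) \<in> A \<longrightarrow> g z = (f (\<pi> (\<rho> z)) :: complex))"
    and F: "\<And>l. l < L \<Longrightarrow> closed (F l) \<and> F l \<subseteq> Y \<and> inj_on \<pi> (F l)"
    and b: "continuous_on Y b"
    and b0: "\<And>l k z. l < L \<Longrightarrow> k < L \<Longrightarrow> l \<noteq> k \<Longrightarrow> z \<in> F l \<Longrightarrow> z \<in> F k \<Longrightarrow> b z \<noteq> 0"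
    and "\<epsilon> > 0"
  shows "\<exists>c. continuous_on Z c \<and> (\<forall>z\<in>Z. \<rho> z \<in> (\<Union>l<L. F l) \<longrightarrow> c z \<noteq> 0) \<and>
    (\<forall>z\<in>Z. norm (c z - b (\<rho> z)) \<le> 2 * \<epsilon>)"
proof -
  have clY: "closed Y" "closed Z" using Y Z compact_imp_closed by auto
  \<comment> \<open>The direction of \<open>b\<close> is prescribed only where \<open>b\<close> is
    not small or where sheets overlap; in both places \<open>b \<noteq> 0\<close>. Elsewhere on the
    sheet the extension may take any direction.\<close>
  define D where "D l = F l \<inter> ({z\<in>Y. \<epsilon> \<le> norm (b z)} \<union> (\<Union>k\<in>{..<L}-{l}. F k))" for l
  have clD: "closed (D l)" if "l < L" for l
    unfolding D_def using F that
    by (intro closed_Int closed_Un closed_UN continuous_on_closed_Collect_le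
          continuous_on_norm continuous_on_const b clY) auto
  have DY: "D l \<subseteq> F l" "D l \<subseteq> Y" if "l < L" for l using F[OF that] by (auto simp: D_def)
  have bD: "b z \<noteq> 0" if "l < L" "z \<in> D l" for l z
    using that b0[of l _ z] \<open>\<epsilon> > 0\<close> unfolding D_def by auto
  have "\<exists>g. continuous_on Z g \<and> (\<forall>z\<in>Z. norm (g z) = 1) \<and>
           (\<forall>z\<in>Z. \<rho> z \<in> D l \<longrightarrow> g z = sgn (b (\<rho> z)))" if l: "l < L" for l
  proof -
    define \<sigma> where "\<sigma> = inv_into (F l) \<pi>"
    have \<sigma>\<pi>: "\<sigma> (\<pi> z) = z" if "z \<in> D l" for z
      using that F[OF l] DY[OF l] by (auto simp: \<sigma>_def)
    have cD: "compact (D l)" using clD[OF l] DY[OF l] Y(1) compact_Int_closed inf.absorb2 by metis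
    have cDp: "continuous_on (D l) \<pi>" using DY[OF l] Y(2) continuous_on_subset by blast
    define A where "A = \<pi> ` D l"
    have "closed A" unfolding A_def using compact_continuous_image[OF cDp cD] compact_imp_closed by blast
    moreover have "A \<subseteq> S" using Y(3) DY[OF l] by (auto simp: A_def)
    moreover have c\<sigma>: "continuous_on A \<sigma>"
      unfolding A_def using \<sigma>\<pi> by (intro continuous_on_inv cDp cD) auto
    have "continuous_on A (\<lambda>x. b (\<sigma> x))"
      by (rule continuous_on_compose2[OF b c\<sigma>]) (use \<sigma>\<pi> DY[OF l] in \<open>auto simp: A_def\<close>)
    then have "continuous_on A (\<lambda>x. sgn (b (\<sigma> x)))"
      by (rule continuous_on_sgn) (use \<sigma>\<pi> bD[OF l] in \<open>auto simp: A_def\<close>)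
    moreover have "norm (sgn (b (\<sigma> x))) = 1" if "x \<in> A" for x
      using that \<sigma>\<pi> bD[OF l] by (auto simp: A_def norm_sgn)
    ultimately obtain g where g: "continuous_on Z g" "\<forall>z\<in>Z. norm (g z) = 1"
      "\<forall>z\<in>Z. \<pi> (\<rho> z) \<in> A \<longrightarrow> g z = sgn (b (\<sigma> (\<pi> (\<rho> z))))"
      using ext[of A "\<lambda>x. sgn (b (\<sigma> x))"] by blast
    have "g z = sgn (b (\<rho> z))" if "z \<in> Z" "\<rho> z \<in> D l" for z
      using g(3) that \<sigma>\<pi> by (auto simp: A_def)
    then show ?thesis using g by blast
  qed
  then obtain g where g: "\<And>l. l < L \<Longrightarrow> continuous_on Z (g l)"
     "\<And>l z. l < L \<Longrightarrow> z \<in> Z \<Longrightarrow> norm (g l z) = 1"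
     "\<And>l z. l < L \<Longrightarrow> z \<in> Z \<Longrightarrow> \<rho> z \<in> D l \<Longrightarrow> g l z = sgn (b (\<rho> z))"
    by metis
  define W where "W l = {z\<in>Z. \<rho> z \<in> F l}" for l
  have clW: "closed (W l)" if "l < L" for l
  proof -
    have "closedin (top_of_set Z) (Z \<inter> \<rho> -` F l)"
      using Z F[OF that] by (intro continuous_closedin_preimage) auto
    moreover have "Z \<inter> \<rho> -` F l = W l" by (auto simp: W_def)
    ultimately show ?thesis using clY(2) closedin_closed_trans by metis
  qed
  define ix where "ix z = (SOME l. l < L \<and> z \<in> W l)" for z
  define \<beta> where "\<beta> z = g (ix z) z" for z
  have \<beta>: "\<beta> z = g l z" if "l < L" "z \<in> W l" for l z
  proof -
    have i: "ix z < L \<and> z \<in> W (ix z)"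
      unfolding ix_def by (rule someI[of _ l]) (use that in blast)
    show ?thesis
    proof (cases "ix z = l")
      case False
      then have "\<rho> z \<in> D l" "\<rho> z \<in> D (ix z)" "z \<in> Z"
        using i that by (auto simp: D_def W_def)
      then show ?thesis using g(3) that i by (simp add: \<beta>_def)
    qed (simp add: \<beta>_def)
  qed
  have \<beta>n: "norm (\<beta> z) = 1" if "l < L" "z \<in> W l" for l z
    using \<beta>[OF that] g(2)[of l z] that by (auto simp: W_def)
  define U where "U = (\<Union>l\<in>{..<L}. W l)"
  have UZ: "U \<subseteq> Z" by (auto simp: U_def W_def)
  have "continuous_on U \<beta>"
    unfolding U_def
  proof (rule continuous_on_closed_Union)
    fix l assume l: "l \<in> {..<L}"
    have "continuous_on (W l) (g l)"
      by (rule continuous_on_subset[OF g(1)[of l]]) (use l in \<open>auto simp: W_def\<close>)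
    then show "continuous_on (W l) \<beta>" by (rule continuous_on_eq) (use \<beta> l in auto)
  qed (use clW in auto)
  \<comment> \<open>The correction from \<open>b\<close> to a function with direction
    \<open>\<beta>\<close> and modulus at least \<open>\<epsilon>\<close>. It vanishes where
    \<open>norm (b (\<rho> z)) \<ge> \<epsilon>\<close> and costs at most
    \<open>\<epsilon> + \<epsilon>\<close> elsewhere, whence the factor \<open>2\<close>.\<close>
  define d where "d z = complex_of_real (max \<epsilon> (norm (b (\<rho> z)))) * \<beta> z - b (\<rho> z)" for z
  have b\<rho>: "continuous_on Z (\<lambda>z. b (\<rho> z))" by (rule continuous_on_compose2[OF b Z(2,3)])
  have "continuous_on U d"
    unfolding d_def using \<open>continuous_on U \<beta>\<close> continuous_on_subset[OF b\<rho> UZ]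
    by (intro continuous_intros)
  moreover have "closed U" unfolding U_def using clW by (intro closed_UN) auto
  then have "closedin (top_of_set Z) U" using UZ by (rule closed_subset[rotated])
  moreover have "norm (d z) \<le> 2 * \<epsilon>" if z: "z \<in> U" for z
  proof -
    obtain l where l: "l < L" "z \<in> W l" using z by (auto simp: U_def)
    have zz: "z \<in> Z" "\<rho> z \<in> F l" "\<rho> z \<in> Y" using l Z(3) by (auto simp: W_def)
    show ?thesis
    proof (cases "\<epsilon> \<le> norm (b (\<rho> z))")
      case True
      then have "\<rho> z \<in> D l" using zz by (simp add: D_def)
      then have "\<beta> z = sgn (b (\<rho> z))" using \<beta>[OF l] g(3) l zz by simp
      moreover have "b (\<rho> z) \<noteq> 0" using True \<open>\<epsilon> > 0\<close> by auto
      ultimately have "d z = 0" using True by (simp add: d_def sgn_eq)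
      then show ?thesis using \<open>\<epsilon> > 0\<close> by simp
    next
      case False
      then have "d z = \<epsilon> * \<beta> z - b (\<rho> z)" by (simp add: d_def max_def)
      then have "norm (d z) \<le> norm (\<epsilon> * \<beta> z) + norm (b (\<rho> z))" by (simp add: norm_triangle_ineq4)
      also have "\<dots> \<le> 2 * \<epsilon>" using False \<open>\<epsilon> > 0\<close> \<beta>n[OF l] by (simp add: norm_mult)
      finally show ?thesis .
    qed
  qed
  ultimately obtain e where e: "continuous_on Z e" "\<And>z. z \<in> U \<Longrightarrow> e z = d z"
    "\<And>z. z \<in> Z \<Longrightarrow> norm (e z) \<le> 2 * \<epsilon>"
    using Tietze[of U d Z "2 * \<epsilon>"] \<open>\<epsilon> > 0\<close> by auto
  show ?thesis
  proof (intro exI[of _ "\<lambda>z. b (\<rho> z) + e z"] conjI ballI impI)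
    show "continuous_on Z (\<lambda>z. b (\<rho> z) + e z)" by (intro continuous_on_add b\<rho> e(1))
    fix z assume z: "z \<in> Z"
    show "norm (b (\<rho> z) + e z - b (\<rho> z)) \<le> 2 * \<epsilon>" using e(3)[OF z] by simp
    assume "\<rho> z \<in> (\<Union>l<L. F l)"
    then obtain l where l: "l < L" "z \<in> W l" using z by (auto simp: W_def)
    then have "z \<in> U" by (auto simp: U_def)
    then have "b (\<rho> z) + e z = complex_of_real (max \<epsilon> (norm (b (\<rho> z)))) * \<beta> z"
      using e(2)[of z] by (simp add: d_def)
    moreover have "\<beta> z \<noteq> 0" using \<beta>n[OF l] by auto
    moreover have "max \<epsilon> (norm (b (\<rho> z))) \<noteq> 0" using \<open>\<epsilon> > 0\<close> by linarith
    ultimately show "b (\<rho> z) + e z \<noteq> 0" by simp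
  qed
qed

text \<open>Only the coordinates \<open>r\<close> and \<open>Suc r\<close> become genuine functions
  on \<open>Z\<close>. The first \<open>r\<close> stay pulled back from \<open>Y\<close>, so off the
  sheets one of them is still nonzero.\<close>

lemma (in separated_fibres) avoid_zero_over_cover:
  fixes \<rho> :: "'z::{metric_space,second_countable_topology} \<Rightarrow> 'y"
  assumes Z: "compact Z" "continuous_on Z \<rho>" "\<rho> ` Z \<subseteq> Y"
    and ext: "\<And>A f. closed A \<Longrightarrow> A \<subseteq> S \<Longrightarrow> continuous_on A f \<Longrightarrow> (\<And>x. x \<in> A \<Longrightarrow> norm (f x) = 1) \<Longrightarrow>
       \<exists>g. continuous_on Z g \<and> (\<forall>z\<in>Z. norm (g z) = 1) \<and>
           (\<forall>z\<in>Z. \<pi> (\<rho> z) \<in> A \<longrightarrow> g z = (f (\<pi> (\<rho> z)) :: complex))"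
    and r: "2 * r > n \<or> n = r + 2" and m: "m = r + 2"
    and a: "cont_fam m Y a" "e > 0"
  obtains h where "cont_fam m Z h" "near m Z e (\<lambda>i z. a i (\<rho> z)) h" "\<And>z. z \<in> Z \<Longrightarrow> \<exists>i<m. h i z \<noteq> 0"
proof -
  have "\<exists>a' (F :: nat \<Rightarrow> 'y set) (L :: nat). cont_fam m Y a' \<and> near m Y (e/3) a a' \<and>
    (\<forall>l<L. closed (F l) \<and> F l \<subseteq> Y \<and> inj_on \<pi> (F l)) \<and>
    (\<Union>l<L. F l) = {z\<in>Y. \<forall>i<r. a' i z = 0} \<and>
    (\<forall>l k z. l < L \<longrightarrow> k < L \<longrightarrow> l \<noteq> k \<longrightarrow> z \<in> F l \<longrightarrow> z \<in> F k \<longrightarrow> a' r z \<noteq> 0 \<or> a' (Suc r) z \<noteq> 0)"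
    (is "\<exists>a' F L. ?P a' F L")
  proof (cases "n = r + 2")
    case True
    have a3: "cont_fam n Y a" "e/3 > 0" using a True m by auto
    show ?thesis
    proof (rule zero_set_many_sheets[OF True a3])
      fix a' and F :: "nat \<Rightarrow> 'y set" and L :: nat
      assume "cont_fam n Y a'" "near n Y (e/3) a a'"
        and "\<And>l. l < L \<Longrightarrow> closed (F l) \<and> F l \<subseteq> Y \<and> inj_on \<pi> (F l)"
        and "(\<Union>l<L. F l) = {z\<in>Y. \<forall>i<r. a' i z = 0}"
        and "\<And>l k z. l < L \<Longrightarrow> k < L \<Longrightarrow> l \<noteq> k \<Longrightarrow> z \<in> F l \<Longrightarrow> z \<in> F k \<Longrightarrow> a' r z \<noteq> 0 \<or> a' (Suc r) z \<noteq> 0"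
      then have "?P a' F L" using True m by simp
      then show ?thesis by (intro exI)
    qed
  next
    case False
    then have "2 * r > n" using r by simp
    have "e/3 > 0" using a by simp
    obtain a' where a': "cont_fam m Y a'" "near m Y (e/3) a a'" "inj_on \<pi> {z\<in>Y. \<forall>i<r. a' i z = 0}"
      by (rule zero_set_one_sheet[OF \<open>2 * r > n\<close> m a(1) \<open>e/3 > 0\<close>])
    have clY: "closed Y" using compact_Y compact_imp_closed by blast
    have "continuous_on Y (a' i)" if "i < r" for i using a'(1) that m by (simp add: cont_fam_def)
    then have "closed (Y \<inter> (\<Inter>i\<in>{..<r}. {z\<in>Y. a' i z = 0}))"
      by (intro closed_Int clY closed_INT ballI continuous_closed_preimage_constant) auto
    moreover have "Y \<inter> (\<Inter>i\<in>{..<r}. {z\<in>Y. a' i z = 0}) = {z\<in>Y. \<forall>i<r. a' i z = 0}" by auto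
    ultimately have "closed {z\<in>Y. \<forall>i<r. a' i z = 0}" by simp
    \<comment> \<open>The zero set is itself one sheet, so \<open>L = 1\<close> and the condition on
      overlaps is vacuous.\<close>
    then have "?P a' (\<lambda>_. {z\<in>Y. \<forall>i<r. a' i z = 0}) 1" using a' by auto
    then show ?thesis by (intro exI)
  qed
  then obtain a' and F :: "nat \<Rightarrow> 'y set" and L :: nat where P: "?P a' F L"
    by (elim exE)
  then have F: "cont_fam m Y a'" "near m Y (e/3) a a'"
    "\<And>l. l < L \<Longrightarrow> closed (F l) \<and> F l \<subseteq> Y \<and> inj_on \<pi> (F l)"
    "(\<Union>l<L. F l) = {z\<in>Y. \<forall>i<r. a' i z = 0}"
    "\<And>l k z. l < L \<Longrightarrow> k < L \<Longrightarrow> l \<noteq> k \<Longrightarrow> z \<in> F l \<Longrightarrow> z \<in> F k \<Longrightarrow> a' r z \<noteq> 0 \<or> a' (Suc r) z \<noteq> 0"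
    by simp_all
  have a'c: "continuous_on Y (a' i)" if "i < m" for i using F(1) that by (simp add: cont_fam_def)
  define b where "b z = Complex (a' r z) (a' (Suc r) z)" for z
  have bc: "continuous_on Y b"
    unfolding b_def using m by (intro continuous_on_Complex a'c) auto
  have b0: "b z \<noteq> 0" if "l < L" "k < L" "l \<noteq> k" "z \<in> F l" "z \<in> F k" for l k z
    using F(5)[OF that] by (auto simp: b_def complex_eq_iff)
  have "e/3 > 0" using a by simp
  \<comment> \<open>The budget \<open>e\<close> splits into \<open>e/3\<close> for general position
    on \<open>Y\<close> and \<open>2 * (e/3)\<close> for changing the last two coordinates.\<close>
  have "\<exists>c. continuous_on Z c \<and> (\<forall>z\<in>Z. \<rho> z \<in> (\<Union>l<L. F l) \<longrightarrow> c z \<noteq> 0) \<and>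
    (\<forall>z\<in>Z. norm (c z - b (\<rho> z)) \<le> 2 * (e/3))"
    by (rule extend_nonzero_over_sheets[OF Z compact_Y cont_\<pi> \<pi>_in _ _ bc _ \<open>e/3 > 0\<close>])
      (fact ext F(3) b0)+
  then obtain c where c: "continuous_on Z c" "\<And>z. z \<in> Z \<Longrightarrow> \<rho> z \<in> (\<Union>l<L. F l) \<Longrightarrow> c z \<noteq> 0"
    "\<And>z. z \<in> Z \<Longrightarrow> norm (c z - b (\<rho> z)) \<le> 2 * (e/3)"
    by blast
  define h where "h i z = (if i = r then Re (c z) else if i = Suc r then Im (c z) else a' i (\<rho> z))" for i z
  have \<rho>Y: "\<rho> z \<in> Y" if "z \<in> Z" for z using that Z(3) by blast
  show ?thesis
  proof (rule that[of h])
    show "cont_fam m Z h"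
      unfolding cont_fam_def
    proof (intro allI impI)
      fix i assume "i < m"
      then have "continuous_on Z (\<lambda>z. a' i (\<rho> z))" by (intro continuous_on_compose2[OF a'c Z(2,3)])
      then show "continuous_on Z (h i)"
        unfolding h_def using c(1)
        by (cases "i = r"; cases "i = Suc r") (auto intro: continuous_on_Re continuous_on_Im)
    qed
    show "near m Z e (\<lambda>i z. a i (\<rho> z)) h"
      unfolding near_def
    proof (intro allI impI ballI)
      fix i z assume "i < m" and z: "z \<in> Z"
      have 1: "\<bar>a' i (\<rho> z) - a i (\<rho> z)\<bar> \<le> e/3"
        using F(2) \<open>i < m\<close> \<rho>Y[OF z] by (simp add: near_def)
      have "\<bar>Re (c z - b (\<rho> z))\<bar> \<le> 2 * (e/3)" "\<bar>Im (c z - b (\<rho> z))\<bar> \<le> 2 * (e/3)"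
        using c(3)[OF z] abs_Re_le_cmod abs_Im_le_cmod order_trans by blast+
      then have "\<bar>h i z - a' i (\<rho> z)\<bar> \<le> 2 * (e/3)"
        using a(2) by (auto simp: h_def b_def)
      then show "\<bar>h i z - a i (\<rho> z)\<bar> \<le> e" using 1 by linarith
    qed
    show "\<exists>i<m. h i z \<noteq> 0" if z: "z \<in> Z" for z
    proof (cases "\<rho> z \<in> (\<Union>l<L. F l)")
      case True
      then have "c z \<noteq> 0" using c(2) z by blast
      then have "h r z \<noteq> 0 \<or> h (Suc r) z \<noteq> 0" by (auto simp: h_def complex_eq_iff)
      then show ?thesis using m by (metis add_2_eq_Suc' lessI less_SucI)
    next
      case False
      then obtain i where "i < r" "a' i (\<rho> z) \<noteq> 0" using F(4) \<rho>Y[OF z] by blast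
      then show ?thesis using m by (intro exI[of _ i]) (auto simp: h_def)
    qed
  qed
qed

subsection \<open>Covering dimension\<close>

text \<open>The origin of R^m is an unstable value of every map from \<open>Z\<close>: the classical
  description of dimension at most \<open>m - 1\<close> for compact metric spaces.\<close>

definition unstable_zero :: "'z::topological_space set \<Rightarrow> nat \<Rightarrow> bool" where
  "unstable_zero Z m \<longleftrightarrow> (\<forall>h e. cont_fam m Z h \<and> e > 0 \<longrightarrow>
     (\<exists>h'. cont_fam m Z h' \<and> near m Z e h h' \<and> (\<forall>z\<in>Z. \<exists>i<m. h' i z \<noteq> 0)))"

text \<open>The functions \<open>h i = \<phi> i - \<phi> m\<close> vanish together exactly where all the bump functions agree.
  After perturbing them away from zero, and only near their common zeros, \<open>V i\<close> collects the points
  at which the \<open>i\<close>-th value is not the least one.\<close>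

lemma shrink_to_empty_intersection:
  fixes Z :: "'z::metric_space set"
  assumes Z: "compact Z" "unstable_zero Z m"
    and U: "\<And>i. i \<le> m \<Longrightarrow> openin (top_of_set Z) (U i)" "(\<Union>i\<le>m. U i) = Z"
  shows "\<exists>V. (\<forall>i\<le>m. openin (top_of_set Z) (V i) \<and> V i \<subseteq> U i) \<and> (\<Union>i\<le>m. V i) = Z \<and> (\<Inter>i\<le>m. V i) = {}"
proof -
  define \<phi> where "\<phi> i = bump Z (U i)" for i
  have \<phi>c: "continuous_on Z (\<phi> i)" for i unfolding \<phi>_def by (rule continuous_on_bump)
  have \<phi>0: "\<phi> i x \<ge> 0" for i x by (simp add: \<phi>_def bump_nonneg)
  have \<phi>pos: "\<phi> i x > 0 \<longleftrightarrow> x \<in> U i" if "i \<le> m" "x \<in> Z" for i x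
    unfolding \<phi>_def by (rule bump_pos_iff[OF Z(1) U(1)[OF that(1)] that(2)])
  have sum_pos: "(\<Sum>i\<le>m. \<phi> i x) > 0" if x: "x \<in> Z" for x
  proof -
    obtain i where "i \<le> m" "x \<in> U i" using U(2) x by blast
    then show ?thesis using \<phi>pos[of i x] x by (intro sum_pos2[where i=i]) (auto simp: \<phi>0)
  qed
  have sumc: "continuous_on Z (\<lambda>x. \<Sum>i\<le>m. \<phi> i x)" by (intro continuous_on_sum \<phi>c)
  obtain \<mu> where \<mu>: "\<mu> > 0" "\<And>x. x \<in> Z \<Longrightarrow> (\<Sum>i\<le>m. \<phi> i x) \<ge> \<mu>"
    using compact_pos_lower_bound[OF Z(1) sumc sum_pos] by blast
  \<comment> \<open>A lower bound for the average of the \<open>m + 1\<close> bumps, so that one of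
    them reaches it at every point.\<close>
  define \<eta> where "\<eta> = \<mu> / (Suc m)"
  have "\<eta> > 0" using \<mu> by (simp add: \<eta>_def)
  have big: "\<exists>j\<le>m. \<phi> j x \<ge> \<eta>" if x: "x \<in> Z" for x
  proof (rule ccontr)
    assume "\<not> ?thesis"
    then have "(\<Sum>i\<le>m. \<phi> i x) < (\<Sum>i\<le>m. \<eta>)" by (intro sum_strict_mono) auto
    also have "\<dots> = \<mu>" by (simp add: \<eta>_def del: of_nat_Suc)
    finally show False using \<mu>(2)[OF x] by linarith
  qed
  define h where "h i x = \<phi> i x - \<phi> m x" for i x
  \<comment> \<open>Calibrated for the threshold \<open>t = 2 * m * e\<close> below: the
    perturbation changes \<open>N\<close> by at most \<open>m * e \<le> t\<close>, and where
    \<open>N x < 2 * t\<close> any two bumps differ by less than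
    \<open>4 * t \<le> \<eta>\<close>.\<close>
  define e where "e = \<eta> / (8 * (m + 1))"
  have e: "e > 0" "8 * m * e \<le> \<eta>" using \<open>\<eta> > 0\<close> by (auto simp: e_def field_simps)
  have hc: "continuous_on Z (h i)" for i unfolding h_def by (intro continuous_on_diff \<phi>c)
  then have "cont_fam m Z h" by (simp add: cont_fam_def)
  then obtain h' where h': "cont_fam m Z h'" "near m Z e h h'" "\<And>z. z \<in> Z \<Longrightarrow> \<exists>i<m. h' i z \<noteq> 0"
    using Z(2)[unfolded unstable_zero_def] e(1) by blast
  define N where "N x = (\<Sum>i<m. \<bar>h i x\<bar>)" for x
  have Nc: "continuous_on Z N" unfolding N_def by (intro continuous_on_sum continuous_on_rabs hc)
  show ?thesis
  \<comment> \<open>With no functions at all, having no common zero means that \<open>Z\<close> is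
    empty.\<close>
  proof (cases "m = 0")
    case True
    then have "Z = {}" using h'(3) by auto
    then show ?thesis using U True by (intro exI[of _ "\<lambda>_. {}"]) auto
  next
    case False
    define t where "t = 2 * m * e"
    have t: "t > 0" using e False by (simp add: t_def)
    define s where "s x = max 0 (min 1 (2 - N x / t))" for x
    have sc: "continuous_on Z s" unfolding s_def
      by (intro continuous_on_max continuous_on_min continuous_on_diff continuous_on_divide
           continuous_on_const Nc) (use t in auto)
    have s01: "0 \<le> s x" "s x \<le> 1" for x by (auto simp: s_def)
    \<comment> \<open>The entry \<open>v m = 0\<close> completes the list: where
      \<open>s x = 0\<close>, every \<open>v i x\<close> with \<open>i \<le> m\<close> equals
      \<open>\<phi> i x - \<phi> m x\<close>, so these values are ordered like the bumps.\<close>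
    define v where "v i x = (if i < m then h i x + s x * (h' i x - h i x) else 0)" for i x
    have vc: "continuous_on Z (v i)" for i
    proof (cases "i < m")
      case True
      then have "continuous_on Z (h' i)" using h'(1) by (simp add: cont_fam_def)
      then have "continuous_on Z (\<lambda>x. h i x + s x * (h' i x - h i x))"
        by (intro continuous_on_add continuous_on_mult continuous_on_diff hc sc)
      then show ?thesis using True by (simp add: v_def[abs_def])
    qed (simp add: v_def[abs_def])
    have nz: "\<exists>i<m. v i x \<noteq> 0" if x: "x \<in> Z" for x
    proof (cases "N x \<le> t")
      case True
      then have "s x = 1" using t by (simp add: s_def field_simps)
      then show ?thesis using h'(3)[OF x] by (auto simp: v_def)
    next
      case False
      show ?thesis
      proof (rule ccontr)
        assume neg: "\<not> ?thesis"
        have "\<bar>h i x\<bar> \<le> e" if "i < m" for i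
        proof -
          have "h i x = - (s x * (h' i x - h i x))" using neg that by (auto simp: v_def)
          then have "\<bar>h i x\<bar> = s x * \<bar>h' i x - h i x\<bar>" using s01[of x]
            by (metis abs_minus_cancel abs_mult abs_of_nonneg)
          also have "\<dots> \<le> 1 * e"
            using h'(2) that x s01[of x] by (intro mult_mono) (auto simp: near_def)
          finally show ?thesis by simp
        qed
        then have "N x \<le> (\<Sum>i<m. e)" unfolding N_def by (intro sum_mono) auto
        also have "\<dots> = m * e" by simp
        also have "\<dots> \<le> t" using e(1) by (simp add: t_def)
        finally show False using False by simp
      qed
    qed
    define V where "V i = {x\<in>Z. \<exists>j\<le>m. v j x < v i x}" for i
    show ?thesis
    proof (intro exI[of _ V] conjI allI impI)
      fix i assume i: "i \<le> m"
      have "openin (top_of_set Z) (\<Union>j\<in>{..m}. Z \<inter> (\<lambda>x. v i x - v j x) -` {0<..})"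
        by (intro openin_Union ballI) (auto intro!: continuous_openin_preimage_gen continuous_on_diff vc)
      moreover have "(\<Union>j\<in>{..m}. Z \<inter> (\<lambda>x. v i x - v j x) -` {0<..}) = V i"
        by (auto simp: V_def)
      ultimately show "openin (top_of_set Z) (V i)" by simp
      show "V i \<subseteq> U i"
      proof
        fix x assume "x \<in> V i"
        then obtain j where x: "x \<in> Z" and j: "j \<le> m" "v j x < v i x" by (auto simp: V_def)
        \<comment> \<open>Far from the common zeros, comparing values is comparing bumps, so
          \<open>\<phi> i x > \<phi> j x \<ge> 0\<close>. Near them every bump is close to one of
          size at least \<open>\<eta>\<close>, hence positive.\<close>
        have "\<phi> i x > 0"
        proof (cases "N x \<ge> 2 * t")
          case True
          then have "s x = 0" using t by (simp add: s_def field_simps)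
          then have "v k x = \<phi> k x - \<phi> m x" if "k \<le> m" for k
            using that by (cases "k < m") (auto simp: v_def h_def)
          then have "\<phi> j x < \<phi> i x" using j i by simp
          then show ?thesis using \<phi>0[of j x] by linarith
        next
          case False
          have "\<bar>h k x\<bar> < 2 * t" if "k \<le> m" for k
          proof (cases "k < m")
            case True
            then have "\<bar>h k x\<bar> \<le> N x" unfolding N_def by (intro member_le_sum) auto
            then show ?thesis using False by simp
          next
            case False
            then have "h k x = 0" using that by (simp add: h_def)
            then show ?thesis using t by simp
          qed
          moreover obtain k where k: "k \<le> m" "\<phi> k x \<ge> \<eta>" using big[OF x] by blast
          ultimately have "\<bar>\<phi> k x - \<phi> m x\<bar> < 2 * t" "\<bar>\<phi> i x - \<phi> m x\<bar> < 2 * t"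
            using i by (auto simp: h_def)
          moreover have "4 * t \<le> \<eta>" using e(2) by (simp add: t_def)
          ultimately show ?thesis using k(2) by linarith
        qed
        then show "x \<in> U i" using \<phi>pos i x by blast
      qed
    next
      show "(\<Union>i\<le>m. V i) = Z"
      proof
        show "Z \<subseteq> (\<Union>i\<le>m. V i)"
        proof
          fix x assume x: "x \<in> Z"
          obtain i where i: "i < m" "v i x \<noteq> 0" using nz[OF x] by blast
          have vm: "v m x = 0" by (simp add: v_def)
          have "v m x < v i x \<or> v i x < v m x" using i vm by linarith
          then have "x \<in> V i \<or> x \<in> V m" using x i(1) by (auto simp: V_def intro: less_imp_le)
          then show "x \<in> (\<Union>i\<le>m. V i)" using i(1) by auto
        qed
      qed (auto simp: V_def)
    next
      show "(\<Inter>i\<le>m. V i) = {}"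
      proof (rule ccontr)
        assume "(\<Inter>i\<le>m. V i) \<noteq> {}"
        then obtain x where x: "\<And>i. i \<le> m \<Longrightarrow> x \<in> V i" by blast
        have "Min ((\<lambda>i. v i x) ` {..m}) \<in> (\<lambda>i. v i x) ` {..m}" by (rule Min_in) auto
        then obtain j where j: "Min ((\<lambda>i. v i x) ` {..m}) = v j x" "j \<in> {..m}" by (rule imageE)
        obtain k where "k \<le> m" "v k x < v j x" using x[of j] j(2) by (auto simp: V_def)
        moreover have "v j x \<le> v k x" unfolding j(1)[symmetric] using \<open>k \<le> m\<close> by (intro Min_le) auto
        ultimately show False by linarith
      qed
    qed
  qed
qed

text \<open>Hemmingsen's reduction of the order of a cover to covers by \<open>m + 1\<close> sets.\<close>

lemma shrink_reducing_order:
  fixes Z :: "'z::metric_space set" and U :: "'i \<Rightarrow> 'z set"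
  assumes Z: "compact Z" "unstable_zero Z m" and I: "finite I"
    and U: "\<And>i. i \<in> I \<Longrightarrow> openin (top_of_set Z) (U i)" "(\<Union>i\<in>I. U i) = Z"
    and F: "finite \<S>" "\<And>S. S \<in> \<S> \<Longrightarrow> S \<subseteq> I \<and> card S = Suc m"
  shows "\<exists>V. (\<forall>i\<in>I. openin (top_of_set Z) (V i) \<and> V i \<subseteq> U i) \<and> (\<Union>i\<in>I. V i) = Z \<and>
     (\<forall>S\<in>\<S>. (\<Inter>i\<in>S. V i) = {})"
  using F
proof (induction \<S> rule: finite_induct)
  case empty
  then show ?case using U by (intro exI[of _ U]) auto
next
  case (insert S \<S>)
  have "\<exists>V. (\<forall>i\<in>I. openin (top_of_set Z) (V i) \<and> V i \<subseteq> U i) \<and> (\<Union>i\<in>I. V i) = Z \<and>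
     (\<forall>S\<in>\<S>. (\<Inter>i\<in>S. V i) = {})"
    by (rule insert.IH) (use insert.prems in auto)
  then obtain V where "(\<forall>i\<in>I. openin (top_of_set Z) (V i) \<and> V i \<subseteq> U i) \<and> (\<Union>i\<in>I. V i) = Z \<and>
     (\<forall>S\<in>\<S>. (\<Inter>i\<in>S. V i) = {})" ..
  then have V: "\<And>i. i \<in> I \<Longrightarrow> openin (top_of_set Z) (V i)" "\<And>i. i \<in> I \<Longrightarrow> V i \<subseteq> U i"
    "(\<Union>i\<in>I. V i) = Z" "\<And>S. S \<in> \<S> \<Longrightarrow> (\<Inter>i\<in>S. V i) = {}"
    by blast+
  have S: "S \<subseteq> I" "card S = Suc m" using insert.prems by auto
  then have fS: "finite S" using I finite_subset by blast
  obtain f where f: "bij_betw f {0..<Suc m} S" using ex_bij_betw_nat_finite[OF fS] S(2) by auto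
  define g where "g = inv_into {0..<Suc m} f"
  have g: "g i \<le> m" "f (g i) = i" if "i \<in> S" for i
    using that f bij_betw_inv_into_right[OF f] bij_betw_apply[OF bij_betw_inv_into[OF f]]
    by (auto simp: g_def less_Suc_eq_le)
  have fS': "f j \<in> S" "g (f j) = j" if "j \<le> m" for j
    using that f bij_betw_inv_into_left[OF f] bij_betw_apply[OF f] by (auto simp: g_def less_Suc_eq_le)
  \<comment> \<open>Everything outside \<open>S\<close> is merged into the last of the
    \<open>m + 1\<close> sets, so that these cover \<open>Z\<close>. Afterwards only members with
    index in \<open>S\<close> are cut down; a point that was covered through the merged part keeps
    its old member.\<close>
  define U' where "U' j = (if j < m then V (f j) else V (f j) \<union> (\<Union>i\<in>I-S. V i))" for j
  have "\<exists>W. (\<forall>i\<le>m. openin (top_of_set Z) (W i) \<and> W i \<subseteq> U' i) \<and> (\<Union>i\<le>m. W i) = Z \<and> (\<Inter>i\<le>m. W i) = {}"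
  proof (rule shrink_to_empty_intersection[OF Z])
    fix j assume "j \<le> m"
    then have "f j \<in> I" using fS' S by blast
    then show "openin (top_of_set Z) (U' j)"
      unfolding U'_def using V(1) by (auto intro!: openin_Un openin_Union)
  next
    show "(\<Union>j\<le>m. U' j) = Z"
    proof
      show "(\<Union>j\<le>m. U' j) \<subseteq> Z"
        using V(3) fS' S(1) by (auto simp: U'_def split: if_splits)
      show "Z \<subseteq> (\<Union>j\<le>m. U' j)"
      proof
        fix x assume "x \<in> Z"
        then obtain i where i: "i \<in> I" "x \<in> V i" using V(3) by blast
        show "x \<in> (\<Union>j\<le>m. U' j)"
        proof (cases "i \<in> S")
          case True
          then have "x \<in> U' (g i)" using g i by (auto simp: U'_def)
          then show ?thesis using g(1)[OF True] by blast
        next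
          case False
          then have "x \<in> U' m" using i by (auto simp: U'_def)
          then show ?thesis by blast
        qed
      qed
    qed
  qed
  then obtain W where W: "\<And>j. j \<le> m \<Longrightarrow> openin (top_of_set Z) (W j)" "\<And>j. j \<le> m \<Longrightarrow> W j \<subseteq> U' j"
    "(\<Union>j\<le>m. W j) = Z" "(\<Inter>j\<le>m. W j) = {}" by blast
  define V' where "V' i = (if i \<in> S then V i \<inter> W (g i) else V i)" for i
  have V'V: "V' i \<subseteq> V i" for i by (auto simp: V'_def)
  show ?case
  proof (intro exI[of _ V'] conjI ballI)
    fix i assume i: "i \<in> I"
    show "openin (top_of_set Z) (V' i)"
      unfolding V'_def using V(1)[OF i] W(1) g by (auto intro!: openin_Int)
    show "V' i \<subseteq> U i" using V'V V(2)[OF i] by blast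
  next
    show "(\<Union>i\<in>I. V' i) = Z"
    proof
      show "(\<Union>i\<in>I. V' i) \<subseteq> Z" using V'V V(3) by blast
      show "Z \<subseteq> (\<Union>i\<in>I. V' i)"
      proof
        fix x assume "x \<in> Z"
        then obtain j where j: "j \<le> m" "x \<in> W j" using W(3) by blast
        then have "x \<in> U' j" using W(2) by blast
        then consider "x \<in> V (f j)" | i where "i \<in> I - S" "x \<in> V i"
          by (auto simp: U'_def split: if_splits)
        then show "x \<in> (\<Union>i\<in>I. V' i)"
        proof cases
          case 1
          then have "x \<in> V' (f j)" using fS'[OF j(1)] j by (simp add: V'_def)
          then show ?thesis using fS'[OF j(1)] S(1) by blast
        next
          case 2
          then show ?thesis by (auto simp: V'_def)
        qed
      qed
    qed
  next
    fix S' assume "S' \<in> insert S \<S>"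
    then show "(\<Inter>i\<in>S'. V' i) = {}"
    proof
      assume "S' = S"
      have "(\<Inter>i\<in>S. V' i) \<subseteq> (\<Inter>j\<le>m. W j)"
      proof
        fix x assume x: "x \<in> (\<Inter>i\<in>S. V' i)"
        have "x \<in> W j" if "j \<le> m" for j
        proof -
          have "x \<in> V' (f j)" using x fS'[OF that] by blast
          then show ?thesis using fS'[OF that] by (simp add: V'_def)
        qed
        then show "x \<in> (\<Inter>j\<le>m. W j)" by blast
      qed
      then have "(\<Inter>i\<in>S. V' i) \<subseteq> {}" by (simp only: W(4))
      then show ?thesis by (simp only: \<open>S' = S\<close> subset_empty)
    next
      assume "S' \<in> \<S>"
      have "(\<Inter>i\<in>S'. V' i) \<subseteq> (\<Inter>i\<in>S'. V i)" by (rule INF_superset_mono) (simp_all add: V'V)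
      then show ?thesis by (simp only: V(4)[OF \<open>S' \<in> \<S>\<close>] subset_empty)
    qed
  qed
qed

text \<open>If no \<open>Suc m\<close> of the shrunken members meet, no point lies in more than
  \<open>m\<close> of them. Shrunken members with different indices may coincide, which only lowers
  the count.\<close>

lemma covering_dim_le_if_unstable_zero:
  fixes Z :: "'z::metric_space set"
  assumes Z: "compact Z" "unstable_zero Z m"
  shows "covering_dim_le (top_of_set Z) (int m - 1)"
  unfolding covering_dim_le_def
proof (intro allI impI)
  fix \<U> assume \<U>: "finite_open_cover (top_of_set Z) \<U>"
  define \<S> where "\<S> = {S. S \<subseteq> \<U> \<and> card S = Suc m}"
  have f: "finite \<U>" using \<U> by (simp add: finite_open_cover_def)
  then have "finite \<S>" by (simp add: \<S>_def)
  have "\<exists>V. (\<forall>i\<in>\<U>. openin (top_of_set Z) (V i) \<and> V i \<subseteq> i) \<and> (\<Union>i\<in>\<U>. V i) = Z \<and>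
     (\<forall>S\<in>\<S>. (\<Inter>i\<in>S. V i) = {})"
    by (rule shrink_reducing_order[OF Z f _ _ \<open>finite \<S>\<close>])
       (use \<U> in \<open>auto simp: finite_open_cover_def \<S>_def\<close>)
  then obtain V where V: "\<And>i. i \<in> \<U> \<Longrightarrow> openin (top_of_set Z) (V i)" "\<And>i. i \<in> \<U> \<Longrightarrow> V i \<subseteq> i"
    "(\<Union>i\<in>\<U>. V i) = Z" "\<And>S. S \<in> \<S> \<Longrightarrow> (\<Inter>i\<in>S. V i) = {}" by blast
  have "int (card {W \<in> V ` \<U>. x \<in> W}) \<le> int m - 1 + 1" for x
  proof (rule ccontr)
    assume "\<not> ?thesis"
    moreover have "{W \<in> V ` \<U>. x \<in> W} = V ` {i\<in>\<U>. x \<in> V i}" by auto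
    then have "card {W \<in> V ` \<U>. x \<in> W} \<le> card {i\<in>\<U>. x \<in> V i}"
      using f by (simp add: card_image_le)
    ultimately have "Suc m \<le> card {i\<in>\<U>. x \<in> V i}" by linarith
    then obtain S where S: "S \<subseteq> {i\<in>\<U>. x \<in> V i}" "card S = Suc m" by (rule obtain_subset_with_card_n)
    then have "S \<in> \<S>" "x \<in> (\<Inter>i\<in>S. V i)" by (auto simp: \<S>_def)
    then show False using V(4) by blast
  qed
  then show "\<exists>\<V>. finite_open_cover (top_of_set Z) \<V> \<and> (\<forall>V\<in>\<V>. \<exists>U\<in>\<U>. V \<subseteq> U) \<and>
            (\<forall>x\<in>topspace (top_of_set Z). int (card {V \<in> \<V>. x \<in> V}) \<le> int m - 1 + 1)"
  proof (intro exI[of _ "V ` \<U>"] conjI ballI)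
    show "finite_open_cover (top_of_set Z) (V ` \<U>)"
      using V(1,3) f by (simp add: finite_open_cover_def)
    show "\<exists>U\<in>\<U>. V' \<subseteq> U" if "V' \<in> V ` \<U>" for V' using that V(2) by blast
  qed
qed

section \<open>Invariance of covering dimension, and covers of small mesh\<close>

lemma covering_dim_le_homeomorphic:
  assumes "X homeomorphic_space Y" "covering_dim_le X n"
  shows "covering_dim_le Y n"
  unfolding covering_dim_le_def
proof (intro allI impI)
  fix \<U> assume \<U>: "finite_open_cover Y \<U>"
  obtain f g where fg: "homeomorphic_maps X Y f g" using assms(1) by (auto simp: homeomorphic_space_def)
  then have f: "continuous_map X Y f" and g: "continuous_map Y X g"
    and gf: "\<And>x. x \<in> topspace X \<Longrightarrow> g (f x) = x" and fg': "\<And>y. y \<in> topspace Y \<Longrightarrow> f (g y) = y"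
    by (auto simp: homeomorphic_maps_def)
  have fX: "f x \<in> topspace Y" if "x \<in> topspace X" for x using f that by (auto simp: continuous_map_def)
  have gY: "g x \<in> topspace X" if "x \<in> topspace Y" for x using g that by (auto simp: continuous_map_def)
  define P where "P U = {x \<in> topspace X. f x \<in> U}" for U
  define Q where "Q V = {y \<in> topspace Y. g y \<in> V}" for V
  have "finite_open_cover X (P ` \<U>)"
    unfolding finite_open_cover_def
  proof (intro conjI ballI)
    show "finite (P ` \<U>)" using \<U> by (simp add: finite_open_cover_def)
    show "openin X U'" if "U' \<in> P ` \<U>" for U'
      using that \<U> f by (auto simp: P_def finite_open_cover_def intro!: openin_continuous_map_preimage)
    show "\<Union> (P ` \<U>) = topspace X" 
      using \<U> fX by (auto simp: P_def finite_open_cover_def)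
  qed
  then obtain \<V> where \<V>: "finite_open_cover X \<V>" "\<forall>V\<in>\<V>. \<exists>U\<in>P ` \<U>. V \<subseteq> U"
    "\<forall>x\<in>topspace X. int (card {V\<in>\<V>. x \<in> V}) \<le> n + 1"
    using assms(2)[unfolded covering_dim_le_def] by blast
  have fV: "finite \<V>" using \<V>(1) by (simp add: finite_open_cover_def)
  show "\<exists>\<V>. finite_open_cover Y \<V> \<and> (\<forall>V\<in>\<V>. \<exists>U\<in>\<U>. V \<subseteq> U) \<and>
            (\<forall>x\<in>topspace Y. int (card {V\<in>\<V>. x \<in> V}) \<le> n + 1)"
  proof (intro exI[of _ "Q ` \<V>"] conjI ballI)
    show "finite_open_cover Y (Q ` \<V>)"
      unfolding finite_open_cover_def
    proof (intro conjI ballI)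
      show "finite (Q ` \<V>)" using fV by simp
      show "openin Y U'" if "U' \<in> Q ` \<V>" for U'
        using that \<V>(1) g by (auto simp: Q_def finite_open_cover_def intro!: openin_continuous_map_preimage)
      show "\<Union> (Q ` \<V>) = topspace Y"
        using \<V>(1) gY by (auto simp: Q_def finite_open_cover_def)
    qed
    fix V' assume "V' \<in> Q ` \<V>"
    then obtain V where V: "V \<in> \<V>" "V' = Q V" by blast
    then obtain U where U: "U \<in> \<U>" "V \<subseteq> P U" using \<V>(2) by blast
    have "V' \<subseteq> U"
    proof
      fix y assume "y \<in> V'"
      then have "y \<in> topspace Y" "g y \<in> V" using V by (auto simp: Q_def)
      then have "f (g y) \<in> U" using U(2) by (auto simp: P_def)
      then show "y \<in> U" using fg' \<open>y \<in> topspace Y\<close> by simp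
    qed
    then show "\<exists>U\<in>\<U>. V' \<subseteq> U" using U by blast
  next
    fix y assume y: "y \<in> topspace Y"
    have "{V \<in> Q ` \<V>. y \<in> V} \<subseteq> Q ` {V \<in> \<V>. g y \<in> V}" by (auto simp: Q_def)
    then have "card {V \<in> Q ` \<V>. y \<in> V} \<le> card (Q ` {V \<in> \<V>. g y \<in> V})"
      using fV by (intro card_mono) auto
    also have "\<dots> \<le> card {V \<in> \<V>. g y \<in> V}" using fV by (intro card_image_le) auto
    finally show "int (card {V \<in> Q ` \<V>. y \<in> V}) \<le> n + 1" using \<V>(3) gY[OF y] by force
  qed
qed

lemma fine_covers_if_covering_dim_le:
  fixes S :: "'z::metric_space set"
  assumes "compact S" "covering_dim_le (top_of_set S) (int n)"
  shows "fine_covers S n"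
  unfolding fine_covers_def
proof (intro allI impI)
  fix e :: real assume "e > 0"
  have "S \<subseteq> (\<Union>c\<in>S. ball c (e/2))" using \<open>e > 0\<close> by auto
  then obtain C where C: "C \<subseteq> S" "finite C" "S \<subseteq> (\<Union>c\<in>C. ball c (e/2))"
    by (rule compactE_image[OF assms(1), of S "\<lambda>c. ball c (e/2)", rotated]) auto
  have "finite_open_cover (top_of_set S) ((\<lambda>c. S \<inter> ball c (e/2)) ` C)"
    using C by (auto simp: finite_open_cover_def)
  then obtain \<V> where \<V>: "finite_open_cover (top_of_set S) \<V>"
    "\<forall>V\<in>\<V>. \<exists>U\<in>(\<lambda>c. S \<inter> ball c (e/2)) ` C. V \<subseteq> U"
    "\<forall>x\<in>topspace (top_of_set S). int (card {V\<in>\<V>. x \<in> V}) \<le> int n + 1"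
    using assms(2)[unfolded covering_dim_le_def] by blast
  have "dist x y < e" if V: "V \<in> \<V>" and xy: "x \<in> V" "y \<in> V" for V x y
  proof -
    obtain U where "U \<in> (\<lambda>c. S \<inter> ball c (e/2)) ` C" and VU: "V \<subseteq> U" using \<V>(2)[THEN bspec, OF V] ..
    then obtain c where "U = S \<inter> ball c (e/2)" by (elim imageE)
    then have "V \<subseteq> ball c (e/2)" using VU by simp
    then have "dist c x < e/2" "dist c y < e/2" using xy by auto
    then show ?thesis using dist_triangle3[of x y c] by linarith
  qed
  moreover have "card {V\<in>\<V>. x \<in> V} \<le> n + 1" if "x \<in> S" for x
  proof -
    have "int (card {V\<in>\<V>. x \<in> V}) \<le> int n + 1" using \<V>(3) that by simp
    then show ?thesis by linarith
  qed
  ultimately show "\<exists>\<V>. finite \<V> \<and>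
     (\<forall>V\<in>\<V>. openin (top_of_set S) V \<and> (\<forall>x\<in>V. \<forall>y\<in>V. dist x y < e)) \<and>
     \<Union>\<V> = S \<and> (\<forall>x\<in>S. card {V\<in>\<V>. x \<in> V} \<le> n + 1)"
    using \<V>(1) by (intro exI[of _ \<V>]) (auto simp: finite_open_cover_def)
qed

subsection \<open>Rational Cech cohomology and circle-valued maps\<close>

lemma coboundary_3: "coboundary c [x, y, z] = c [y, z] - c [x, z] + c [x, y]"
  by (simp add: coboundary_def lessThan_Suc)

lemma coboundary_4: "coboundary c [x, y, z, w] = c [y, z, w] - c [x, z, w] + c [x, y, w] - c [x, y, z]"
  by (simp add: coboundary_def lessThan_Suc numeral_3_eq_3)

text \<open>The bound \<open>m \<ge> 2\<close> is wanted because \<open>m\<close> will serve as an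
  exponent of the tower, and those start at \<open>2\<close>.\<close>

lemma rat_common_denominator:
  assumes "finite R"
  shows "\<exists>m\<ge>2::nat. \<forall>r\<in>R. \<exists>k::int. of_nat m * (r::rat) = of_int k"
  using assms
proof (induction R rule: finite_induct)
  case (insert r R)
  then obtain m where m: "m \<ge> 2" "\<forall>r\<in>R. \<exists>k::int. of_nat m * (r::rat) = of_int k" by blast
  obtain p q where pq: "quotient_of r = (p, q)" by fastforce
  then have q: "q > 0" "r = of_int p / of_int q" using quotient_of_denom_pos quotient_of_div by blast+
  have eq: "of_nat (m * nat q) * x = (of_int q :: rat) * (of_nat m * x)" for x :: rat
    using q(1) by simp
  show ?case
  proof (intro exI[of _ "m * nat q"] conjI ballI)
    have "nat q \<ge> 1" using q(1) by linarith
    then have "m * nat q \<ge> m * 1" by (intro mult_le_mono) auto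
    then show "m * nat q \<ge> 2" using m(1) by linarith
    fix s assume "s \<in> insert r R"
    then consider "s = r" | "s \<in> R" by blast
    then show "\<exists>k::int. of_nat (m * nat q) * s = of_int k"
    proof cases
      case 1
      have "of_nat (m * nat q) * s = (of_int (int m * p) :: rat)"
        unfolding eq 1 using q by simp
      then show ?thesis by blast
    next
      case 2
      then obtain k where "of_nat m * s = of_int k" using m(2) by blast
      then have "of_nat (m * nat q) * s = of_int (q * k)" unfolding eq by simp
      then show ?thesis by blast
    qed
  qed
qed auto

text \<open>The coboundary of \<open>b\<close> vanishes on simplices that meet \<open>A\<close>, so
  it is a relative 2-cocycle although \<open>b\<close> need not be a relative cochain. Rational
  vanishing provides, on a refinement, a relative cochain \<open>e\<close> with the same coboundary.
  Then \<open>b - e\<close> is a cocycle that agrees with \<open>b\<close> at \<open>A\<close>, and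
  its finitely many denominators can be cleared.\<close>

lemma cech_integral_cocycle:
  fixes b :: "'a set \<Rightarrow> 'a set \<Rightarrow> int"
  assumes H: "rat_cohom_dim_le X 1" and A: "closedin X A" and \<U>: "finite_open_cover X \<U>"
    and b: "\<And>U V W. U \<in> \<U> \<Longrightarrow> V \<in> \<U> \<Longrightarrow> W \<in> \<U> \<Longrightarrow> A \<inter> (U \<inter> V \<inter> W) \<noteq> {} \<Longrightarrow> b U V + b V W = b U W"
  shows "\<exists>\<V> p m d. finite_open_cover X \<V> \<and> (\<forall>V\<in>\<V>. p V \<in> \<U> \<and> V \<subseteq> p V) \<and> (m::nat) \<ge> 2 \<and>
     (\<forall>U\<in>\<V>. \<forall>V\<in>\<V>. \<forall>W\<in>\<V>. U \<inter> V \<inter> W \<noteq> {} \<longrightarrow> d U V + d V W = (d U W :: int)) \<and>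
     (\<forall>V\<in>\<V>. \<forall>W\<in>\<V>. A \<inter> (V \<inter> W) \<noteq> {} \<longrightarrow> d V W = int m * b (p V) (p W))"
proof -
  define \<beta> where "\<beta> s = (of_int (b (s ! 0) (s ! 1)) :: rat)" for s
  define c where "c = coboundary \<beta>"
  have c3: "c [x, y, z] = of_int (b y z) - of_int (b x z) + of_int (b x y)" for x y z
    by (simp add: c_def coboundary_3 \<beta>_def)
  have len3: "\<exists>x y z. s = [x, y, z]" if "length s = Suc 2" for s :: "'a set list"
    using that by (auto simp: length_Suc_conv numeral_2_eq_2)
  have len4: "\<exists>x y z w. s = [x, y, z, w]" if "length s = Suc (Suc 2)" for s :: "'a set list"
    using that by (auto simp: length_Suc_conv numeral_2_eq_2)
  have cocycle: "rel_cocycle X A \<U> 2 c"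
    unfolding rel_cocycle_def rel_cochain_def
  proof (intro conjI allI impI)
    fix s assume s: "nerve_tuple X \<U> s \<and> length s = Suc 2 \<and> A \<inter> \<Inter>(set s) \<noteq> {}"
    then obtain x y z where xyz: "s = [x, y, z]" using len3 by blast
    have "x \<in> \<U>" "y \<in> \<U>" "z \<in> \<U>" using s by (auto simp: nerve_tuple_def xyz)
    moreover have "A \<inter> (x \<inter> y \<inter> z) \<noteq> {}" using s by (auto simp: xyz)
    ultimately have "b x y + b y z = b x z" using b by blast
    then have "of_int (b x z) = (of_int (b x y) + of_int (b y z) :: rat)" by (metis of_int_add)
    then show "c s = 0" by (simp add: xyz c3)
  next
    fix s assume s: "nerve_tuple X \<U> s \<and> length s = Suc (Suc 2)"
    obtain x y z w where "s = [x, y, z, w]" using len4[OF conjunct2[OF s]] by (elim exE)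
    then show "coboundary c s = 0" by (simp add: coboundary_4 c3)
  qed
  have "cech_vanishes X A 2"
    using H A by (simp add: rat_cohom_dim_le_def numeral_2_eq_2)
  from this[unfolded cech_vanishes_def, THEN spec, THEN spec, THEN mp, OF conjI[OF \<U> cocycle]]
  obtain \<V> p where \<V>: "finite_open_cover X \<V>" "\<forall>V\<in>\<V>. p V \<in> \<U> \<and> V \<subseteq> p V"
    and "rel_coboundary X A \<V> 2 (\<lambda>s. c (map p s))"
    by (elim exE conjE)
  then obtain e where e: "rel_cochain X A \<V> 1 e"
    "\<forall>s. nerve_tuple X \<V> s \<and> length s = Suc 2 \<longrightarrow> c (map p s) = coboundary e s"
    by (auto simp: rel_coboundary_def)
  have VX: "V \<subseteq> topspace X" if "V \<in> \<V>" for V using \<V>(1) that by (auto simp: finite_open_cover_def)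
  have "finite ((\<lambda>(V, W). e [V, W]) ` (\<V> \<times> \<V>))" using \<V>(1) by (simp add: finite_open_cover_def)
  then obtain m :: nat where m: "m \<ge> 2"
    "\<forall>r\<in>(\<lambda>(V, W). e [V, W]) ` (\<V> \<times> \<V>). \<exists>k::int. of_nat m * r = of_int k"
    using rat_common_denominator by blast
  have "\<forall>V W. \<exists>k::int. V \<in> \<V> \<and> W \<in> \<V> \<longrightarrow> of_nat m * e [V, W] = of_int k"
    using m(2) by auto
  then obtain k where k: "\<And>V W. V \<in> \<V> \<Longrightarrow> W \<in> \<V> \<Longrightarrow> of_nat m * e [V, W] = (of_int (k V W) :: rat)"
    by metis
  \<comment> \<open>By the choice of \<open>k\<close> this is the integer form of
    \<open>m * (b - e)\<close>, with \<open>b\<close> pulled back along \<open>p\<close>.\<close>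
  define d where "d V W = int m * b (p V) (p W) - k V W" for V W
  have d_rat: "(of_int (d V W) :: rat) = of_nat m * (of_int (b (p V) (p W)) - e [V, W])"
    if "V \<in> \<V>" "W \<in> \<V>" for V W
    using k[OF that] by (simp add: d_def right_diff_distrib)
  have "d U V + d V W = d U W" if "U \<in> \<V>" "V \<in> \<V>" "W \<in> \<V>" "U \<inter> V \<inter> W \<noteq> {}" for U V W
  proof -
    have "nerve_tuple X \<V> [U, V, W]" using that VX by (auto simp: nerve_tuple_def)
    then have "c [p U, p V, p W] = coboundary e [U, V, W]" using e(2)[rule_format, of "[U,V,W]"] by simp
    then have *: "of_int (b (p U) (p V)) + of_int (b (p V) (p W)) - of_int (b (p U) (p W)) =
       e [U, V] + e [V, W] - e [U, W]" by (simp add: c3 coboundary_3)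
    have "(of_int (d U V + d V W - d U W) :: rat) = of_nat m *
       ((of_int (b (p U) (p V)) + of_int (b (p V) (p W)) - of_int (b (p U) (p W))) -
        (e [U, V] + e [V, W] - e [U, W]))"
      using that by (simp add: d_rat algebra_simps)
    also have "\<dots> = 0" unfolding * by simp
    finally have "(of_int (d U V + d V W - d U W) :: rat) = of_int 0" by simp
    then show ?thesis unfolding of_int_eq_iff by simp
  qed
  moreover have "d V W = int m * b (p V) (p W)" if "V \<in> \<V>" "W \<in> \<V>" "A \<inter> (V \<inter> W) \<noteq> {}" for V W
  proof -
    have "nerve_tuple X \<V> [V, W]" using that VX by (auto simp: nerve_tuple_def)
    then have "e [V, W] = 0" using e(1) that by (auto simp: rel_cochain_def)
    then have "(of_int (d V W) :: rat) = of_int (int m * b (p V) (p W))" using that d_rat by simp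
    then show ?thesis unfolding of_int_eq_iff .
  qed
  ultimately show ?thesis using \<V> m(1) by (intro exI[of _ \<V>] exI[of _ p] exI[of _ m] exI[of _ d]) auto
qed

lemma cis_arcsin_Im:
  assumes "norm q = 1" "Re q > 0"
  shows "cis (arcsin (Im q)) = q" "\<bar>arcsin (Im q)\<bar> < pi / 2"
proof -
  have sq: "(Re q)\<^sup>2 + (Im q)\<^sup>2 = 1" using assms(1) by (simp add: cmod_def)
  moreover have "(Re q)\<^sup>2 > 0" using assms(2) by simp
  ultimately have "(Im q)\<^sup>2 < 1" by linarith
  then have lt: "\<bar>Im q\<bar> < 1" by (simp add: abs_square_less_1)
  then have I: "-1 < Im q" "Im q < 1" by auto
  have "cos (arcsin (Im q)) = sqrt (1 - (Im q)\<^sup>2)" using I by (intro cos_arcsin) auto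
  also have "\<dots> = Re q" using sq assms(2) by (metis add_diff_cancel_right' less_imp_le real_sqrt_unique)
  finally show "cis (arcsin (Im q)) = q" using I by (simp add: complex_eq_iff)
  show "\<bar>arcsin (Im q)\<bar> < pi / 2" using arcsin_lt_bounded[OF I] by auto
qed

lemma cis_2pi_int: "cis (2 * pi * of_int k) = 1"
  by (rule cis_multiple_2pi) (rule Ints_of_int)

text \<open>The angle of \<open>f\<close> is known up to a quarter turn on each member of the cover, so
  \<open>round\<close> turns differences of approximate angles into an integral 1-cochain that near \<open>A\<close>
  is the genuine difference of angles; its coboundary is a relative 2-cocycle.\<close>

lemma circle_map_power_extends:
  fixes S :: "'x::metric_space set" and X :: "'a topology" and f :: "'x \<Rightarrow> complex"
  assumes hom: "homeomorphic_maps X (top_of_set S) \<phi> \<psi>" and S: "compact S"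
    and H: "rat_cohom_dim_le X 1"
    and A: "closed A" "A \<subseteq> S" and f: "continuous_on A f" "\<And>x. x \<in> A \<Longrightarrow> norm (f x) = 1"
  shows "\<exists>(m::nat) F \<Theta>. m \<ge> 2 \<and> continuous_on S F \<and> (\<forall>x\<in>S. norm (F x) = 1) \<and> continuous_on A \<Theta> \<and>
     (\<forall>x\<in>A. f x ^ m * F x = cis (real m * \<Theta> x))"
proof -
  have \<phi>: "continuous_map X (top_of_set S) \<phi>" and \<psi>: "continuous_map (top_of_set S) X \<psi>"
    and \<psi>\<phi>: "\<And>y. y \<in> topspace X \<Longrightarrow> \<psi> (\<phi> y) = y" and \<phi>\<psi>: "\<And>x. x \<in> S \<Longrightarrow> \<phi> (\<psi> x) = x"
    using hom by (auto simp: homeomorphic_maps_def)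
  have \<psi>X: "\<psi> x \<in> topspace X" if "x \<in> S" for x using \<psi> that by (auto simp: continuous_map_def)
  have \<phi>S: "\<phi> y \<in> S" if "y \<in> topspace X" for y using \<phi> that by (auto simp: continuous_map_def)
  \<comment> \<open>The open half circles centred at these four points cover the circle, and on each
    the angle is within a quarter turn of that of the centre. Points off \<open>A\<close> belong to
    every \<open>O' c\<close>.\<close>
  define Q where "Q = {1, \<i>, -1, -\<i>}"
  define O' where "O' c = S - {x\<in>A. Re (f x / c) \<le> 0}" for c
  have Q1: "norm c = 1" if "c \<in> Q" for c using that by (auto simp: Q_def)
  have Q0: "c \<noteq> 0" if "c \<in> Q" for c using Q1[OF that] by auto
  have O: "openin (top_of_set S) (O' c)" if "c \<in> Q" for c
  proof -
    have "continuous_on A (\<lambda>x. Re (f x / c))"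
      using Q0[OF that] by (intro continuous_on_Re continuous_on_divide f continuous_on_const) auto
    then have "closed {x\<in>A. Re (f x / c) \<le> 0}"
      by (intro continuous_on_closed_Collect_le continuous_on_const A)
    then have "closedin (top_of_set S) {x\<in>A. Re (f x / c) \<le> 0}"
      using A by (intro closed_subset) auto
    then show ?thesis unfolding O'_def by (metis openin_diff openin_subtopology_self topspace_euclidean_subtopology openin_topspace)
  qed
  have Ocov: "\<exists>c\<in>Q. x \<in> O' c" if "x \<in> S" for x
  proof (cases "x \<in> A")
    case True
    then have "f x \<noteq> 0" using f(2) by force
    then have "Re (f x) > 0 \<or> Re (f x) < 0 \<or> Im (f x) > 0 \<or> Im (f x) < 0"
      by (auto simp: complex_eq_iff)
    then have "\<exists>c\<in>Q. Re (f x / c) > 0" by (auto simp: Q_def)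
    then show ?thesis using that by (force simp: O'_def)
  next
    case False
    then show ?thesis using that by (auto simp: O'_def Q_def)
  qed
  define P where "P c = {y \<in> topspace X. \<phi> y \<in> O' c}" for c
  define \<U> where "\<U> = P ` Q"
  have \<U>: "finite_open_cover X \<U>"
    unfolding finite_open_cover_def
  proof (intro conjI ballI)
    show "finite \<U>" by (simp add: \<U>_def Q_def)
    show "openin X U" if U: "U \<in> \<U>" for U
    proof -
      obtain c where "c \<in> Q" "U = P c" using U by (auto simp: \<U>_def)
      then show ?thesis unfolding P_def using openin_continuous_map_preimage[OF \<phi> O] by simp
    qed
    show "\<Union>\<U> = topspace X" using Ocov \<phi>S by (auto simp: \<U>_def P_def)
  qed
  have "\<forall>U\<in>\<U>. \<exists>c\<in>Q. \<forall>y\<in>U. \<phi> y \<in> A \<longrightarrow> Re (f (\<phi> y) / c) > 0"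
    unfolding \<U>_def P_def O'_def by force
  then obtain \<kappa> where \<kappa>: "\<And>U. U \<in> \<U> \<Longrightarrow> \<kappa> U \<in> Q"
    "\<And>U y. U \<in> \<U> \<Longrightarrow> y \<in> U \<Longrightarrow> \<phi> y \<in> A \<Longrightarrow> Re (f (\<phi> y) / \<kappa> U) > 0"
    by metis
  define \<tau> where "\<tau> U = Arg (\<kappa> U)" for U
  have \<tau>: "cis (\<tau> U) = \<kappa> U" if "U \<in> \<U>" for U
    using Q0[OF \<kappa>(1)[OF that]] Q1[OF \<kappa>(1)[OF that]] by (simp add: \<tau>_def cis_Arg sgn_eq)
  \<comment> \<open>\<open>arcsin\<close> of the imaginary part is continuous on the whole circle.
    So \<open>\<theta> U\<close> is continuous on all of \<open>A\<close>, while it is an angle of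
    \<open>f\<close> only where \<open>\<psi> x \<in> U\<close>.\<close>
  define \<theta> where "\<theta> U x = \<tau> U + arcsin (Im (f x / \<kappa> U))" for U x
  have n1: "norm (f x / \<kappa> U) = 1" if "U \<in> \<U>" "x \<in> A" for U x
    using f(2)[OF that(2)] Q1[OF \<kappa>(1)[OF that(1)]] by (simp add: norm_divide)
  have \<theta>c: "continuous_on A (\<theta> U)" if "U \<in> \<U>" for U
    unfolding \<theta>_def
  proof (intro continuous_on_add continuous_on_const continuous_on_arcsin ballI)
    show "continuous_on A (\<lambda>x. Im (f x / \<kappa> U))"
      using Q0[OF \<kappa>(1)[OF that]] by (intro continuous_on_Im continuous_on_divide f continuous_on_const) auto
    show "- 1 \<le> Im (f x / \<kappa> U) \<and> Im (f x / \<kappa> U) \<le> 1" if "x \<in> A" for x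
      using abs_Im_le_cmod[of "f x / \<kappa> U"] n1[OF \<open>U \<in> \<U>\<close> that] by linarith
  qed
  have \<theta>1: "cis (\<theta> U x) = f x" and \<theta>2: "\<bar>\<theta> U x - \<tau> U\<bar> < pi / 2"
    if "U \<in> \<U>" "x \<in> A" "\<psi> x \<in> U" for U x
  proof -
    have "x \<in> S" using that A by blast
    then have q: "Re (f x / \<kappa> U) > 0" using \<kappa>(2)[OF that(1,3)] that(2) \<phi>\<psi> by simp
    have "cis (\<theta> U x) = cis (\<tau> U) * cis (arcsin (Im (f x / \<kappa> U)))" by (simp add: \<theta>_def cis_mult)
    also have "\<dots> = \<kappa> U * (f x / \<kappa> U)"
      using \<tau>[OF that(1)] cis_arcsin_Im(1)[OF n1[OF that(1,2)] q] by simp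
    finally show "cis (\<theta> U x) = f x" using Q0[OF \<kappa>(1)[OF that(1)]] by simp
    show "\<bar>\<theta> U x - \<tau> U\<bar> < pi / 2"
      using cis_arcsin_Im(2)[OF n1[OF that(1,2)] q] by (simp add: \<theta>_def)
  qed
  define b where "b U V = round ((\<tau> V - \<tau> U) / (2 * pi))" for U V
  have b\<theta>: "2 * pi * of_int (b U V) = \<theta> V x - \<theta> U x"
    if "U \<in> \<U>" "V \<in> \<U>" "x \<in> A" "\<psi> x \<in> U" "\<psi> x \<in> V" for U V x
  proof -
    have "cis (\<theta> V x - \<theta> U x) = cis (\<theta> V x) / cis (\<theta> U x)" by (simp add: cis_divide)
    also have "\<dots> = 1" using \<theta>1 that f(2)[OF that(3)] by auto
    finally have "cos (\<theta> V x - \<theta> U x) = 1" by (simp add: complex_eq_iff)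
    then obtain k :: int where k: "\<theta> V x - \<theta> U x = of_int k * 2 * pi" using cos_one_2pi_int by blast
    \<comment> \<open>Two errors below \<open>pi / 2\<close> stay below \<open>pi\<close> together,
      that is, below \<open>1/2\<close> after division by \<open>2 * pi\<close>; this is what
      \<open>round\<close> needs to return \<open>k\<close>.\<close>
    have "\<bar>(\<theta> V x - \<theta> U x) - (\<tau> V - \<tau> U)\<bar> < pi"
      using \<theta>2[OF that(1,3,4)] \<theta>2[OF that(2,3,5)] by linarith
    then have "\<bar>(\<tau> V - \<tau> U) - of_int k * 2 * pi\<bar> < pi" unfolding k by linarith
    then have "\<bar>(\<tau> V - \<tau> U) - of_int k * 2 * pi\<bar> / (2 * pi) < 1/2" by (simp add: field_simps)
    also have "\<bar>(\<tau> V - \<tau> U) - of_int k * 2 * pi\<bar> / (2 * pi) = \<bar>((\<tau> V - \<tau> U) - of_int k * 2 * pi) / (2 * pi)\<bar>"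
      by (simp add: abs_divide)
    also have "((\<tau> V - \<tau> U) - of_int k * 2 * pi) / (2 * pi) = (\<tau> V - \<tau> U) / (2 * pi) - of_int k"
      by (simp add: field_simps)
    finally have "b U V = k" unfolding b_def by (rule round_unique')
    then show ?thesis using k by simp
  qed
  define AX where "AX = {y \<in> topspace X. \<phi> y \<in> A}"
  have "closedin (top_of_set S) A" using A by (intro closed_subset) auto
  then have AX: "closedin X AX" unfolding AX_def by (rule closedin_continuous_map_preimage[OF \<phi>])
  have AXD: "\<exists>x\<in>A. \<psi> x = y" if "y \<in> AX" for y using that \<psi>\<phi> by (auto simp: AX_def)
  have "\<exists>\<V> p m d. finite_open_cover X \<V> \<and> (\<forall>V\<in>\<V>. p V \<in> \<U> \<and> V \<subseteq> p V) \<and> (m::nat) \<ge> 2 \<and>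
     (\<forall>U\<in>\<V>. \<forall>V\<in>\<V>. \<forall>W\<in>\<V>. U \<inter> V \<inter> W \<noteq> {} \<longrightarrow> d U V + d V W = (d U W :: int)) \<and>
     (\<forall>V\<in>\<V>. \<forall>W\<in>\<V>. AX \<inter> (V \<inter> W) \<noteq> {} \<longrightarrow> d V W = int m * b (p V) (p W))"
  proof (rule cech_integral_cocycle[OF H AX \<U>])
    fix U V W assume UVW: "U \<in> \<U>" "V \<in> \<U>" "W \<in> \<U>" "AX \<inter> (U \<inter> V \<inter> W) \<noteq> {}"
    then obtain x where x: "x \<in> A" "\<psi> x \<in> U" "\<psi> x \<in> V" "\<psi> x \<in> W" using AXD by blast
    have "2 * pi * of_int (b U V) + 2 * pi * of_int (b V W) = 2 * pi * of_int (b U W)"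
      using b\<theta>[of U V x] b\<theta>[of V W x] b\<theta>[of U W x] UVW x by simp
    then have "2 * pi * (of_int (b U V + b V W) - of_int (b U W)) = 0" by (simp add: algebra_simps)
    then have "real_of_int (b U V + b V W) = of_int (b U W)" using pi_neq_zero by simp
    then show "b U V + b V W = b U W" unfolding of_int_eq_iff .
  qed
  then obtain \<V> p m d where \<V>d: "finite_open_cover X \<V> \<and> (\<forall>V\<in>\<V>. p V \<in> \<U> \<and> V \<subseteq> p V) \<and> (m::nat) \<ge> 2 \<and>
     (\<forall>U\<in>\<V>. \<forall>V\<in>\<V>. \<forall>W\<in>\<V>. U \<inter> V \<inter> W \<noteq> {} \<longrightarrow> d U V + d V W = (d U W :: int)) \<and>
     (\<forall>V\<in>\<V>. \<forall>W\<in>\<V>. AX \<inter> (V \<inter> W) \<noteq> {} \<longrightarrow> d V W = int m * b (p V) (p W))"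
    by (elim exE)
  then have \<V>: "finite_open_cover X \<V>" "\<And>V. V \<in> \<V> \<Longrightarrow> p V \<in> \<U>" "\<And>V. V \<in> \<V> \<Longrightarrow> V \<subseteq> p V" "m \<ge> 2"
    by simp_all
  have d: "\<And>U V W. U \<in> \<V> \<Longrightarrow> V \<in> \<V> \<Longrightarrow> W \<in> \<V> \<Longrightarrow> U \<inter> V \<inter> W \<noteq> {} \<Longrightarrow> d U V + d V W = (d U W :: int)"
      "\<And>V W. V \<in> \<V> \<Longrightarrow> W \<in> \<V> \<Longrightarrow> AX \<inter> (V \<inter> W) \<noteq> {} \<Longrightarrow> d V W = int m * b (p V) (p W)"
    using \<V>d by simp_all
  have f\<V>: "finite \<V>" using \<V>(1) by (simp add: finite_open_cover_def)
  define G where "G V = {x \<in> S. \<psi> x \<in> V}" for V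
  have Go: "openin (top_of_set S) (G V)" if "V \<in> \<V>" for V
    using openin_continuous_map_preimage[OF \<psi>, of V] that \<V>(1) by (simp add: G_def finite_open_cover_def)
  have Gcov: "\<exists>V\<in>\<V>. x \<in> G V" if "x \<in> S" for x
    using \<psi>X[OF that] \<V>(1) that by (auto simp: G_def finite_open_cover_def)
  define \<beta> where "\<beta> V = bump S (G V)" for V
  define \<Sigma> where "\<Sigma> x = (\<Sum>V\<in>\<V>. \<beta> V x)" for x
  define w where "w V x = \<beta> V x / \<Sigma> x" for V x
  have \<beta>0: "\<beta> V x \<ge> 0" for V x by (simp add: \<beta>_def bump_nonneg)
  have \<beta>pos: "\<beta> V x > 0 \<longleftrightarrow> x \<in> G V" if "V \<in> \<V>" "x \<in> S" for V x
    unfolding \<beta>_def by (rule bump_pos_iff[OF S Go[OF that(1)] that(2)])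
  have \<Sigma>pos: "\<Sigma> x > 0" if x: "x \<in> S" for x
  proof -
    obtain V where "V \<in> \<V>" "x \<in> G V" using Gcov[OF x] by blast
    then show ?thesis unfolding \<Sigma>_def
      using \<beta>pos[of V x] x f\<V> by (intro sum_pos2[where i=V]) (auto simp: \<beta>0)
  qed
  have \<beta>c: "continuous_on S (\<beta> V)" for V unfolding \<beta>_def by (rule continuous_on_bump)
  have wc: "continuous_on S (w V)" for V
    unfolding w_def \<Sigma>_def
  proof (intro continuous_on_divide continuous_on_sum \<beta>c ballI)
    show "(\<Sum>V\<in>\<V>. \<beta> V x) \<noteq> 0" if "x \<in> S" for x using \<Sigma>pos[OF that] by (simp add: \<Sigma>_def)
  qed
  have w1: "(\<Sum>V\<in>\<V>. w V x) = 1" if "x \<in> S" for x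
    using \<Sigma>pos[OF that] by (simp add: w_def flip: sum_divide_distrib) (simp add: \<Sigma>_def)
  have w0: "w V x = 0" if "V \<in> \<V>" "x \<in> S" "x \<notin> G V" for V x
    using \<beta>pos[OF that(1,2)] that(3) \<beta>0[of V x] by (simp add: w_def)
  \<comment> \<open>Averaging over a partition of unity makes the integral cocycle \<open>d\<close>
    a coboundary of real functions: on overlaps \<open>\<Gamma> U - \<Gamma> V\<close> is the
    integer \<open>d U V\<close>, so \<open>cis (2 * pi * \<Gamma> V x)\<close> does not depend on
    \<open>V\<close>.\<close>
  define \<Gamma> where "\<Gamma> V x = (\<Sum>W\<in>\<V>. w W x * of_int (d V W))" for V x
  have \<Gamma>c: "continuous_on S (\<Gamma> V)" for V
    unfolding \<Gamma>_def by (intro continuous_on_sum continuous_on_mult wc continuous_on_const)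
  have \<Gamma>diff: "\<Gamma> U x = of_int (d U V) + \<Gamma> V x" if "U \<in> \<V>" "V \<in> \<V>" "x \<in> G U" "x \<in> G V" for U V x
  proof -
    have x: "x \<in> S" using that by (simp add: G_def)
    have "\<Gamma> U x = (\<Sum>W\<in>\<V>. w W x * of_int (d U V) + w W x * of_int (d V W))"
      unfolding \<Gamma>_def
    proof (rule sum.cong)
      fix W assume W: "W \<in> \<V>"
      show "w W x * of_int (d U W) = w W x * of_int (d U V) + w W x * of_int (d V W)"
      proof (cases "x \<in> G W")
        case True
        then have "\<psi> x \<in> U \<inter> V \<inter> W" using that by (simp add: G_def)
        then have "U \<inter> V \<inter> W \<noteq> {}" by blast
        from d(1)[OF that(1,2) W this] have "d U W = d U V + d V W" by simp
        then show ?thesis by (simp add: distrib_left)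
      next
        case False
        then show ?thesis using w0[OF W x] by simp
      qed
    qed simp
    also have "\<dots> = (\<Sum>W\<in>\<V>. w W x) * of_int (d U V) + \<Gamma> V x"
      by (simp add: sum.distrib \<Gamma>_def sum_distrib_right)
    finally show ?thesis using w1[OF x] by simp
  qed
  define vx where "vx x = (SOME V. V \<in> \<V> \<and> x \<in> G V)" for x
  have vx: "vx x \<in> \<V>" "x \<in> G (vx x)" if "x \<in> S" for x
    using someI_ex[of "\<lambda>V. V \<in> \<V> \<and> x \<in> G V"] Gcov[OF that] unfolding vx_def by blast+
  define F where "F x = cis (2 * pi * \<Gamma> (vx x) x)" for x
  have F: "cis (2 * pi * \<Gamma> V x) = F x" if "V \<in> \<V>" "x \<in> G V" for V x
  proof -
    have x: "x \<in> S" using that by (simp add: G_def)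
    have "\<Gamma> V x = of_int (d V (vx x)) + \<Gamma> (vx x) x"
      by (rule \<Gamma>diff[OF that(1) vx(1)[OF x] that(2) vx(2)[OF x]])
    then have "cis (2 * pi * \<Gamma> V x) = cis (2 * pi * of_int (d V (vx x))) * F x"
      unfolding F_def cis_mult by (simp only: distrib_left)
    then show ?thesis by (simp add: cis_2pi_int)
  qed
  have Fc: "continuous_on S F"
    unfolding continuous_on_eq_continuous_within
  proof
    fix x assume x: "x \<in> S"
    have "continuous_on S (\<lambda>x. cis (2 * pi * \<Gamma> (vx x') x))" for x'
      by (intro continuous_on_cis continuous_on_mult continuous_on_const \<Gamma>c)
    then have "continuous (at x within S) (\<lambda>y. cis (2 * pi * \<Gamma> (vx x) y))"
      using x unfolding continuous_on_eq_continuous_within by blast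
    then show "continuous (at x within S) F"
      by (rule continuous_transform_within_openin[OF _ Go[OF vx(1)[OF x]] vx(2)[OF x]])
         (rule F[OF vx(1)[OF x]])
  qed
  \<comment> \<open>On \<open>A\<close> the cocycle is \<open>m\<close> times a difference of
    angles, so the same average turns \<open>2 * pi * \<Gamma> V x\<close> into
    \<open>m * \<Theta> x - m * \<theta> (p V) x\<close>; applying \<open>cis\<close> gives the
    claim.\<close>
  define \<Theta> where "\<Theta> x = (\<Sum>W\<in>\<V>. w W x * \<theta> (p W) x)" for x
  have "continuous_on A \<Theta>"
    unfolding \<Theta>_def using \<V>(2) continuous_on_subset[OF wc A(2)]
    by (intro continuous_on_sum continuous_on_mult \<theta>c) auto
  moreover have "f x ^ m * F x = cis (real m * \<Theta> x)" if xA: "x \<in> A" for x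
  proof -
    have x: "x \<in> S" using xA A by blast
    obtain V where V: "V \<in> \<V>" "x \<in> G V" using Gcov[OF x] by blast
    have pV: "\<psi> x \<in> p W" if "W \<in> \<V>" "x \<in> G W" for W using \<V>(3)[OF that(1)] that(2) by (auto simp: G_def)
    have "2 * pi * \<Gamma> V x = (\<Sum>W\<in>\<V>. w W x * (2 * pi * of_int (d V W)))"
      unfolding \<Gamma>_def sum_distrib_left by (intro sum.cong) auto
    also have "\<dots> = (\<Sum>W\<in>\<V>. m * (w W x * \<theta> (p W) x) - m * \<theta> (p V) x * w W x)"
    proof (rule sum.cong)
      fix W assume W: "W \<in> \<V>"
      show "w W x * (2 * pi * of_int (d V W)) = m * (w W x * \<theta> (p W) x) - m * \<theta> (p V) x * w W x"
      proof (cases "x \<in> G W")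
        case True
        then have "\<psi> x \<in> AX \<inter> (V \<inter> W)" using V xA x \<psi>X \<phi>\<psi> by (simp add: G_def AX_def)
        then have "d V W = int m * b (p V) (p W)" using d(2)[OF V(1) W] by blast
        then have "2 * pi * of_int (d V W) = m * (2 * pi * of_int (b (p V) (p W)))" by simp
        also have "2 * pi * of_int (b (p V) (p W)) = \<theta> (p W) x - \<theta> (p V) x"
          by (rule b\<theta>[OF \<V>(2)[OF V(1)] \<V>(2)[OF W] xA pV[OF V] pV[OF W True]])
        finally have E: "2 * pi * of_int (d V W) = m * (\<theta> (p W) x - \<theta> (p V) x)" .
        show ?thesis unfolding E by (simp add: algebra_simps)
      next
        case False
        then show ?thesis using w0[OF W x] by simp
      qed
    qed simp
    also have "\<dots> = m * \<Theta> x - m * \<theta> (p V) x"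
      using w1[OF x] by (simp add: sum_subtractf \<Theta>_def flip: sum_distrib_left)
    finally have *: "2 * pi * \<Gamma> V x = m * \<Theta> x - m * \<theta> (p V) x" .
    have "f x = cis (\<theta> (p V) x)" using \<theta>1[OF \<V>(2)[OF V(1)] xA pV[OF V]] by simp
    then have "f x ^ m = cis (m * \<theta> (p V) x)" by (simp only: Complex.DeMoivre)
    then have "f x ^ m * F x = cis (m * \<theta> (p V) x) * cis (2 * pi * \<Gamma> V x)"
      by (simp only: F[OF V])
    then show ?thesis unfolding * by (simp add: cis_mult)
  qed
  moreover have "\<forall>x\<in>S. norm (F x) = 1" by (simp add: F_def)
  ultimately show ?thesis using Fc \<V>(4) by blast
qed

subsection \<open>The tower of roots\<close>

lemma norm_eq_1_if_power:
  fixes z :: complex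
  assumes "norm (z ^ m) = 1" "m > 0"
  shows "norm z = 1"
  using assms power_eq_imp_eq_base[of "norm z" m 1] by (simp add: norm_power)

text \<open>The maps are finite partitions of unity with rational complex coefficients, normalised.
  Distance below \<open>1\<close> is what later gives the quotient of two circle-valued maps a
  positive real part.\<close>

lemma countable_dense_circle_maps:
  fixes S :: "'x::metric_space set"
  assumes S: "compact S"
  shows "\<exists>G :: nat \<Rightarrow> 'x \<Rightarrow> complex. (\<forall>j. continuous_on S (G j) \<and> (\<forall>x\<in>S. norm (G j x) = 1)) \<and>
     (\<forall>F. continuous_on S F \<and> (\<forall>x\<in>S. norm (F x) = 1) \<longrightarrow> (\<exists>j. \<forall>x\<in>S. norm (F x - G j x) < 1))"
proof -
  have "\<exists>(N::nat) p. (\<forall>i<N. p i \<in> S) \<and> S \<subseteq> (\<Union>i<N. ball (p i) (1 / Suc k))" for k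
  proof -
    have "S \<subseteq> (\<Union>c\<in>S. ball c (1 / Suc k))" by auto
    then obtain C where C: "C \<subseteq> S" "finite C" "S \<subseteq> (\<Union>c\<in>C. ball c (1 / Suc k))"
      by (rule compactE_image[OF S, of S "\<lambda>c. ball c (1 / Suc k)", rotated]) auto
    obtain p where p: "bij_betw p {0..<card C} C" using ex_bij_betw_nat_finite C(2) by blast
    then have pC: "p ` {..<card C} = C" by (simp add: bij_betw_def atLeast0LessThan)
    then have "S \<subseteq> (\<Union>c\<in>p ` {..<card C}. ball c (1 / Suc k))" using C(3) by (simp only:)
    moreover have "\<forall>i<card C. p i \<in> S" using pC C(1) by blast
    ultimately show ?thesis by (intro exI[of _ "card C"] exI[of _ p]) simp
  qed
  then obtain N :: "nat \<Rightarrow> nat" and p where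
    Np: "\<forall>k. (\<forall>i<N k. p k i \<in> S) \<and> S \<subseteq> (\<Union>i<N k. ball (p k i) (1 / Suc k))"
    by metis
  then have p: "\<And>k i. i < N k \<Longrightarrow> p k i \<in> S" and cov: "\<And>k. S \<subseteq> (\<Union>i<N k. ball (p k i) (1 / Suc k))"
    by blast+
  define \<beta> where "\<beta> k i = bump S (S \<inter> ball (p k i) (1 / Suc k))" for k i
  have \<beta>0: "\<beta> k i x \<ge> 0" for k i x by (simp add: \<beta>_def bump_nonneg)
  have \<beta>pos: "\<beta> k i x > 0 \<longleftrightarrow> x \<in> ball (p k i) (1 / Suc k)" if "x \<in> S" for k i x
    unfolding \<beta>_def using bump_pos_iff[OF S _ that, of "S \<inter> ball (p k i) (1 / Suc k)"] that by auto
  have \<beta>c: "continuous_on S (\<beta> k i)" for k i unfolding \<beta>_def by (rule continuous_on_bump)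
  define \<Sigma> where "\<Sigma> k x = (\<Sum>i<N k. \<beta> k i x)" for k x
  have \<Sigma>pos: "\<Sigma> k x > 0" if x: "x \<in> S" for k x
  proof -
    obtain i where "i < N k" "x \<in> ball (p k i) (1 / Suc k)" using cov[of k] x by blast
    then show ?thesis unfolding \<Sigma>_def
      using \<beta>pos[OF x] by (intro sum_pos2[where i=i]) (auto simp: \<beta>0)
  qed
  define q where "q u = Complex (of_rat (fst u)) (of_rat (snd u))" for u :: "rat \<times> rat"
  have q: "\<exists>u. norm (q u - z) < 1/8" for z
  proof -
    obtain a where a: "Re z - 1/16 < of_rat a" "of_rat a < Re z"
      using of_rat_dense[of "Re z - 1/16" "Re z"] by auto
    obtain b where b: "Im z - 1/16 < of_rat b" "of_rat b < Im z"
      using of_rat_dense[of "Im z - 1/16" "Im z"] by auto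
    have "norm (q (a, b) - z) \<le> \<bar>Re (q (a, b) - z)\<bar> + \<bar>Im (q (a, b) - z)\<bar>" by (rule cmod_le)
    also have "\<dots> < 1/8" using a b by (simp add: q_def)
    finally show ?thesis by blast
  qed
  define H where "H k l x = (\<Sum>i<N k. complex_of_real (\<beta> k i x / \<Sigma> k x) * q (l ! i))" for k l x
  have Hc: "continuous_on S (H k l)" for k l
    unfolding H_def \<Sigma>_def
  proof (intro continuous_on_sum continuous_on_mult continuous_on_of_real continuous_on_divide
           continuous_on_const \<beta>c ballI)
    show "(\<Sum>i<N k. \<beta> k i x) \<noteq> 0" if "x \<in> S" for x using \<Sigma>pos[OF that, of k] by (simp add: \<Sigma>_def)
  qed
  \<comment> \<open>Every pair of a mesh index and a coefficient list has a code. Combinations with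
    a zero cannot be normalised and are replaced by the constant \<open>1\<close>.\<close>
  define G where "G j = (let (k, l) = from_nat j in
     if \<forall>x\<in>S. H k l x \<noteq> 0 then (\<lambda>x. sgn (H k l x)) else (\<lambda>_. 1))" for j
  show ?thesis
  proof (intro exI[of _ G] conjI allI impI)
    fix j
    obtain k :: nat and l :: "(rat \<times> rat) list" where kl: "from_nat j = (k, l)" by fastforce
    show "continuous_on S (G j)"
      using Hc[of k l] by (auto simp: G_def kl intro!: continuous_on_sgn)
    show "\<forall>x\<in>S. norm (G j x) = 1" by (auto simp: G_def kl norm_sgn)
  next
    fix F :: "'x \<Rightarrow> complex" assume F: "continuous_on S F \<and> (\<forall>x\<in>S. norm (F x) = 1)"
    then have "uniformly_continuous_on S F" using S compact_uniformly_continuous by blast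
    then obtain d where d: "d > 0" "\<And>x y. x \<in> S \<Longrightarrow> y \<in> S \<Longrightarrow> dist y x < d \<Longrightarrow> dist (F y) (F x) < 1/8"
      unfolding uniformly_continuous_on_def by (metis zero_less_divide_1_iff zero_less_numeral)
    obtain k where k: "1 / Suc k < d" using nat_approx_posE[OF d(1)] by blast
    have "\<forall>i. \<exists>u. norm (q u - F (p k i)) < 1/8" using q by blast
    then obtain u where u: "\<And>i. norm (q (u i) - F (p k i)) < 1/8" by metis
    define l where "l = map u [0..<N k]"
    \<comment> \<open>The error is \<open>1/8\<close> from the coefficients and \<open>1/8\<close>
      from the oscillation of \<open>F\<close> on a ball. Normalising costs at most another
      \<open>1/4\<close>, so the total stays below \<open>1\<close>.\<close>
    have Happ: "norm (H k l x - F x) \<le> 1/4" if x: "x \<in> S" for x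
    proof -
      have s1: "(\<Sum>i<N k. \<beta> k i x / \<Sigma> k x) = 1"
        using \<Sigma>pos[OF x, of k] by (simp add: \<Sigma>_def flip: sum_divide_distrib)
      have "F x = (\<Sum>i<N k. complex_of_real (\<beta> k i x / \<Sigma> k x)) * F x"
        unfolding of_real_sum[symmetric] s1 by simp
      then have "H k l x - F x = (\<Sum>i<N k. complex_of_real (\<beta> k i x / \<Sigma> k x) * (q (u i) - F x))"
        by (simp add: H_def l_def sum_distrib_right right_diff_distrib sum_subtractf)
      also have "norm \<dots> \<le> (\<Sum>i<N k. \<beta> k i x / \<Sigma> k x * (1/4))"
      proof (rule sum_norm_le)
        fix i assume i: "i \<in> {..<N k}"
        show "norm (complex_of_real (\<beta> k i x / \<Sigma> k x) * (q (u i) - F x)) \<le> \<beta> k i x / \<Sigma> k x * (1/4)"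
        proof (cases "x \<in> ball (p k i) (1 / Suc k)")
          case True
          then have "dist (p k i) x < d" using k by simp
          then have "norm (F (p k i) - F x) < 1/8" using d(2) x p i by (simp add: dist_norm)
          then have "norm (q (u i) - F x) \<le> 1/4"
            using u[of i] norm_triangle_ineq[of "q (u i) - F (p k i)" "F (p k i) - F x"] by simp
          moreover have "0 \<le> \<beta> k i x / \<Sigma> k x" using \<beta>0 \<Sigma>pos[OF x, of k] by simp
          ultimately show ?thesis unfolding norm_mult norm_of_real
            by (intro mult_mono) auto
        next
          case False
          then have "\<beta> k i x = 0" using \<beta>pos[OF x, of k i] \<beta>0[of k i x] by linarith
          then show ?thesis by simp
        qed
      qed
      also have "\<dots> = 1/4" unfolding sum_distrib_right[symmetric] s1 by simp
      finally show ?thesis .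
    qed
    have Hn: "\<bar>norm (H k l x) - 1\<bar> \<le> 1/4" if x: "x \<in> S" for x
      using Happ[OF x] F x norm_triangle_ineq3[of "H k l x" "F x"] by simp
    then have nz: "H k l x \<noteq> 0" if "x \<in> S" for x using Hn[OF that] by auto
    have G: "G (to_nat (k, l)) x = sgn (H k l x)" for x using nz by (simp add: G_def)
    have "norm (F x - G (to_nat (k, l)) x) < 1" if x: "x \<in> S" for x
    proof -
      have "H k l x = norm (H k l x) * sgn (H k l x)" using nz[OF x] by (simp add: sgn_eq)
      then have "H k l x - sgn (H k l x) = complex_of_real (norm (H k l x) - 1) * sgn (H k l x)"
        by (simp add: left_diff_distrib)
      then have "norm (H k l x - sgn (H k l x)) = \<bar>norm (H k l x) - 1\<bar>"
        using nz[OF x] by (simp add: norm_mult norm_sgn del: of_real_diff)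
      then have "norm (H k l x - sgn (H k l x)) \<le> 1/4" using Hn[OF x] by simp
      moreover have "norm (F x - H k l x) \<le> 1/4" using Happ[OF x] by (simp add: norm_minus_commute)
      ultimately show ?thesis
        unfolding G using norm_triangle_ineq[of "F x - H k l x" "H k l x - sgn (H k l x)"] by simp
    qed
    then show "\<exists>j. \<forall>x\<in>S. norm (F x - G j x) < 1" by blast
  qed
qed

lemma compact_cube: "compact {w :: nat \<Rightarrow> complex. \<forall>j. norm (w j) \<le> 1}"
proof -
  have "compactin (product_topology (\<lambda>i. euclidean) UNIV) (PiE UNIV (\<lambda>_::nat. cball (0::complex) 1))"
    unfolding compactin_PiE by simp
  moreover have "PiE UNIV (\<lambda>_::nat. cball (0::complex) 1) = {w. \<forall>j. norm (w j) \<le> 1}"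
    by auto
  ultimately show ?thesis by (simp add: euclidean_product_topology)
qed

locale root_tower =
  fixes S :: "'x::{metric_space,second_countable_topology} set" and F :: "nat \<Rightarrow> 'x \<Rightarrow> complex" and M :: "nat \<Rightarrow> nat"
  assumes compact_S: "compact S" and F: "\<And>j. continuous_on S (F j)" "\<And>j x. x \<in> S \<Longrightarrow> norm (F j x) = 1"
    and M: "\<And>j. M j \<ge> 2"
begin

definition root_space :: "('x \<times> (nat \<Rightarrow> complex)) set" where
  "root_space = {(x, w). x \<in> S \<and> (\<forall>j. w j ^ M j = F j x)}"

text \<open>The missing roots are filled with \<open>0\<close>, so that all stages lie in the same
  compact \<open>box\<close> as \<open>root_space\<close> and can be compared with it in one
  metric.\<close>

definition stage :: "nat \<Rightarrow> ('x \<times> (nat \<Rightarrow> complex)) set" where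
  "stage k = {(x, w). x \<in> S \<and> (\<forall>j. if j < k then w j ^ M j = F j x else w j = 0)}"

definition trunc :: "nat \<Rightarrow> 'x \<times> (nat \<Rightarrow> complex) \<Rightarrow> 'x \<times> (nat \<Rightarrow> complex)" where
  "trunc k z = (fst z, \<lambda>j. if j < k then snd z j else 0)"

definition box :: "('x \<times> (nat \<Rightarrow> complex)) set" where
  "box = S \<times> {w. \<forall>j. norm (w j) \<le> 1}"

lemma compact_box: "compact box"
  unfolding box_def by (intro compact_Times compact_S compact_cube)

lemma norm_root: 
  assumes "w ^ M j = F j x" "x \<in> S"
  shows "norm w = 1"
  by (rule norm_eq_1_if_power[of w "M j"]) (use assms F(2)[of x j] M[of j] in auto)

lemma root_space_subset_box: "root_space \<subseteq> box"
proof
  fix z assume z: "z \<in> root_space"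
  then have "norm (snd z j) = 1" for j by (intro norm_root[of _ j "fst z"]) (auto simp: root_space_def)
  then show "z \<in> box" using z by (cases z) (auto simp: root_space_def box_def)
qed

lemma stage_subset_box: "stage k \<subseteq> box"
proof
  fix z assume z: "z \<in> stage k"
  obtain x w where xw: "z = (x, w)" by fastforce
  have "norm (w j) \<le> 1" for j
  proof (cases "j < k")
    case True
    then show ?thesis using z norm_root[of "w j" j x] by (auto simp: stage_def xw)
  next
    case False
    then have "w j = 0" using z by (auto simp: stage_def xw)
    then show ?thesis by simp
  qed
  then show "z \<in> box" using z by (auto simp: box_def stage_def xw)
qed

lemma continuous_on_snd_apply: "continuous_on A (\<lambda>z. snd z (j::nat))"
  by (rule continuous_on_compose2[OF continuous_on_product_coordinates[of j] continuous_on_snd[OF continuous_on_id]]) auto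

lemma continuous_on_F_fst: "continuous_on box (\<lambda>z. F j (fst z))"
  by (rule continuous_on_compose2[OF F(1)[of j] continuous_on_fst[OF continuous_on_id]]) (auto simp: box_def)

lemma closed_root_condition: "closed {z \<in> box. snd z j ^ M j - F j (fst z) = 0}"
  by (intro continuous_closed_preimage_constant continuous_on_diff continuous_on_power
       continuous_on_snd_apply continuous_on_F_fst compact_imp_closed compact_box)

lemma compact_root_space: "compact root_space"
proof -
  have "root_space = box \<inter> (\<Inter>j. {z \<in> box. snd z j ^ M j - F j (fst z) = 0})"
    using root_space_subset_box by (auto simp: root_space_def box_def)
  also have "compact \<dots>"
    by (intro compact_Int_closed compact_box closed_INT ballI closed_root_condition)
  finally show ?thesis .
qed

lemma compact_stage: "compact (stage k)"
proof -
  define C where "C j = (if j < k then {z \<in> box. snd z j ^ M j - F j (fst z) = 0} else {z \<in> box. snd z j = 0})" for j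
  have "stage k = box \<inter> (\<Inter>j. C j)"
  proof
    show "stage k \<subseteq> box \<inter> (\<Inter>j. C j)"
      using stage_subset_box[of k] by (auto simp: C_def stage_def split: if_splits)
    show "box \<inter> (\<Inter>j. C j) \<subseteq> stage k"
    proof
      fix z assume z: "z \<in> box \<inter> (\<Inter>j. C j)"
      then have zC: "z \<in> C j" for j by blast
      have "if j < k then snd z j ^ M j = F j (fst z) else snd z j = 0" for j
        using zC[of j] by (cases "j < k") (auto simp: C_def)
      moreover have "fst z \<in> S" using z by (auto simp: box_def)
      ultimately show "z \<in> stage k" by (simp only: stage_def case_prod_unfold mem_Collect_eq) blast
    qed
  qed
  moreover have "closed {z \<in> box. snd z j = 0}" for j
    by (intro continuous_closed_preimage_constant continuous_on_snd_apply compact_imp_closed compact_box)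
  then have "closed (C j)" for j
    using closed_root_condition[of j] by (cases "j < k") (simp_all only: C_def if_True if_False)
  then have "compact (box \<inter> (\<Inter>j. C j))"
    by (intro compact_Int_closed compact_box closed_INT ballI)
  ultimately show ?thesis by simp
qed

lemma continuous_on_trunc: "continuous_on A (trunc k)"
  unfolding trunc_def
proof (intro continuous_on_Pair continuous_on_fst continuous_on_id continuous_on_coordinatewise_then_product)
  show "continuous_on A (\<lambda>z. if j < k then snd z j else 0)" for j
    by (cases "j < k") (simp_all add: continuous_on_snd_apply)
qed

lemma trunc_in_stage: "z \<in> root_space \<Longrightarrow> trunc k z \<in> stage k"
  by (auto simp: root_space_def stage_def trunc_def)

lemma fst_trunc [simp]: "fst (trunc k z) = fst z" by (simp add: trunc_def)

lemma dist_trunc: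
  assumes "e > 0"
  obtains k where "\<And>z. dist (trunc k z) z < e"
proof -
  obtain N where N: "(1/2::real) ^ N < e" using real_arch_pow_inv[OF assms, of "1/2"] by auto
  \<comment> \<open>The metric on functions weighs the coordinates in the order of
    \<open>from_nat\<close>, so \<open>k\<close> has to exceed all of the first \<open>N + 1\<close>
    coordinates in that order.\<close>
  define k where "k = Suc (Max (from_nat ` {..N}))"
  have "dist (trunc k z) z < e" for z
  proof -
    have "dist (snd (trunc k z) (from_nat n)) (snd z (from_nat n)) = 0" if "n \<le> N" for n
    proof -
      have "from_nat n \<le> Max (from_nat ` {..N} :: nat set)" using that by (intro Max_ge) auto
      then have "from_nat n < k" by (simp add: k_def)
      then show ?thesis by (simp add: trunc_def)
    qed
    then have "{dist (snd (trunc k z) (from_nat n)) (snd z (from_nat n)) |n. n \<le> N} = {0}"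
      by force
    then have "dist (snd (trunc k z)) (snd z) \<le> (1/2) ^ N"
      using dist_fun_le_dist_first_terms[of "snd (trunc k z)" "snd z" N] by simp
    moreover have "dist (trunc k z) z = dist (snd (trunc k z)) (snd z)"
      by (simp add: dist_prod_def)
    ultimately show ?thesis using N by linarith
  qed
  then show ?thesis by (rule that)
qed

text \<open>Truncated points have zero coordinates and so lie outside \<open>root_space\<close>.
  Hence \<open>h\<close> is first extended by Tietze; uniform continuity on \<open>box\<close> then
  compares \<open>z\<close> with \<open>trunc k z\<close>.\<close>

lemma approx_by_stage:
  assumes h: "cont_fam m root_space h" and "e > 0"
  shows "\<exists>k a. cont_fam m (stage k) a \<and> near m root_space e (\<lambda>i z. a i (trunc k z)) h"
proof -
  have "\<exists>g. continuous_on UNIV g \<and> (\<forall>z\<in>root_space. g z = h i z)" if "i < m" for i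
  proof -
    have "closedin (top_of_set UNIV) root_space" using compact_root_space compact_imp_closed by (simp add: closed_closedin[symmetric])
    moreover have "continuous_on root_space (h i)" using h that by (simp add: cont_fam_def)
    ultimately show ?thesis using Tietze_unbounded by metis
  qed
  then obtain g where g: "\<And>i. i < m \<Longrightarrow> continuous_on UNIV (g i)"
    "\<And>i z. i < m \<Longrightarrow> z \<in> root_space \<Longrightarrow> g i z = h i z" by metis
  have "\<exists>d>0. \<forall>i\<in>{..<m}. \<forall>x\<in>box. \<forall>y\<in>box. dist x y < d \<longrightarrow> dist (g i x) (g i y) < e"
    by (rule uniformly_continuous_finite_family[OF _ compact_box _ \<open>e > 0\<close>])
       (auto intro: continuous_on_subset[OF g(1)])
  then obtain d where d: "d > 0" "\<forall>i\<in>{..<m}. \<forall>x\<in>box. \<forall>y\<in>box. dist x y < d \<longrightarrow> dist (g i x) (g i y) < e"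
    by blast
  obtain k where k: "\<And>z. dist (trunc k z) z < d" using dist_trunc[OF d(1)] by blast
  show ?thesis
  proof (intro exI[of _ k] exI[of _ g] conjI)
    show "cont_fam m (stage k) g" using g(1) continuous_on_subset unfolding cont_fam_def by blast
    show "near m root_space e (\<lambda>i z. g i (trunc k z)) h"
      unfolding near_def
    proof (intro allI impI ballI)
      fix i z assume i: "i < m" and z: "z \<in> root_space"
      then have "trunc k z \<in> box" "z \<in> box" using trunc_in_stage stage_subset_box root_space_subset_box by blast+
      then have "dist (g i (trunc k z)) (g i z) < e" using d(2) i k[of z] by blast
      then show "\<bar>h i z - g i (trunc k z)\<bar> \<le> e" using g(2)[OF i z] by (simp add: dist_real_def abs_minus_commute)
    qed
  qed
qed

text \<open>Two points of a fibre differ in some coordinate \<open>j < k\<close> by a root of unity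
  other than \<open>1\<close>. Only finitely many such roots occur, so that coordinate differs by at
  least a fixed \<open>\<eta>\<close>, and uniform continuity of the coordinates turns this into a
  distance.\<close>

lemma separated_fibres_stage:
  assumes "fine_covers S n"
  shows "\<exists>\<delta>. separated_fibres S n (stage k) fst \<delta>"
proof -
  define U where "U = (\<Union>j<k. {u::complex. u ^ M j = 1})"
  have "finite {u::complex. u ^ M j = 1}" for j using M[of j] by (intro finite_roots_unity) simp
  then have "finite U" unfolding U_def by blast
  then obtain \<eta> where \<eta>: "\<eta> > 0" "\<And>u. u \<in> U \<Longrightarrow> u \<noteq> 1 \<Longrightarrow> \<eta> \<le> dist 1 u"
    using finite_set_avoid by metis
  have "\<exists>d>0. \<forall>i\<in>{..<k}. \<forall>x\<in>stage k. \<forall>y\<in>stage k. dist x y < d \<longrightarrow> dist (snd x i) (snd y i) < \<eta>"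
    by (rule uniformly_continuous_finite_family[OF _ compact_stage _ \<eta>(1)])
       (auto intro: continuous_on_snd_apply)
  then obtain d where d: "d > 0"
    "\<forall>i\<in>{..<k}. \<forall>x\<in>stage k. \<forall>y\<in>stage k. dist x y < d \<longrightarrow> dist (snd x i) (snd y i) < \<eta>" by blast
  have "separated_fibres S n (stage k) fst d"
  proof
    show "continuous_on (stage k) fst" by (intro continuous_on_fst continuous_on_id)
    show "fst ` stage k \<subseteq> S" by (auto simp: stage_def)
    fix z z' assume z: "z \<in> stage k" "z' \<in> stage k" "fst z = fst z'" "z \<noteq> z'"
    then have "snd z \<noteq> snd z'" by (simp add: prod_eq_iff)
    then obtain j where j: "snd z j \<noteq> snd z' j" by blast
    have "j < k"
    proof (rule ccontr)
      assume "\<not> j < k"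
      then have "snd z j = 0" "snd z' j = 0" using z by (auto simp: stage_def split: if_splits)
      then show False using j by simp
    qed
    have x: "fst z \<in> S" using z by (auto simp: stage_def)
    have w: "snd z j ^ M j = F j (fst z)" "snd z' j ^ M j = F j (fst z)"
      using z \<open>j < k\<close> by (auto simp: stage_def split: if_splits)
    have n: "norm (snd z' j) = 1" by (rule norm_root[OF w(2) x])
    then have nz: "snd z' j \<noteq> 0" by auto
    define u where "u = snd z j / snd z' j"
    have "F j (fst z) \<noteq> 0" using F(2)[OF x, of j] by auto
    then have "u ^ M j = 1" using w by (simp add: u_def power_divide)
    then have "u \<in> U" using \<open>j < k\<close> by (auto simp: U_def)
    moreover have "u \<noteq> 1" using j nz by (simp add: u_def)
    ultimately have "\<eta> \<le> dist 1 u" using \<eta>(2) by blast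
    also have "dist 1 u = norm (snd z' j * (1 - u))" using n by (simp add: dist_norm norm_mult)
    also have "snd z' j * (1 - u) = snd z' j - snd z j" using nz by (simp add: u_def right_diff_distrib)
    also have "norm \<dots> = dist (snd z j) (snd z' j)" by (simp add: dist_norm norm_minus_commute)
    finally show "d \<le> dist z z'" using d(2) \<open>j < k\<close> z(1,2) by (meson lessThan_iff not_le)
  qed (use compact_S assms compact_stage d(1) in auto)
  then show ?thesis by blast
qed

lemma unstable_zero_root_space:
  assumes fine: "fine_covers S n" and r: "2 * r > n \<or> n = r + 2"
    and ext: "\<And>A f. closed A \<Longrightarrow> A \<subseteq> S \<Longrightarrow> continuous_on A f \<Longrightarrow> (\<And>x. x \<in> A \<Longrightarrow> norm (f x) = 1) \<Longrightarrow>
       \<exists>g. continuous_on root_space g \<and> (\<forall>z\<in>root_space. norm (g z) = 1) \<and>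
           (\<forall>z\<in>root_space. fst z \<in> A \<longrightarrow> g z = (f (fst z) :: complex))"
  shows "unstable_zero root_space (r + 2)"
  unfolding unstable_zero_def
proof (intro allI impI, elim conjE)
  fix h and e :: real assume h: "cont_fam (r + 2) root_space h" and "e > 0"
  \<comment> \<open>Half of \<open>e\<close> pays for replacing \<open>h\<close> by a family on a
    stage, the other half for moving that family off zero.\<close>
  then have e2: "e / 2 > 0" by simp
  obtain k a where a: "cont_fam (r + 2) (stage k) a"
    "near (r + 2) root_space (e/2) (\<lambda>i z. a i (trunc k z)) h"
    using approx_by_stage[OF h e2] by blast
  obtain \<delta> where "separated_fibres S n (stage k) fst \<delta>" using separated_fibres_stage[OF fine] ..
  then interpret separated_fibres S n "stage k" fst \<delta> .
  have sub: "trunc k ` root_space \<subseteq> stage k" using trunc_in_stage by blast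
  have ext': "\<exists>g. continuous_on root_space g \<and> (\<forall>z\<in>root_space. norm (g z) = 1) \<and>
           (\<forall>z\<in>root_space. fst (trunc k z) \<in> A \<longrightarrow> g z = (f (fst (trunc k z)) :: complex))"
    if "closed A" "A \<subseteq> S" "continuous_on A f" "\<And>x. x \<in> A \<Longrightarrow> norm (f x) = 1" for A f
    unfolding fst_trunc using that by (rule ext)
  show "\<exists>h'. cont_fam (r + 2) root_space h' \<and> near (r + 2) root_space e h h' \<and>
      (\<forall>z\<in>root_space. \<exists>i<r + 2. h' i z \<noteq> 0)"
  proof (rule avoid_zero_over_cover[OF compact_root_space continuous_on_trunc sub ext' r refl a(1) e2])
    fix h' assume h': "cont_fam (r + 2) root_space h'"
      "near (r + 2) root_space (e/2) (\<lambda>i z. a i (trunc k z)) h'"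
      "\<And>z. z \<in> root_space \<Longrightarrow> \<exists>i<r + 2. h' i z \<noteq> 0"
    have "near (r + 2) root_space (e/2) h (\<lambda>i z. a i (trunc k z))"
      using a(2) by (simp add: near_def abs_minus_commute)
    from near_trans[OF this h'(2)] have "near (r + 2) root_space e h h'" by simp
    then show ?thesis using h' by blast
  qed
qed

text \<open>If \<open>y\<close> is an \<open>m\<close>-th root of \<open>F\<close>, then \<open>f * y * cis (- \<Theta>)\<close> takes values in the \<open>m\<close>-th roots
  of unity, so its argument is a continuous real function and extends.\<close>

lemma circle_map_extends_over_root_space:
  fixes f :: "'x \<Rightarrow> complex"
  assumes dense: "\<And>F' m. continuous_on S F' \<Longrightarrow> (\<And>x. x \<in> S \<Longrightarrow> norm (F' x) = 1) \<Longrightarrow> m \<ge> 2 \<Longrightarrow>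
      \<exists>j. M j = m \<and> (\<forall>x\<in>S. norm (F' x - F j x) < 1)"
    and A: "closed A" "A \<subseteq> S"
    and pow: "m \<ge> 2" "continuous_on S F'" "\<And>x. x \<in> S \<Longrightarrow> norm (F' x) = 1" "continuous_on A \<Theta>"
       "\<And>x. x \<in> A \<Longrightarrow> f x ^ m * F' x = cis (real m * \<Theta> x)"
    and f: "continuous_on A f" "\<And>x. x \<in> A \<Longrightarrow> norm (f x) = 1"
  shows "\<exists>g. continuous_on root_space g \<and> (\<forall>z\<in>root_space. norm (g z) = 1) \<and>
           (\<forall>z\<in>root_space. fst z \<in> A \<longrightarrow> g z = f (fst z))"
proof -
  obtain j where j: "M j = m" "\<And>x. x \<in> S \<Longrightarrow> norm (F' x - F j x) < 1"
    using dense[OF pow(2,3,1)] by blast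
  have Fnz: "F j x \<noteq> 0" if "x \<in> S" for x using F(2)[OF that, of j] by auto
  define L where "L x = Ln (F' x / F j x)" for x
  have Re: "Re (F' x / F j x) > 0" if x: "x \<in> S" for x
  proof -
    have "norm (F' x / F j x - 1) = norm (F' x - F j x) / norm (F j x)"
      using Fnz[OF x] by (simp add: diff_divide_distrib flip: norm_divide)
    then have "norm (F' x / F j x - 1) < 1" using j(2)[OF x] F(2)[OF x, of j] by simp
    then have "\<bar>Re (F' x / F j x - 1)\<bar> < 1" using abs_Re_le_cmod order_le_less_trans by blast
    then show ?thesis by simp
  qed
  have Lc: "continuous_on S L"
    unfolding L_def
  proof (intro continuous_on_Ln' continuous_on_divide pow(2) F(1) ballI Fnz)
    show "F' x / F j x \<notin> \<real>\<^sub>\<le>\<^sub>0" if "x \<in> S" for x using Re[OF that] by (auto simp: complex_nonpos_Reals_iff)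
  qed
  have eL: "exp (L x) = F' x / F j x" if "x \<in> S" for x
    unfolding L_def using Re[OF that] by (intro exp_Ln) auto
  \<comment> \<open>\<open>F j\<close> only approximates \<open>F'\<close>; the root of
    \<open>F j\<close> is corrected by an \<open>m\<close>-th root of the quotient, obtained from
    its logarithm.\<close>
  define y where "y z = snd z j * exp (L (fst z) / m)" for z :: "'x \<times> (nat \<Rightarrow> complex)"
  have zS: "fst z \<in> S" if "z \<in> root_space" for z using that by (auto simp: root_space_def)
  have fstS: "fst ` root_space \<subseteq> S" using zS by blast
  have cfst: "continuous_on B fst" for B :: "('x \<times> (nat \<Rightarrow> complex)) set" by (intro continuous_on_fst continuous_on_id)
  have yc: "continuous_on root_space y"
    unfolding y_def
    by (intro continuous_on_mult continuous_on_snd_apply continuous_on_exp continuous_on_divide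
         continuous_on_const continuous_on_compose2[OF Lc cfst fstS]) (use pow(1) in auto)
  have ym: "y z ^ m = F' (fst z)" if z: "z \<in> root_space" for z
  proof -
    have "snd z j ^ m = F j (fst z)" using z j(1) by (auto simp: root_space_def)
    moreover have "exp (L (fst z) / m) ^ m = exp (L (fst z))"
      using pow(1) by (simp flip: exp_of_nat_mult)
    ultimately have "y z ^ m = F j (fst z) * (F' (fst z) / F j (fst z))"
      using eL[OF zS[OF z]] by (simp add: y_def power_mult_distrib)
    then show ?thesis using Fnz[OF zS[OF z]] by simp
  qed
  have y1: "norm (y z) = 1" if z: "z \<in> root_space" for z
    by (rule norm_eq_1_if_power[of _ m]) (use ym[OF z] pow(3)[OF zS[OF z]] pow(1) in auto)
  define B where "B = {z\<in>root_space. fst z \<in> A}"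
  have "closedin (top_of_set root_space) (root_space \<inter> fst -` A)"
    by (intro continuous_closedin_preimage cfst A)
  moreover have "root_space \<inter> fst -` A = B" by (auto simp: B_def)
  ultimately have Bcl: "closedin (top_of_set root_space) B" by simp
  have BA: "fst ` B \<subseteq> A" by (auto simp: B_def)
  define \<zeta> where "\<zeta> z = f (fst z) * y z * cis (- \<Theta> (fst z))" for z
  have \<zeta>c: "continuous_on B \<zeta>"
    unfolding \<zeta>_def
    by (intro continuous_on_mult continuous_on_cis continuous_on_minus continuous_on_compose2[OF f(1) cfst BA]
         continuous_on_compose2[OF pow(4) cfst BA] continuous_on_subset[OF yc]) (auto simp: B_def)
  have \<zeta>m: "\<zeta> z ^ m = 1" if z: "z \<in> B" for z
  proof -
    have z': "z \<in> root_space" "fst z \<in> A" using z by (auto simp: B_def)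
    have "\<zeta> z ^ m = f (fst z) ^ m * F' (fst z) * cis (- (m * \<Theta> (fst z)))"
      by (simp add: \<zeta>_def power_mult_distrib Complex.DeMoivre ym[OF z'(1)])
    also have "\<dots> = 1" unfolding pow(5)[OF z'(2)] by (simp add: cis_mult)
    finally show ?thesis .
  qed
  \<comment> \<open>On a finite set every function is continuous, so the jump of \<open>Arg\<close>
    does no harm.\<close>
  have "finite {u::complex. u ^ m = 1}" using pow(1) by (intro finite_roots_unity) simp
  then have "continuous_on {u::complex. u ^ m = 1} Arg" by (rule continuous_on_finite)
  then have "continuous_on B (\<lambda>z. Arg (\<zeta> z))"
    by (rule continuous_on_compose2[OF _ \<zeta>c]) (use \<zeta>m in auto)
  from Tietze_unbounded[OF this Bcl]
  obtain \<alpha> where \<alpha>: "continuous_on root_space \<alpha>" "\<And>z. z \<in> B \<Longrightarrow> \<alpha> z = Arg (\<zeta> z)"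
    by blast
  have "continuous_on B (\<lambda>z. \<Theta> (fst z))" by (rule continuous_on_compose2[OF pow(4) cfst BA])
  from Tietze_unbounded[OF this Bcl]
  obtain \<theta> where \<theta>: "continuous_on root_space \<theta>" "\<And>z. z \<in> B \<Longrightarrow> \<theta> z = \<Theta> (fst z)"
    by blast
  show ?thesis
  \<comment> \<open>The definition of \<open>\<zeta>\<close> solved for \<open>f\<close>, with both
    angles replaced by their extensions to \<open>root_space\<close>.\<close>
  proof (intro exI[of _ "\<lambda>z. cis (\<alpha> z) * cis (\<theta> z) / y z"] conjI ballI impI)
    show "continuous_on root_space (\<lambda>z. cis (\<alpha> z) * cis (\<theta> z) / y z)"
      using y1 by (intro continuous_on_divide continuous_on_mult continuous_on_cis \<alpha>(1) \<theta>(1) yc) force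
    fix z assume z: "z \<in> root_space"
    show "norm (cis (\<alpha> z) * cis (\<theta> z) / y z) = 1" using y1[OF z] by (simp add: norm_mult norm_divide)
    assume "fst z \<in> A"
    then have zB: "z \<in> B" using z by (simp add: B_def)
    have "norm (\<zeta> z) = 1" by (rule norm_eq_1_if_power[of _ m]) (use \<zeta>m[OF zB] pow(1) in auto)
    then have "cis (Arg (\<zeta> z)) = \<zeta> z" by (subst cis_Arg) (auto simp: sgn_eq)
    then have "cis (\<alpha> z) * cis (\<theta> z) = f (fst z) * y z * (cis (- \<Theta> (fst z)) * cis (\<Theta> (fst z)))"
      using \<alpha>(2)[OF zB] \<theta>(2)[OF zB] by (simp add: \<zeta>_def mult.assoc)
    also have "\<dots> = f (fst z) * y z" by (simp add: cis_mult)
    finally show "cis (\<alpha> z) * cis (\<theta> z) / y z = f (fst z)" using y1[OF z] by auto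
  qed
qed

end

subsection \<open>Embedding compacta\<close>

text \<open>A point is determined by its distances to a countable dense set, here the union of
  finite nets. This moves X into a type with a second countable metric topology, where the preceding
  sections apply.\<close>

lemma compactum_embeds_in_sequences:
  fixes X :: "'a topology"
  assumes "compactum X"
  shows "\<exists>(S :: (nat \<Rightarrow> real) set) \<phi> \<psi>. compact S \<and> homeomorphic_maps X (top_of_set S) \<phi> \<psi>"
proof -
  have comp: "compact_space X" and "metrizable_space X" using assms by (auto simp: compactum_def)
  then obtain M d where Md: "Metric_space M d" and X: "X = Metric_space.mtopology M d"
    by (auto simp: metrizable_space_def)
  interpret Metric_space M d by (rule Md)
  have "mtotally_bounded M"
    using comp X compact_space_eq_mcomplete_mtotally_bounded by simp
  then have "\<forall>k. \<exists>K. finite K \<and> K \<subseteq> M \<and> M \<subseteq> (\<Union>x\<in>K. mball x (1 / Suc k))"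
    by (simp add: mtotally_bounded_def)
  then obtain K where K: "\<And>k. finite (K k)" "\<And>k. K k \<subseteq> M" "\<And>k. M \<subseteq> (\<Union>x\<in>K k. mball x (1 / Suc k))"
    by metis
  define C where "C = (\<Union>k. K k)"
  have "countable C" unfolding C_def using K(1) by (intro countable_UN) (auto intro: countable_finite)
  have CM: "C \<subseteq> M" using K(2) by (auto simp: C_def)
  \<comment> \<open>\<open>C\<close> is empty only if \<open>M\<close> is; the value
    \<open>0\<close> then merely makes \<open>f\<close> total.\<close>
  define f where "f x j = (if C = {} then 0 else d (from_nat_into C j) x)" for x j
  have fc: "continuous_map X euclidean (\<lambda>x. f x j)" for j
  proof (cases "C = {}")
    case False
    then have "from_nat_into C j \<in> M" using CM from_nat_into[OF False, of j] by blast
    then have "from_nat_into C j \<in> mspace (metric (M, d))" using Md by simp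
    then have "continuous_map (mtopology_of (metric (M, d))) euclidean (mdist (metric (M, d)) (from_nat_into C j))"
      by (rule continuous_on_mdist)
    moreover have "mtopology_of (metric (M, d)) = X" using Md by (simp add: mtopology_of_def X)
    moreover have "mdist (metric (M, d)) = d" using Md by simp
    ultimately show ?thesis using False by (simp add: f_def)
  qed (simp add: f_def)
  have f: "continuous_map X euclidean f"
    using fc continuous_map_componentwise_UNIV[of X "\<lambda>_. euclidean" f]
    by (simp add: euclidean_product_topology)
  have tM: "topspace X = M" by (simp add: X)
  have inj: "inj_on f (topspace X)"
  proof (rule inj_onI, rule ccontr)
    fix x y assume xy: "x \<in> topspace X" "y \<in> topspace X" "f x = f y" "x \<noteq> y"
    then have M: "x \<in> M" "y \<in> M" by (auto simp: tM)
    then have "d x y > 0" using xy(4) by simp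
    then obtain k where k: "1 / Suc k < d x y / 2" using nat_approx_posE[of "d x y / 2"] by auto
    obtain c where c: "c \<in> K k" "x \<in> mball c (1 / Suc k)" using K(3)[of k] M by blast
    then have "c \<in> C" by (auto simp: C_def)
    then have "C \<noteq> {}" by blast
    obtain j where "from_nat_into C j = c" using from_nat_into_surj[OF \<open>countable C\<close> \<open>c \<in> C\<close>] by blast
    then have "d c x = d c y" using fun_cong[OF xy(3), of j] \<open>C \<noteq> {}\<close> by (simp add: f_def)
    moreover have "d c x < 1 / Suc k" using c by simp
    moreover have "d x y \<le> d c x + d c y" using triangle'[of x c y] c M CM \<open>c \<in> C\<close> commute by (metis triangle subsetD)
    ultimately show False using k by linarith
  qed
  define S where "S = f ` topspace X"
  have "compactin X (topspace X)" using comp by (simp add: compact_space_def)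
  then have S: "compact S" using image_compactin[OF _ f] by (auto simp: S_def)
  have "homeomorphic_map X (top_of_set S) f"
  proof (rule continuous_imp_homeomorphic_map[OF _ comp _ _ inj])
    show "continuous_map X (top_of_set S) f"
      using f by (intro continuous_map_into_subtopology) (auto simp: S_def)
    show "f ` topspace X = topspace (top_of_set S)" by (simp add: S_def)
  qed (simp add: Hausdorff_space_subtopology Hausdorff_space_euclidean)
  then obtain \<psi> where "homeomorphic_maps X (top_of_set S) f \<psi>" using homeomorphic_map_maps by blast
  then show ?thesis using S by blast
qed

subsection \<open>The Cantor set as a product of finite sets\<close>

text \<open>A sequence of bits is read as a sequence of digits \<open>x j < M j\<close> in unary: the digit \<open>t\<close> is
  written as \<open>t\<close> times \<open>True\<close> followed by \<open>False\<close>, which is omitted for the largest digit.\<close>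

definition digit :: "(nat \<Rightarrow> bool) \<Rightarrow> nat \<Rightarrow> nat \<Rightarrow> nat" where
  "digit b p m = (LEAST t. t \<ge> m - 1 \<or> \<not> b (p + t))"

definition code_length :: "nat \<Rightarrow> nat \<Rightarrow> nat" where
  "code_length m t = (if t < m - 1 then Suc t else m - 1)"

primrec position :: "(nat \<Rightarrow> nat) \<Rightarrow> (nat \<Rightarrow> bool) \<Rightarrow> nat \<Rightarrow> nat" where
  "position M b 0 = 0"
| "position M b (Suc j) = position M b j + code_length (M j) (digit b (position M b j) (M j))"

definition decode :: "(nat \<Rightarrow> nat) \<Rightarrow> (nat \<Rightarrow> bool) \<Rightarrow> nat \<Rightarrow> nat" where
  "decode M b j = digit b (position M b j) (M j)"

lemma digit_le: "digit b p m \<le> m - 1"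
  unfolding digit_def by (rule Least_le) simp

lemma digit_prefix: "t < digit b p m \<Longrightarrow> b (p + t)"
  unfolding digit_def using not_less_Least by blast

lemma digit_stop: "digit b p m < m - 1 \<Longrightarrow> \<not> b (p + digit b p m)"
  unfolding digit_def using LeastI[of "\<lambda>t. t \<ge> m - 1 \<or> \<not> b (p + t)" "m - 1"] by auto

lemma digit_eqI:
  assumes "\<And>t. t < x \<Longrightarrow> b (p + t)" "x < m - 1 \<Longrightarrow> \<not> b (p + x)" "x \<le> m - 1"
  shows "digit b p m = x"
  unfolding digit_def
proof (rule Least_equality)
  show "m - 1 \<le> x \<or> \<not> b (p + x)" using assms(2,3) by linarith
  show "x \<le> y" if "m - 1 \<le> y \<or> \<not> b (p + y)" for y
    using that assms(1)[of y] assms(3) by linarith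
qed

lemma digit_cong:
  assumes "\<And>i. i < p + m \<Longrightarrow> b i = b' i"
  shows "digit b p m = digit b' p m"
proof (rule digit_eqI)
  show "b (p + t)" if "t < digit b' p m" for t
    using digit_prefix[OF that] assms[of "p + t"] that digit_le[of b' p m] by simp
  show "\<not> b (p + digit b' p m)" if "digit b' p m < m - 1"
    using digit_stop[OF that] assms[of "p + digit b' p m"] that by simp
qed (rule digit_le)

text \<open>Reading the first \<open>j\<close> digits consumes finitely many bits, though how many
  depends on \<open>b\<close>. This is the source of the continuity of
  \<open>decode\<close>.\<close>

lemma position_locally_constant:
  "\<exists>N. \<forall>b'. (\<forall>i<N. b' i = b i) \<longrightarrow> position M b' j = position M b j"
proof (induction j)
  case (Suc j)
  then obtain N where N: "\<forall>b'. (\<forall>i<N. b' i = b i) \<longrightarrow> position M b' j = position M b j" ..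
  show ?case
  proof (intro exI[of _ "max N (position M b j + M j)"] allI impI)
    fix b' assume b': "\<forall>i<max N (position M b j + M j). b' i = b i"
    then have 1: "position M b' j = position M b j" by (intro N[rule_format]) simp
    have "digit b' (position M b j) (M j) = digit b (position M b j) (M j)"
      using b' by (intro digit_cong) simp
    then show "position M b' (Suc j) = position M b (Suc j)" using 1 by simp
  qed
qed simp

lemma decode_locally_constant:
  "\<exists>N. \<forall>b'. (\<forall>i<N. b' i = b i) \<longrightarrow> decode M b' j = decode M b j"
proof -
  obtain N where N: "\<forall>b'. (\<forall>i<N. b' i = b i) \<longrightarrow> position M b' j = position M b j"
    using position_locally_constant[of b M j] ..
  show ?thesis
  proof (intro exI[of _ "max N (position M b j + M j)"] allI impI)
    fix b' assume b': "\<forall>i<max N (position M b j + M j). b' i = b i"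
    then have "position M b' j = position M b j" by (intro N[rule_format]) simp
    moreover have "digit b' (position M b j) (M j) = digit b (position M b j) (M j)"
      using b' by (intro digit_cong) simp
    ultimately show "decode M b' j = decode M b j" by (simp add: decode_def)
  qed
qed

lemma continuous_on_decode:
  fixes g :: "nat \<Rightarrow> 'b::topological_space"
  shows "continuous_on UNIV (\<lambda>b. g (decode M b j))"
  unfolding continuous_on_open_vimage[OF open_UNIV]
proof (intro allI impI)
  fix B :: "'b set" assume "open B"
  have "open ((\<lambda>b. g (decode M b j)) -` B)"
  proof (subst open_subopen, intro ballI)
    fix b assume b: "b \<in> (\<lambda>b. g (decode M b j)) -` B"
    obtain N where N: "\<forall>b'. (\<forall>i<N. b' i = b i) \<longrightarrow> decode M b' j = decode M b j"
      using decode_locally_constant[of b M j] ..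
    define T where "T = (\<Inter>i\<in>{..<N}. (\<lambda>b'::nat \<Rightarrow> bool. b' i) -` {b i})"
    have "open T"
      unfolding T_def by (intro open_INT ballI open_vimage open_discrete continuous_on_product_coordinates) auto
    moreover have "b \<in> T" by (simp add: T_def)
    moreover have "T \<subseteq> (\<lambda>b. g (decode M b j)) -` B"
    proof
      fix b' assume "b' \<in> T"
      then have "decode M b' j = decode M b j" by (intro N[rule_format]) (simp add: T_def)
      then show "b' \<in> (\<lambda>b. g (decode M b j)) -` B" using b by simp
    qed
    ultimately show "\<exists>T. open T \<and> b \<in> T \<and> T \<subseteq> (\<lambda>b. g (decode M b j)) -` B" by blast
  qed
  then show "open ((\<lambda>b. g (decode M b j)) -` B \<inter> UNIV)" by simp
qed

section \<open>Bijectivity of the unary code and its reading as roots of unity\<close>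

context
  fixes M :: "nat \<Rightarrow> nat"
  assumes M: "\<And>j. M j \<ge> 2"
begin

text \<open>A digit with a single possible value would have the empty code word. Nonempty code words
  make the blocks exhaust all bits.\<close>

lemma code_length_pos: "code_length (M j) t > 0"
  using M[of j] by (auto simp: code_length_def)

lemma position_ge: "position M b j \<ge> j"
proof (induction j)
  case (Suc j)
  then show ?case using code_length_pos[of j "digit b (position M b j) (M j)"] by simp
qed simp

lemma block_exists:
  fixes P :: "nat \<Rightarrow> nat"
  assumes "P 0 = 0" "\<And>j. P j \<ge> j"
  shows "\<exists>j. P j \<le> i \<and> i < P (Suc j)"
proof -
  have "\<exists>j. i < P j" using assms(2)[of "Suc i"] by (intro exI[of _ "Suc i"]) simp
  then have L: "i < P (LEAST j. i < P j)" by (rule LeastI_ex)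
  then have "(LEAST j. i < P j) \<noteq> 0" using assms(1) by (metis not_less0)
  then obtain j where j: "(LEAST j. i < P j) = Suc j" using not0_implies_Suc by blast
  then have "\<not> i < P j" using not_less_Least[of j "\<lambda>j. i < P j"] by simp
  then show ?thesis using L j by (intro exI[of _ j]) simp
qed

lemma inj_decode: "inj (decode M)"
proof (rule injI)
  fix b b' assume eq: "decode M b = decode M b'"
  have pos: "position M b j = position M b' j" for j
  proof (induction j)
    case (Suc j)
    have "digit b (position M b j) (M j) = digit b' (position M b' j) (M j)"
      using fun_cong[OF eq, of j] by (simp add: decode_def)
    then show ?case using Suc by simp
  qed simp
  have bit: "c i \<longleftrightarrow> i - position M c j < decode M c j"
    if i: "position M c j \<le> i" "i < position M c (Suc j)" for c i j
  proof -
    obtain t where t: "i = position M c j + t" using i(1) le_Suc_ex by blast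
    have tl: "t < code_length (M j) (decode M c j)" using i(2) t by (simp add: decode_def)
    show ?thesis
    proof (cases "t < decode M c j")
      case True
      then show ?thesis using digit_prefix[of t c "position M c j" "M j"] t by (simp add: decode_def)
    next
      case False
      then have "decode M c j < M j - 1" "t = decode M c j"
        using tl by (auto simp: code_length_def split: if_splits)
      then show ?thesis using digit_stop[of c "position M c j" "M j"] t by (simp add: decode_def)
    qed
  qed
  show "b = b'"
  proof
    fix i
    obtain j where j: "position M b j \<le> i" "i < position M b (Suc j)"
      using block_exists[of "position M b" i] position_ge by auto
    have "b i \<longleftrightarrow> i - position M b j < decode M b j" by (rule bit[OF j])
    moreover have "b' i \<longleftrightarrow> i - position M b' j < decode M b' j"
      using j unfolding pos by (rule bit)
    ultimately show "b i = b' i" using eq pos by simp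
  qed
qed

lemma decode_less: "decode M b j < M j"
  using digit_le[of b "position M b j" "M j"] M[of j] by (simp add: decode_def)

lemma decode_surj:
  assumes x: "\<And>j. x j < M j"
  shows "\<exists>b. decode M b = x"
proof -
  define P where "P = rec_nat 0 (\<lambda>j p. p + code_length (M j) (x j))"
  have P0: "P 0 = 0" and PS: "P (Suc j) = P j + code_length (M j) (x j)" for j
    by (simp_all add: P_def)
  have mono: "P i \<le> P j" if "i \<le> j" for i j
    using that by (induction rule: dec_induct) (auto simp: PS)
  have xl: "x j \<le> code_length (M j) (x j)" for j using x[of j] by (auto simp: code_length_def)
  \<comment> \<open>The code words written one after another: block \<open>j\<close> starts at
    \<open>P j\<close> and opens with \<open>x j\<close> bits that are \<open>True\<close>.\<close>
  define b where "b i = (\<exists>j. P j \<le> i \<and> i < P j + x j)" for i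
  have dig: "digit b (P j) (M j) = x j" for j
  proof (rule digit_eqI)
    show "b (P j + t)" if "t < x j" for t using that by (auto simp: b_def intro!: exI[of _ j])
    show "\<not> b (P j + x j)" if "x j < M j - 1"
    proof
      assume "b (P j + x j)"
      then obtain k where k: "P k \<le> P j + x j" "P j + x j < P k + x k" by (auto simp: b_def)
      \<comment> \<open>Since \<open>x j\<close> is not the largest digit, its block ends with the
        terminating bit at \<open>P j + x j\<close>, and later blocks start beyond it.\<close>
      have S: "P (Suc j) = Suc (P j + x j)" using that by (simp add: PS code_length_def)
      consider "k < j" | "k = j" | "Suc j \<le> k" by linarith
      then show False
      proof cases
        case 1
        then have "P (Suc k) \<le> P j" by (intro mono) simp
        then show False using k(2) xl[of k] PS[of k] by linarith
      next
        case 2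
        then show False using k(2) by simp
      next
        case 3
        then show False using mono[OF 3] k(1) S by linarith
      qed
    qed
    show "x j \<le> M j - 1" using x[of j] by simp
  qed
  have "position M b j = P j" for j
    by (induction j) (simp_all add: P0 PS dig)
  then have "decode M b = x" by (intro ext) (simp add: decode_def dig)
  then show ?thesis by blast
qed

definition roots_of_unity :: "(nat \<Rightarrow> complex) set" where
  "roots_of_unity = {\<gamma>. \<forall>j. \<gamma> j ^ M j = 1}"

definition root_code :: "(nat \<Rightarrow> bool) \<Rightarrow> nat \<Rightarrow> complex" where
  "root_code b j = cis (2 * pi * real (decode M b j) / real (M j))"

lemma bij_root_code: "bij_betw root_code UNIV roots_of_unity"
proof -
  have bij: "bij_betw (\<lambda>k. cis (2 * pi * real k / real (M j))) {..<M j} {z. z ^ M j = 1}" for j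
    by (rule Complex.bij_betw_roots_unity) (use M[of j] in simp)
  have "inj root_code"
  proof (rule injI)
    fix b b' assume eq: "root_code b = root_code b'"
    have "decode M b j = decode M b' j" for j
      using fun_cong[OF eq, of j] bij[of j] decode_less unfolding root_code_def bij_betw_def inj_on_def by blast
    then show "b = b'" using inj_decode by (metis ext injD)
  qed
  moreover have "root_code ` UNIV = roots_of_unity"
  proof
    show "root_code ` UNIV \<subseteq> roots_of_unity"
      using bij_betw_apply[OF bij] decode_less by (auto simp: roots_of_unity_def root_code_def)
    show "roots_of_unity \<subseteq> root_code ` UNIV"
    proof
      fix \<gamma> assume \<gamma>: "\<gamma> \<in> roots_of_unity"
      have "\<forall>j. \<exists>k. k < M j \<and> \<gamma> j = cis (2 * pi * real k / real (M j))"
      proof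
        fix j
        have "\<gamma> j \<in> {z. z ^ M j = 1}" using \<gamma> by (simp add: roots_of_unity_def)
        then have "\<gamma> j \<in> (\<lambda>k. cis (2 * pi * real k / real (M j))) ` {..<M j}"
          using bij[of j] by (simp only: bij_betw_def)
        then show "\<exists>k. k < M j \<and> \<gamma> j = cis (2 * pi * real k / real (M j))" by blast
      qed
      then obtain x where x: "\<And>j. x j < M j" "\<And>j. \<gamma> j = cis (2 * pi * real (x j) / real (M j))" by metis
      obtain b where "decode M b = x" using decode_surj[of x] x(1) by blast
      then have "root_code b = \<gamma>" by (intro ext) (simp add: root_code_def x(2))
      then show "\<gamma> \<in> root_code ` UNIV" by blast
    qed
  qed
  ultimately show ?thesis by (simp add: bij_betw_def)
qed

lemma continuous_on_root_code: "continuous_on UNIV root_code"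
  unfolding root_code_def
  by (intro continuous_on_coordinatewise_then_product continuous_on_decode)

end

lemma cantor_space_eq_euclidean: "cantor_space = euclidean"
proof -
  have "discrete_topology UNIV = (euclidean :: bool topology)"
    by (simp add: topology_eq open_discrete)
  then show ?thesis by (simp add: cantor_space_def euclidean_product_topology)
qed

lemma compact_bits: "compact (UNIV :: (nat \<Rightarrow> bool) set)"
proof -
  have "compact_space cantor_space"
    by (simp add: cantor_space_def compact_space_product_topology compact_space_discrete_topology)
  then show ?thesis by (simp add: cantor_space_eq_euclidean compact_space_def)
qed

subsection \<open>Orbit spaces\<close>

text \<open>The orbits are the fibres of \<open>p\<close>, so \<open>p\<close> induces a continuous
  bijection from the compact orbit space to a Hausdorff space, which is a homeomorphism.\<close>

lemma orbit_space_homeomorphic: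
  assumes comp: "compact_space Z" and X: "Hausdorff_space X"
    and p: "continuous_map Z X p" "p ` topspace Z = topspace X"
    and fibre: "\<And>z. z \<in> topspace Z \<Longrightarrow> {act g z |g. g \<in> carrier G} = {y \<in> topspace Z. p y = p z}"
  shows "orbit_space G Z act homeomorphic_space X"
proof -
  define O' where "O' z = {y \<in> topspace Z. p y = p z}" for z
  have orbs: "orbits G Z act = O' ` topspace Z"
  proof -
    have "orbits G Z act = (\<lambda>z. {act g z |g. g \<in> carrier G}) ` topspace Z"
      by (auto simp: orbits_def)
    also have "\<dots> = O' ` topspace Z"
      by (rule image_cong[OF refl]) (simp only: fibre O'_def)
    finally show ?thesis .
  qed
  have disj: "A = O' z" if "A \<in> orbits G Z act" "z \<in> A" for A z
    using that by (auto simp: orbs O'_def)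
  have mem: "z \<in> O' z" if "z \<in> topspace Z" for z using that by (simp add: O'_def)
  \<comment> \<open>\<open>topology\<close> means something only for a genuine topology. For
    intersections this uses that distinct orbits are disjoint.\<close>
  have ist: "istopology (\<lambda>\<O>. \<O> \<subseteq> orbits G Z act \<and> openin Z (\<Union>\<O>))"
    unfolding istopology_def
  proof (intro conjI allI impI)
    fix \<A> \<B> assume A: "\<A> \<subseteq> orbits G Z act \<and> openin Z (\<Union>\<A>)" and B: "\<B> \<subseteq> orbits G Z act \<and> openin Z (\<Union>\<B>)"
    then show "\<A> \<inter> \<B> \<subseteq> orbits G Z act" by blast
    have "\<Union>(\<A> \<inter> \<B>) = \<Union>\<A> \<inter> \<Union>\<B>"
    proof
      show "\<Union>\<A> \<inter> \<Union>\<B> \<subseteq> \<Union>(\<A> \<inter> \<B>)"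
      proof
        fix z assume "z \<in> \<Union>\<A> \<inter> \<Union>\<B>"
        then obtain a c where "a \<in> \<A>" "z \<in> a" "c \<in> \<B>" "z \<in> c" by blast
        moreover from this have "a = O' z" "c = O' z" using disj A B by blast+
        ultimately show "z \<in> \<Union>(\<A> \<inter> \<B>)" by blast
      qed
    qed blast
    then show "openin Z (\<Union>(\<A> \<inter> \<B>))" using A B by auto
  next
    fix \<K> assume K: "\<forall>K\<in>\<K>. K \<subseteq> orbits G Z act \<and> openin Z (\<Union>K)"
    then show "\<Union>\<K> \<subseteq> orbits G Z act" by blast
    have "\<Union>(\<Union>\<K>) = (\<Union>K\<in>\<K>. \<Union>K)" by blast
    moreover have "openin Z (\<Union>K\<in>\<K>. \<Union>K)" using K by (intro openin_Union) auto
    ultimately show "openin Z (\<Union>(\<Union>\<K>))" by simp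
  qed
  have opn: "openin (orbit_space G Z act) \<O> \<longleftrightarrow> \<O> \<subseteq> orbits G Z act \<and> openin Z (\<Union>\<O>)" for \<O>
    unfolding orbit_space_def using topology_inverse'[OF ist] by simp
  have "\<Union>(orbits G Z act) = topspace Z" using mem by (auto simp: orbs O'_def)
  then have "openin (orbit_space G Z act) (orbits G Z act)" by (simp add: opn)
  then have top: "topspace (orbit_space G Z act) = orbits G Z act"
    using opn by (metis openin_subset openin_topspace subset_antisym)
  have qc: "continuous_map Z (orbit_space G Z act) O'"
    unfolding continuous_map_def
  proof (intro conjI allI impI)
    show "O' \<in> topspace Z \<rightarrow> topspace (orbit_space G Z act)" by (auto simp: top orbs)
    fix \<O> assume "openin (orbit_space G Z act) \<O>"
    then have O: "\<O> \<subseteq> orbits G Z act" "openin Z (\<Union>\<O>)" by (auto simp: opn)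
    have "{z \<in> topspace Z. O' z \<in> \<O>} = \<Union>\<O>"
    proof
      show "{z \<in> topspace Z. O' z \<in> \<O>} \<subseteq> \<Union>\<O>" using mem by blast
      show "\<Union>\<O> \<subseteq> {z \<in> topspace Z. O' z \<in> \<O>}"
      proof
        fix z assume "z \<in> \<Union>\<O>"
        then obtain A where A: "A \<in> \<O>" "z \<in> A" by blast
        then have "A = O' z" using disj O(1) by blast
        then show "z \<in> {z \<in> topspace Z. O' z \<in> \<O>}" using A by (auto simp: O'_def)
      qed
    qed
    then show "openin Z {z \<in> topspace Z. O' z \<in> \<O>}" using O(2) by simp
  qed
  have "compactin Z (topspace Z)" using comp by (simp add: compact_space_def)
  then have "compactin (orbit_space G Z act) (O' ` topspace Z)" using image_compactin[OF _ qc] by blast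
  then have co: "compact_space (orbit_space G Z act)" by (simp add: compact_space_def top orbs)
  \<comment> \<open>The choice of a representative is harmless because \<open>p\<close> is constant
    on each orbit.\<close>
  define r where "r A = p (SOME z. z \<in> A)" for A
  have rO: "r (O' z) = p z" if "z \<in> topspace Z" for z
  proof -
    have "(SOME y. y \<in> O' z) \<in> O' z" by (rule someI[of _ z]) (rule mem[OF that])
    then show ?thesis by (simp add: r_def O'_def)
  qed
  have rc: "continuous_map (orbit_space G Z act) X r"
    unfolding continuous_map_def
  proof (intro conjI allI impI)
    show "r \<in> topspace (orbit_space G Z act) \<rightarrow> topspace X" using rO p(2) by (auto simp: top orbs)
    fix U assume U: "openin X U"
    have "\<Union>{A \<in> topspace (orbit_space G Z act). r A \<in> U} = {z \<in> topspace Z. p z \<in> U}"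
    proof
      show "\<Union>{A \<in> topspace (orbit_space G Z act). r A \<in> U} \<subseteq> {z \<in> topspace Z. p z \<in> U}"
        using rO by (auto simp: top orbs O'_def)
      show "{z \<in> topspace Z. p z \<in> U} \<subseteq> \<Union>{A \<in> topspace (orbit_space G Z act). r A \<in> U}"
      proof
        fix z assume z: "z \<in> {z \<in> topspace Z. p z \<in> U}"
        then have "O' z \<in> {A \<in> topspace (orbit_space G Z act). r A \<in> U}" using rO by (simp add: top orbs)
        then show "z \<in> \<Union>{A \<in> topspace (orbit_space G Z act). r A \<in> U}" using mem z by blast
      qed
    qed
    moreover have "openin Z {z \<in> topspace Z. p z \<in> U}" by (rule openin_continuous_map_preimage[OF p(1) U])
    ultimately show "openin (orbit_space G Z act) {A \<in> topspace (orbit_space G Z act). r A \<in> U}"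
      by (auto simp: opn top)
  qed
  have "homeomorphic_map (orbit_space G Z act) X r"
  proof (rule continuous_imp_homeomorphic_map[OF rc co X])
    show "r ` topspace (orbit_space G Z act) = topspace X"
      using rO p(2) by (simp add: top orbs image_image)
    show "inj_on r (topspace (orbit_space G Z act))"
    proof (rule inj_onI)
      fix A B assume "A \<in> topspace (orbit_space G Z act)" "B \<in> topspace (orbit_space G Z act)" "r A = r B"
      then obtain a b where "A = O' a" "B = O' b" "a \<in> topspace Z" "b \<in> topspace Z" by (auto simp: top orbs)
      then show "A = B" using \<open>r A = r B\<close> rO by (simp add: O'_def)
    qed
  qed
  then show ?thesis using homeomorphic_map_imp_homeomorphic_space by blast
qed

subsection \<open>The Cantor group of roots of unity\<close>

lemma prod_topology_euclidean: "prod_topology euclidean euclidean = euclidean"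
  by (simp add: topology_eq openin_prod_topology_alt open_prod_def)

text \<open>The multiplication of roots is transported along \<open>\<omega>\<close> to bit
  sequences, so that the underlying space is literally \<open>cantor_space\<close>. The inverse of
  \<open>\<omega>\<close> is continuous by compactness, which carries over the continuity of the
  operations.\<close>

lemma cantor_group_of_roots:
  assumes M: "\<And>j. M j \<ge> 2"
  shows "\<exists>(G :: (nat \<Rightarrow> bool) monoid) \<omega>. carrier G = UNIV \<and> abelian_cantor_group G cantor_space \<and>
     bij_betw \<omega> UNIV (roots_of_unity M) \<and> continuous_on UNIV \<omega> \<and>
     (\<forall>b c. \<omega> (b \<otimes>\<^bsub>G\<^esub> c) = (\<lambda>j. \<omega> b j * \<omega> c j)) \<and> \<omega> \<one>\<^bsub>G\<^esub> = (\<lambda>_. 1)"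
proof -
  define \<omega> where "\<omega> = root_code M"
  have bij: "bij_betw \<omega> UNIV (roots_of_unity M)" unfolding \<omega>_def by (rule bij_root_code[OF M])
  have c\<omega>: "continuous_on UNIV \<omega>" unfolding \<omega>_def by (rule continuous_on_root_code[OF M])
  have im: "\<omega> ` UNIV = roots_of_unity M" and inj: "inj \<omega>" using bij by (auto simp: bij_betw_def)
  define \<eta> where "\<eta> = inv_into UNIV \<omega>"
  have \<eta>\<omega>: "\<eta> (\<omega> b) = b" for b using inj by (simp add: \<eta>_def)
  have \<omega>\<eta>: "\<omega> (\<eta> \<gamma>) = \<gamma>" if "\<gamma> \<in> roots_of_unity M" for \<gamma>
    using that im by (metis \<eta>_def f_inv_into_f)
  have "continuous_on (\<omega> ` UNIV) \<eta>" by (rule continuous_on_inv[OF c\<omega> compact_bits]) (simp add: \<eta>\<omega>)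
  then have c\<eta>: "continuous_on (roots_of_unity M) \<eta>" by (simp only: im)
  have \<omega>in: "\<omega> b \<in> roots_of_unity M" for b using im by blast
  have root: "\<omega> b j ^ M j = 1" for b j using \<omega>in[of b] M by (simp add: roots_of_unity_def)
  have prod_in: "(\<lambda>j. \<omega> b j * \<omega> c j) \<in> roots_of_unity M" for b c
    by (simp add: roots_of_unity_def M power_mult_distrib root)
  have inv_in: "(\<lambda>j. inverse (\<omega> b j)) \<in> roots_of_unity M" for b
    by (simp add: roots_of_unity_def M power_inverse root)
  have one_in: "(\<lambda>_. 1) \<in> roots_of_unity M" by (simp add: roots_of_unity_def M)
  have nz: "\<omega> b j \<noteq> 0" for b j using root[of b j] M[of j] by (auto simp: power_0_left)
  define G :: "(nat \<Rightarrow> bool) monoid" where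
    "G = \<lparr>carrier = UNIV, mult = (\<lambda>b c. \<eta> (\<lambda>j. \<omega> b j * \<omega> c j)), one = \<eta> (\<lambda>_. 1)\<rparr>"
  have carrier: "carrier G = UNIV" by (simp add: G_def)
  have mult: "\<omega> (b \<otimes>\<^bsub>G\<^esub> c) = (\<lambda>j. \<omega> b j * \<omega> c j)" for b c
    unfolding G_def by (simp add: \<omega>\<eta>[OF prod_in])
  have one: "\<omega> \<one>\<^bsub>G\<^esub> = (\<lambda>_. 1)" unfolding G_def by (simp add: \<omega>\<eta>[OF one_in])
  have linv: "\<eta> (\<lambda>j. inverse (\<omega> b j)) \<otimes>\<^bsub>G\<^esub> b = \<one>\<^bsub>G\<^esub>" for b
    by (rule injD[OF inj]) (simp add: mult one \<omega>\<eta>[OF inv_in] nz)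
  have comm: "comm_group G"
  proof (rule comm_groupI)
    fix x y z
    show "x \<otimes>\<^bsub>G\<^esub> y \<otimes>\<^bsub>G\<^esub> z = x \<otimes>\<^bsub>G\<^esub> (y \<otimes>\<^bsub>G\<^esub> z)"
      by (rule injD[OF inj]) (simp add: mult mult.assoc)
    show "x \<otimes>\<^bsub>G\<^esub> y = y \<otimes>\<^bsub>G\<^esub> x"
      by (rule injD[OF inj]) (simp add: mult mult.commute)
    show "\<one>\<^bsub>G\<^esub> \<otimes>\<^bsub>G\<^esub> x = x"
      by (rule injD[OF inj]) (simp add: mult one)
    show "\<exists>y\<in>carrier G. y \<otimes>\<^bsub>G\<^esub> x = \<one>\<^bsub>G\<^esub>" using linv carrier by blast
  qed (simp_all add: carrier)
  interpret G: comm_group G by (rule comm)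
  have inv: "inv\<^bsub>G\<^esub> b = \<eta> (\<lambda>j. inverse (\<omega> b j))" for b
    by (rule G.inv_equality) (simp_all add: linv carrier)
  have coord: "continuous_on A (\<lambda>z. \<omega> (f z) j)" if "continuous_on A f" for A f and j :: nat
    by (rule continuous_on_product_then_coordinatewise)
       (rule continuous_on_compose2[OF c\<omega> that subset_UNIV])
  have "continuous_on UNIV (\<lambda>z. \<eta> (\<lambda>j. \<omega> (fst z) j * \<omega> (snd z) j))"
    by (rule continuous_on_compose2[OF c\<eta>])
       (use prod_in in \<open>auto intro!: continuous_on_coordinatewise_then_product continuous_on_mult coord
          continuous_on_fst continuous_on_snd continuous_on_id\<close>)
  then have cm: "continuous_on UNIV (\<lambda>(x, y). x \<otimes>\<^bsub>G\<^esub> y)"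
    by (simp add: G_def case_prod_unfold)
  have "continuous_on UNIV (\<lambda>z. \<eta> (\<lambda>j. inverse (\<omega> z j)))"
    by (rule continuous_on_compose2[OF c\<eta>])
       (use inv_in nz in \<open>auto intro!: continuous_on_coordinatewise_then_product continuous_on_inverse coord
          continuous_on_id\<close>)
  then have ci: "continuous_on UNIV (\<lambda>x. inv\<^bsub>G\<^esub> x)" by (simp add: inv)
  have "abelian_cantor_group G cantor_space"
    unfolding abelian_cantor_group_def cantor_space_eq_euclidean prod_topology_euclidean
    using comm cm ci by (simp add: carrier homeomorphic_space_refl)
  then show ?thesis using carrier bij c\<omega> mult one by blast
qed

text \<open>The space \<open>Z\<close> of the theorem is a topology on real sequences. The residues
  modulo \<open>3\<close> hold the base coordinates and the real and imaginary parts of the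
  roots.\<close>

definition interleave :: "(nat \<Rightarrow> real) \<times> (nat \<Rightarrow> complex) \<Rightarrow> nat \<Rightarrow> real" where
  "interleave z k = (if k mod 3 = 0 then fst z (k div 3)
     else if k mod 3 = 1 then Re (snd z (k div 3)) else Im (snd z (k div 3)))"

definition separate :: "(nat \<Rightarrow> real) \<Rightarrow> (nat \<Rightarrow> real) \<times> (nat \<Rightarrow> complex)" where
  "separate y = (\<lambda>k. y (3 * k), \<lambda>k. Complex (y (3 * k + 1)) (y (3 * k + 2)))"

lemma separate_interleave [simp]: "separate (interleave z) = z"
proof -
  have 1: "(3 * k + 1) mod 3 = 1" "(3 * k + 1) div 3 = k" for k :: nat by presburger+
  have 2: "(3 * k + 2) mod 3 = 2" "(3 * k + 2) div 3 = k" for k :: nat by presburger+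
  show ?thesis
    unfolding separate_def interleave_def 1 2 by (simp add: prod_eq_iff)
qed

lemma continuous_on_interleave: "continuous_on A interleave"
proof (rule continuous_on_coordinatewise_then_product)
  fix k
  have f: "continuous_on A (\<lambda>z. fst z i)" for i
    by (rule continuous_on_product_then_coordinatewise) (intro continuous_on_fst continuous_on_id)
  have s: "continuous_on A (\<lambda>z. snd z i)" for i
    by (rule continuous_on_product_then_coordinatewise) (intro continuous_on_snd continuous_on_id)
  show "continuous_on A (\<lambda>z. interleave z k)"
    unfolding interleave_def
    by (cases "k mod 3 = 0"; cases "k mod 3 = 1") (simp_all add: f continuous_on_Re continuous_on_Im s)
qed

lemma continuous_on_separate: "continuous_on A separate"
proof -
  have c: "continuous_on A (\<lambda>y::nat \<Rightarrow> real. y i)" for i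
    by (rule continuous_on_product_then_coordinatewise) (rule continuous_on_id)
  show ?thesis
    unfolding separate_def
    by (intro continuous_on_Pair continuous_on_coordinatewise_then_product continuous_on_Complex c)
qed

section \<open>Assembly of the space, the group action and the two bounds\<close>

theorem mainTheorem3:
  fixes X :: "'a topology" and n :: nat
  assumes "compactum X" and "rat_cohom_dim_one X" and "covering_dim X (int n)"
  shows "\<exists>(Z :: (nat \<Rightarrow> real) topology) (G :: (nat \<Rightarrow> bool) monoid) (T :: (nat \<Rightarrow> bool) topology) act.
           compactum Z \<and> abelian_cantor_group G T \<and> free_continuous_action G T Z act \<and>
           orbit_space G Z act homeomorphic_space X \<and>
           (2 \<le> n \<and> n \<le> 6 \<longrightarrow> covering_dim_le Z (int n - 1)) \<and>
           (7 \<le> n \<longrightarrow> covering_dim_le Z (int (n div 2) + 2))"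
proof -
  have H: "rat_cohom_dim_le X 1" using assms(2) by (simp add: rat_cohom_dim_one_def)
  obtain S :: "(nat \<Rightarrow> real) set" and \<phi> \<psi> where S: "compact S"
    and hom: "homeomorphic_maps X (top_of_set S) \<phi> \<psi>"
    using compactum_embeds_in_sequences[OF assms(1)] by blast
  have "X homeomorphic_space top_of_set S" using hom by (auto simp: homeomorphic_space_def)
  moreover have "covering_dim_le X (int n)" using assms(3) by (simp add: covering_dim_def)
  ultimately have "covering_dim_le (top_of_set S) (int n)" by (rule covering_dim_le_homeomorphic)
  then have fine: "fine_covers S n" by (rule fine_covers_if_covering_dim_le[OF S])
  from countable_dense_circle_maps[OF S]
  obtain D :: "nat \<Rightarrow> (nat \<Rightarrow> real) \<Rightarrow> complex" where
    D: "\<forall>j. continuous_on S (D j) \<and> (\<forall>x\<in>S. norm (D j x) = 1)"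
    and dense: "\<forall>F. continuous_on S F \<and> (\<forall>x\<in>S. norm (F x) = 1) \<longrightarrow> (\<exists>j. \<forall>x\<in>S. norm (F x - D j x) < 1)"
    by (elim exE conjE)
  \<comment> \<open>\<open>prod_decode\<close> runs through all pairs of a map and an exponent; the
    shift by \<open>2\<close> in \<open>M\<close> makes the exponents exactly the numbers from
    \<open>2\<close> on.\<close>
  define F where "F j = D (fst (prod_decode j))" for j
  define M where "M j = snd (prod_decode j) + 2" for j
  have M2: "M j \<ge> 2" for j by (simp add: M_def)
  interpret root_tower S F M
    by standard (use S D in \<open>auto simp: F_def M_def\<close>)
  have dense': "\<exists>j. M j = m \<and> (\<forall>x\<in>S. norm (F' x - F j x) < 1)"
    if F': "continuous_on S F'" "\<And>x. x \<in> S \<Longrightarrow> norm (F' x) = 1" and m: "m \<ge> 2" for F' m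
  proof -
    obtain i where "\<forall>x\<in>S. norm (F' x - D i x) < 1" using dense F' by blast
    then show ?thesis
      using m by (intro exI[of _ "prod_encode (i, m - 2)"]) (simp add: F_def M_def)
  qed
  have ext: "\<exists>g. continuous_on root_space g \<and> (\<forall>z\<in>root_space. norm (g z) = 1) \<and>
           (\<forall>z\<in>root_space. fst z \<in> A \<longrightarrow> g z = (f (fst z) :: complex))"
    if A: "closed A" "A \<subseteq> S" and f: "continuous_on A f" "\<And>x. x \<in> A \<Longrightarrow> norm (f x) = 1" for A f
  proof -
    have "\<exists>(m::nat) F \<Theta>. m \<ge> 2 \<and> continuous_on S F \<and> (\<forall>x\<in>S. norm (F x) = 1) \<and>
        continuous_on A \<Theta> \<and> (\<forall>x\<in>A. f x ^ m * F x = cis (real m * \<Theta> x))"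
      by (rule circle_map_power_extends[OF hom S H A]) (fact f)+
    then obtain m :: nat and F' \<Theta> where P: "m \<ge> 2" "continuous_on S F'" "continuous_on A \<Theta>"
      and "\<forall>x\<in>S. norm (F' x) = 1" "\<forall>x\<in>A. f x ^ m * F' x = cis (real m * \<Theta> x)"
      by (elim exE conjE)
    then have P': "\<And>x. x \<in> S \<Longrightarrow> norm (F' x) = 1"
      "\<And>x. x \<in> A \<Longrightarrow> f x ^ m * F' x = cis (real m * \<Theta> x)"
      by blast+
    show ?thesis
      by (rule circle_map_extends_over_root_space[OF _ A P(1,2) _ P(3) _ f(1)]) (fact dense' P' f)+
  qed
  define Z where "Z = top_of_set (interleave ` root_space)"
  have cZ: "compact (interleave ` root_space)"
    by (rule compact_continuous_image[OF continuous_on_interleave compact_root_space])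
  have compactumZ: "compactum Z"
    unfolding compactum_def Z_def
    using cZ by (simp add: compact_space_subtopology metrizable_space_subtopology metrizable_space_euclidean)
  have homZ: "top_of_set root_space homeomorphic_space Z"
    unfolding homeomorphic_space_def homeomorphic_maps_def Z_def
    by (intro exI[of _ interleave] exI[of _ separate]) (auto simp: continuous_on_interleave continuous_on_separate)
  have dim: "covering_dim_le Z (int r + 1)" if "2 * r > n \<or> n = r + 2" for r
  proof -
    have "unstable_zero root_space (r + 2)" by (rule unstable_zero_root_space[OF fine that ext])
    then have "covering_dim_le (top_of_set root_space) (int (r + 2) - 1)"
      by (rule covering_dim_le_if_unstable_zero[OF compact_root_space])
    then have "covering_dim_le Z (int (r + 2) - 1)" by (rule covering_dim_le_homeomorphic[OF homZ])
    moreover have "int (r + 2) - 1 = int r + 1" by simp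
    ultimately show ?thesis by (simp only:)
  qed
  obtain G :: "(nat \<Rightarrow> bool) monoid" and \<omega> where G: "carrier G = UNIV" "abelian_cantor_group G cantor_space"
    and bij: "bij_betw \<omega> UNIV (roots_of_unity M)" and c\<omega>: "continuous_on UNIV \<omega>"
    and mult: "\<And>b c. \<omega> (b \<otimes>\<^bsub>G\<^esub> c) = (\<lambda>j. \<omega> b j * \<omega> c j)" and one: "\<omega> \<one>\<^bsub>G\<^esub> = (\<lambda>_. 1)"
    using cantor_group_of_roots[of M, OF M2] by blast
  have root: "\<omega> b j ^ M j = 1" for b j
    using bij_betw_apply[OF bij, of b] by (simp add: roots_of_unity_def M2)
  define tr where "tr b z = (fst z, \<lambda>j. \<omega> b j * snd z j)" for b and z :: "(nat \<Rightarrow> real) \<times> (nat \<Rightarrow> complex)"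
  have tr_in: "tr b z \<in> root_space" if "z \<in> root_space" for b z
    using that by (auto simp: root_space_def tr_def power_mult_distrib root)
  define act where "act b y = interleave (tr b (separate y))" for b y
  have nz: "snd z j \<noteq> 0" if "z \<in> root_space" for z j
    using norm_root[of "snd z j" j "fst z"] that by (auto simp: root_space_def)
  have free: "free_continuous_action G cantor_space Z act"
    unfolding free_continuous_action_def
  proof (intro conjI ballI impI)
    fix b y assume "y \<in> topspace Z"
    then obtain z where z: "z \<in> root_space" "y = interleave z" by (auto simp: Z_def)
    show "act b y \<in> topspace Z" using tr_in[OF z(1)] by (simp add: Z_def act_def z(2))
    assume "act b y = y"
    then have "separate (act b y) = z" by (simp add: z(2))
    then have "tr b z = z" by (simp add: act_def z(2))
    then have "\<omega> b j * snd z j = snd z j" for j by (metis snd_conv tr_def)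
    then have "\<omega> b j = 1" for j using nz[OF z(1)] by simp
    then have "\<omega> b = \<omega> \<one>\<^bsub>G\<^esub>" using one by auto
    then show "b = \<one>\<^bsub>G\<^esub>" using bij by (auto simp: bij_betw_def inj_on_def)
  next
    fix y assume "y \<in> topspace Z"
    then obtain z where "y = interleave z" by (auto simp: Z_def)
    then show "act \<one>\<^bsub>G\<^esub> y = y" by (simp add: act_def tr_def one)
  next
    fix b c y
    show "act (b \<otimes>\<^bsub>G\<^esub> c) y = act b (act c y)" by (simp add: act_def tr_def mult mult.assoc)
  next
    have cact: "continuous_on A (\<lambda>p. act (fst p) (snd p))" for A
    proof -
      have "continuous_on A (\<lambda>p. \<omega> (fst p))"
        by (rule continuous_on_compose2[OF c\<omega> _ subset_UNIV]) (intro continuous_on_fst continuous_on_id)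
      then have 1: "continuous_on A (\<lambda>p. \<omega> (fst p) j)" for j by (rule continuous_on_product_then_coordinatewise)
      have 2: "continuous_on A (\<lambda>p. separate (snd p))"
        by (rule continuous_on_compose2[OF continuous_on_separate[of UNIV] _ subset_UNIV])
           (intro continuous_on_snd continuous_on_id)
      have 3: "continuous_on A (\<lambda>p. snd (separate (snd p)) j)" for j
        by (rule continuous_on_product_then_coordinatewise) (rule continuous_on_snd[OF 2])
      have "continuous_on A (\<lambda>p. tr (fst p) (separate (snd p)))"
        unfolding tr_def
        by (intro continuous_on_Pair continuous_on_fst 2 continuous_on_coordinatewise_then_product continuous_on_mult 1 3)
      then show ?thesis
        unfolding act_def by (rule continuous_on_compose2[OF continuous_on_interleave[of UNIV] _ subset_UNIV])
    qed
    have "prod_topology cantor_space Z = top_of_set (UNIV \<times> interleave ` root_space)"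
      unfolding cantor_space_eq_euclidean Z_def prod_topology_subtopology prod_topology_euclidean by simp
    moreover have "act b y \<in> interleave ` root_space" if "y \<in> interleave ` root_space" for b y
      using that tr_in by (auto simp: act_def)
    ultimately show "continuous_map (prod_topology cantor_space Z) Z (\<lambda>(g, z). act g z)"
      using cact by (auto simp: Z_def case_prod_unfold)
  qed
  have \<psi>: "continuous_map (top_of_set S) X \<psi>" and \<phi>\<psi>: "\<And>x. x \<in> S \<Longrightarrow> \<phi> (\<psi> x) = x"
    and \<psi>S: "\<psi> ` S = topspace X"
    using hom homeomorphic_imp_surjective_map[OF homeomorphic_maps_imp_map[OF homeomorphic_maps_sym[THEN iffD1, OF hom]]]
    by (auto simp: homeomorphic_maps_def)
  have orb: "orbit_space G Z act homeomorphic_space X"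
  proof (rule orbit_space_homeomorphic[where p = "\<lambda>y. \<psi> (fst (separate y))"])
    show "compact_space Z" using compactumZ by (simp add: compactum_def)
    show "Hausdorff_space X" using assms(1) by (simp add: compactum_def metrizable_imp_Hausdorff_space)
    have "continuous_map Z (top_of_set S) (\<lambda>y. fst (separate y))"
      using continuous_on_fst[OF continuous_on_separate] by (auto simp: Z_def root_space_def)
    from continuous_map_compose[OF this \<psi>]
    show "continuous_map Z X (\<lambda>y. \<psi> (fst (separate y)))" by (simp add: o_def)
    have "fst ` root_space = S"
    proof
      show "S \<subseteq> fst ` root_space"
      proof
        fix x assume x: "x \<in> S"
        \<comment> \<open>Surjectivity asks for roots at the single point \<open>x\<close> only, so
          the discontinuity of the principal logarithm is harmless.\<close>
        have "exp (Ln (F j x) / of_nat (M j)) ^ M j = F j x" for j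
        proof -
          have "exp (Ln (F j x) / of_nat (M j)) ^ M j = exp (of_nat (M j) * (Ln (F j x) / of_nat (M j)))"
            by (rule exp_of_nat_mult[symmetric])
          also have "of_nat (M j) * (Ln (F j x) / of_nat (M j)) = Ln (F j x)" using M2[of j] by simp
          also have "exp (Ln (F j x)) = F j x" using F(2)[OF x, of j] by (intro exp_Ln) auto
          finally show ?thesis .
        qed
        then have "(x, \<lambda>j. exp (Ln (F j x) / of_nat (M j))) \<in> root_space" using x by (simp add: root_space_def)
        then show "x \<in> fst ` root_space" by force
      qed
    qed (auto simp: root_space_def)
    then show "(\<lambda>y. \<psi> (fst (separate y))) ` topspace Z = topspace X"
      by (simp add: Z_def image_image flip: \<psi>S)
         (simp flip: image_image[of \<psi> fst root_space])
    fix y assume "y \<in> topspace Z"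
    then obtain z where z: "z \<in> root_space" "y = interleave z" by (auto simp: Z_def)
    show "{act g y |g. g \<in> carrier G} = {y' \<in> topspace Z. \<psi> (fst (separate y')) = \<psi> (fst (separate y))}"
    proof
      show "{act g y |g. g \<in> carrier G} \<subseteq> {y' \<in> topspace Z. \<psi> (fst (separate y')) = \<psi> (fst (separate y))}"
        using tr_in[OF z(1)] by (auto simp: act_def z(2) Z_def tr_def)
      show "{y' \<in> topspace Z. \<psi> (fst (separate y')) = \<psi> (fst (separate y))} \<subseteq> {act g y |g. g \<in> carrier G}"
      proof
        fix y' assume y': "y' \<in> {y' \<in> topspace Z. \<psi> (fst (separate y')) = \<psi> (fst (separate y))}"
        then obtain z' where z': "z' \<in> root_space" "y' = interleave z'" by (auto simp: Z_def)
        have xS: "fst z \<in> S" "fst z' \<in> S" using z z' by (auto simp: root_space_def)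
        have "\<psi> (fst z') = \<psi> (fst z)" using y' z z' by simp
        then have x: "fst z' = fst z" using \<phi>\<psi> xS by metis
        have pw: "snd z j ^ M j = F j (fst z)" "snd z' j ^ M j = F j (fst z)" for j
          using z(1) z'(1) x by (auto simp: root_space_def)
        have Fnz: "F j (fst z) \<noteq> 0" for j using F(2)[OF xS(1), of j] by auto
        \<comment> \<open>The quotients of corresponding roots form the group element that carries
          \<open>z\<close> to \<open>z'\<close>.\<close>
        have "(\<lambda>j. snd z' j / snd z j) \<in> roots_of_unity M"
          by (simp add: roots_of_unity_def M2 power_divide pw Fnz)
        then obtain g where g: "\<omega> g = (\<lambda>j. snd z' j / snd z j)"
          using bij by (metis bij_betw_imp_surj_on imageE)
        have "tr g z = z'" using nz[OF z(1)] x by (simp add: tr_def g prod_eq_iff)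
        then have "act g y = y'" by (simp add: act_def z(2) z'(2))
        then show "y' \<in> {act g y |g. g \<in> carrier G}" using G(1) by blast
      qed
    qed
  qed
  have "covering_dim_le Z (int n - 1)" if "2 \<le> n"
  proof -
    have "n = (n - 2) + 2" using that by simp
    then have "covering_dim_le Z (int (n - 2) + 1)" by (intro dim disjI2)
    moreover have "int (n - 2) + 1 = int n - 1" using that by simp
    ultimately show ?thesis by (simp only:)
  qed
  moreover have "covering_dim_le Z (int (n div 2) + 2)"
  proof -
    \<comment> \<open>\<open>n div 2 + 1\<close> is the least \<open>r\<close> with
      \<open>2 * r > n\<close>.\<close>
    have "2 * (n div 2 + 1) > n" by presburger
    then show ?thesis using dim[of "n div 2 + 1"] by (simp add: add.commute add.left_commute)
  qed
  ultimately show ?thesis using compactumZ G(2) free orb by blast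
qed

end
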